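(* Let $q$ be a power of a prime $p$, let $\mathbb{F}_q$ be the finite field with $q$ elements, let $V$ be an $\mathbb{F}_q$-vector space of finite dimension $d$, and let $G \subseteq GL(V)$ be a subgroup. Let $R = \mathbb{F}_q[V] = \operatorname{Sym}(V^* )$ and $S = R^G$. For $i \geq 0$ let $J_i = \operatorname{ann}_S H^i(G,R)$. Then for every $i \geq 0$ the ideal $J_i$ is a $\mathcal{P}^*$-invariant ideal of $S$.
   Context: The group $G$ (which is finite) acts on $V^*$ by the dual action and on $R = \operatorname{Sym}(V^* )$ by the induced $\mathbb{F}_q$-algebra automorphisms. $R$ is a module over the group ring $S[G]$, and $H^i(G,-)$ denotes the $i$-th right derived functor of the fixed-point functor $M \mapsto M^G$ from $S[G]$-modules to $S$-modules (equivalently $H^i(G,M) = \operatorname{Ext}^i_{S[G]}(S,M)$), so $H^i(G,R)$ is an $S$-module. Steenrod operators: let $P(\xi)\colon \mathbb{F}_q[V] \to \mathbb{F}_q[V][\xi]$ be the $\mathbb{F}_q$-algebra homomorphism determined by $P(\xi)(v) = v + v^q\xi$ for all $v \in V^*$. The $\mathbb{F}_q$-linear maps $\mathcal{P}^i \colon \mathbb{F}_q[V] \to \mathbb{F}_q[V]$, $i \geq 0$, are defined by $P(\xi)(f) = \sum_{i \geq 0} \mathcal{P}^i(f)\xi^i$. $\mathcal{P}^0$ is the identity. (For $p=2$ these are also written $\mathcal{S}_q^i$.) The maps $\mathcal{P}^i$ commute with the action of $G$, so they restrict to maps $\mathcal{P}^i \colon S \to S$. An ideal $I$ of $S$ is called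 $\mathcal{P}^*$-invariant if $\mathcal{P}^m(I) \subseteq I$ for all $m \geq 0$. *)

theory Defs
  imports
    Complex_Main
    "HOL-Library.Poly_Mapping"
    "HOL-Library.Cardinality"
    "HOL-Computational_Algebra.Primes"
    "HOL-Algebra.QuotRing"
    "HOL-Algebra.UnivPoly"
begin

section \<open>Left modules over a ring, injective resolutions\<close>

text \<open>
  The locale \<^locale>\<open>module\<close> of HOL-Algebra requires a commutative ring of scalars; group rings are
  not commutative in general. In records of type \<^typ>\<open>('a, 'b) module\<close> that are used as modules,
  the fields \<^const>\<open>mult\<close> and \<^const>\<open>one\<close> carry no information.
\<close>

locale left_module = A?: ring A + M?: abelian_group M
  for A :: "('a, 'm) ring_scheme" (structure) and M :: "('a, 'b, 'n) module_scheme" (structure) +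
  assumes smult_closed:
      "a \<in> carrier A \<Longrightarrow> x \<in> carrier M \<Longrightarrow> a \<odot>\<^bsub>M\<^esub> x \<in> carrier M"
    and smult_l_distr:
      "a \<in> carrier A \<Longrightarrow> b \<in> carrier A \<Longrightarrow> x \<in> carrier M \<Longrightarrow>
        (a \<oplus>\<^bsub>A\<^esub> b) \<odot>\<^bsub>M\<^esub> x = a \<odot>\<^bsub>M\<^esub> x \<oplus>\<^bsub>M\<^esub> b \<odot>\<^bsub>M\<^esub> x"
    and smult_r_distr:
      "a \<in> carrier A \<Longrightarrow> x \<in> carrier M \<Longrightarrow> y \<in> carrier M \<Longrightarrow>
        a \<odot>\<^bsub>M\<^esub> (x \<oplus>\<^bsub>M\<^esub> y) = a \<odot>\<^bsub>M\<^esub> x \<oplus>\<^bsub>M\<^esub> a \<odot>\<^bsub>M\<^esub> y"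
    and smult_assoc:
      "a \<in> carrier A \<Longrightarrow> b \<in> carrier A \<Longrightarrow> x \<in> carrier M \<Longrightarrow>
        (a \<otimes>\<^bsub>A\<^esub> b) \<odot>\<^bsub>M\<^esub> x = a \<odot>\<^bsub>M\<^esub> (b \<odot>\<^bsub>M\<^esub> x)"
    and smult_one:
      "x \<in> carrier M \<Longrightarrow> \<one>\<^bsub>A\<^esub> \<odot>\<^bsub>M\<^esub> x = x"

definition left_module_hom ::
  "('a, 'm) ring_scheme \<Rightarrow> ('a, 'b, 'n) module_scheme \<Rightarrow> ('a, 'c, 'o) module_scheme \<Rightarrow> ('b \<Rightarrow> 'c) set"
  where "left_module_hom A M N = {f \<in> carrier M \<rightarrow> carrier N.
    (\<forall>x\<in>carrier M. \<forall>y\<in>carrier M. f (x \<oplus>\<^bsub>M\<^esub> y) = f x \<oplus>\<^bsub>N\<^esub> f y) \<and>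
    (\<forall>a\<in>carrier A. \<forall>x\<in>carrier M. f (a \<odot>\<^bsub>M\<^esub> x) = a \<odot>\<^bsub>N\<^esub> f x)}"

text \<open>
  In the extension property, the test modules \<open>M \<le> N\<close> have to live in some fixed type.
  The type \<^typ>\<open>nat \<Rightarrow> 'a\<close> contains isomorphic copies of \<open>A\<close> and of all its left ideals
  (and of all submodules of finitely generated free modules), so that, by Baer's criterion,
  this is injectivity with respect to all left \<open>A\<close>-modules.
\<close>

definition injective_module ::
  "('a, 'm) ring_scheme \<Rightarrow> ('a, 'b, 'n) module_scheme \<Rightarrow> bool"
  where "injective_module A E \<longleftrightarrow> left_module A E \<and>
    (\<forall>(M :: ('a, nat \<Rightarrow> 'a) module) (N :: ('a, nat \<Rightarrow> 'a) module).
      left_module A M \<longrightarrow> left_module A N \<longrightarrow>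
      (\<forall>f\<in>left_module_hom A M N. \<forall>g\<in>left_module_hom A M E. inj_on f (carrier M) \<longrightarrow>
        (\<exists>h\<in>left_module_hom A N E. \<forall>x\<in>carrier M. h (f x) = g x)))"

text \<open>\<open>0 \<longrightarrow> M \<longrightarrow> E 0 \<longrightarrow> E 1 \<longrightarrow> \<dots>\<close> is exact, with augmentation \<open>\<epsilon>\<close> and differentials \<open>\<delta> n\<close>.\<close>

definition injective_resolution ::
  "('a, 'm) ring_scheme \<Rightarrow> ('a, 'c, 'n) module_scheme \<Rightarrow> ('c \<Rightarrow> 'b) \<Rightarrow>
    (nat \<Rightarrow> ('a, 'b) module) \<Rightarrow> (nat \<Rightarrow> 'b \<Rightarrow> 'b) \<Rightarrow> bool"
  where "injective_resolution A M \<epsilon> E \<delta> \<longleftrightarrow>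
    (\<forall>n. injective_module A (E n)) \<and>
    \<epsilon> \<in> left_module_hom A M (E 0) \<and>
    (\<forall>n. \<delta> n \<in> left_module_hom A (E n) (E (Suc n))) \<and>
    inj_on \<epsilon> (carrier M) \<and>
    \<epsilon> ` carrier M = {x \<in> carrier (E 0). \<delta> 0 x = \<zero>\<^bsub>E (Suc 0)\<^esub>} \<and>
    (\<forall>n. \<delta> n ` carrier (E n) =
      {x \<in> carrier (E (Suc n)). \<delta> (Suc n) x = \<zero>\<^bsub>E (Suc (Suc n))\<^esub>})"

definition cocycles ::
  "(nat \<Rightarrow> ('a, 'b) module) \<Rightarrow> (nat \<Rightarrow> 'b \<Rightarrow> 'b) \<Rightarrow> nat \<Rightarrow> 'b set"
  where "cocycles C \<delta> n = {x \<in> carrier (C n). \<delta> n x = \<zero>\<^bsub>C (Suc n)\<^esub>}"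

fun coboundaries ::
  "(nat \<Rightarrow> ('a, 'b) module) \<Rightarrow> (nat \<Rightarrow> 'b \<Rightarrow> 'b) \<Rightarrow> nat \<Rightarrow> 'b set"
  where
    "coboundaries C \<delta> 0 = {\<zero>\<^bsub>C 0\<^esub>}"
  | "coboundaries C \<delta> (Suc n) = \<delta> n ` carrier (C n)"

text \<open>The quotient module of cocycles by coboundaries; its elements are cosets.\<close>

definition cohomology ::
  "(nat \<Rightarrow> ('a, 'b) module) \<Rightarrow> (nat \<Rightarrow> 'b \<Rightarrow> 'b) \<Rightarrow> nat \<Rightarrow> ('a, 'b set) module"
  where "cohomology C \<delta> n =
    \<lparr>carrier = (\<lambda>z. coboundaries C \<delta> n +>\<^bsub>C n\<^esub> z) ` cocycles C \<delta> n,
     mult = undefined, one = undefined,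
     zero = coboundaries C \<delta> n,
     add = set_add (C n),
     smult = (\<lambda>s X. \<Union>x\<in>X. coboundaries C \<delta> n +>\<^bsub>C n\<^esub> (s \<odot>\<^bsub>C n\<^esub> x))\<rparr>"

definition annihilator ::
  "('a, 'm) ring_scheme \<Rightarrow> ('a, 'b, 'n) module_scheme \<Rightarrow> 'a set"
  where "annihilator S M = {s \<in> carrier S. \<forall>x\<in>carrier M. s \<odot>\<^bsub>M\<^esub> x = \<zero>\<^bsub>M\<^esub>}"


section \<open>Group rings and group cohomology\<close>

text \<open>The group ring \<open>S[G]\<close> of a finite group \<open>G\<close>; its elements are functions from \<open>G\<close> to \<open>S\<close>.\<close>

definition group_ring ::
  "('r, 'm) ring_scheme \<Rightarrow> ('g, 'n) monoid_scheme \<Rightarrow> ('g \<Rightarrow> 'r) ring"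
  where "group_ring S G =
    \<lparr>carrier = carrier G \<rightarrow>\<^sub>E carrier S,
     mult = (\<lambda>a b. \<lambda>x\<in>carrier G.
       \<Oplus>\<^bsub>S\<^esub>g\<in>carrier G. a g \<otimes>\<^bsub>S\<^esub> b (inv\<^bsub>G\<^esub> g \<otimes>\<^bsub>G\<^esub> x)),
     one = (\<lambda>x\<in>carrier G. if x = \<one>\<^bsub>G\<^esub> then \<one>\<^bsub>S\<^esub> else \<zero>\<^bsub>S\<^esub>),
     zero = (\<lambda>x\<in>carrier G. \<zero>\<^bsub>S\<^esub>),
     add = (\<lambda>a b. \<lambda>x\<in>carrier G. a x \<oplus>\<^bsub>S\<^esub> b x)\<rparr>"

text \<open>The element \<open>s g\<close> of \<open>S[G]\<close>.\<close>

definition group_ring_single ::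
  "('r, 'm) ring_scheme \<Rightarrow> ('g, 'n) monoid_scheme \<Rightarrow> 'r \<Rightarrow> 'g \<Rightarrow> ('g \<Rightarrow> 'r)"
  where "group_ring_single S G s g = (\<lambda>x\<in>carrier G. if x = g then s else \<zero>\<^bsub>S\<^esub>)"

text \<open>The fixed-point functor from \<open>S[G]\<close>-modules to \<open>S\<close>-modules (on objects).\<close>

definition fixed_points ::
  "('r, 'm) ring_scheme \<Rightarrow> ('g, 'n) monoid_scheme \<Rightarrow> ('g \<Rightarrow> 'r, 'b) module \<Rightarrow> ('r, 'b) module"
  where "fixed_points S G M =
    \<lparr>carrier = {x \<in> carrier M. \<forall>g\<in>carrier G. group_ring_single S G \<one>\<^bsub>S\<^esub> g \<odot>\<^bsub>M\<^esub> x = x},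
     mult = undefined, one = undefined,
     zero = \<zero>\<^bsub>M\<^esub>,
     add = add M,
     smult = (\<lambda>s x. group_ring_single S G s \<one>\<^bsub>G\<^esub> \<odot>\<^bsub>M\<^esub> x)\<rparr>"

text \<open>
  The right derived functors of the fixed-point functor, computed from an injective resolution
  \<open>(E, \<delta>)\<close>. The functor maps a morphism to its restriction, so the differentials are again \<open>\<delta>\<close>.
\<close>

definition group_cohomology ::
  "('r, 'm) ring_scheme \<Rightarrow> ('g, 'n) monoid_scheme \<Rightarrow>
    (nat \<Rightarrow> ('g \<Rightarrow> 'r, 'b) module) \<Rightarrow> (nat \<Rightarrow> 'b \<Rightarrow> 'b) \<Rightarrow> nat \<Rightarrow> ('r, 'b set) module"
  where "group_cohomology S G E \<delta> i = cohomology (\<lambda>n. fixed_points S G (E n)) \<delta> i"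

definition invariant_ring ::
  "'r ring \<Rightarrow> ('g, 'n) monoid_scheme \<Rightarrow> ('g \<Rightarrow> 'r \<Rightarrow> 'r) \<Rightarrow> 'r ring"
  where "invariant_ring R G act = R\<lparr>carrier := {r \<in> carrier R. \<forall>g\<in>carrier G. act g r = r}\<rparr>"

text \<open>The ring \<open>R\<close> with a \<open>G\<close>-action as a module over \<open>S[G]\<close>, where \<open>S\<close> is the ring of invariants.\<close>

definition group_ring_module ::
  "'r ring \<Rightarrow> ('g, 'n) monoid_scheme \<Rightarrow> ('g \<Rightarrow> 'r \<Rightarrow> 'r) \<Rightarrow> ('g \<Rightarrow> 'r, 'r) module"
  where "group_ring_module R G act =
    \<lparr>carrier = carrier R, mult = undefined, one = undefined, zero = \<zero>\<^bsub>R\<^esub>, add = add R,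
     smult = (\<lambda>a r. \<Oplus>\<^bsub>R\<^esub>g\<in>carrier G. a g \<otimes>\<^bsub>R\<^esub> act g r)\<rparr>"


section \<open>The symmetric algebra of the dual space\<close>

definition general_linear_group ::
  "('k::field \<Rightarrow> 'v::ab_group_add \<Rightarrow> 'v) \<Rightarrow> ('v \<Rightarrow> 'v) monoid"
  where "general_linear_group scale =
    \<lparr>carrier = {g. Vector_Spaces.linear scale scale g \<and> bij g}, mult = (\<circ>), one = id\<rparr>"

definition dual_space :: "('k::field \<Rightarrow> 'v::ab_group_add \<Rightarrow> 'v) \<Rightarrow> ('v \<Rightarrow> 'k) set"
  where "dual_space scale = {l. Vector_Spaces.linear scale (*) l}"

text \<open>
  The polynomial ring over \<open>'k\<close> with the set \<open>X\<close> of indeterminates; its elements are finitely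
  supported maps from monomials (finitely supported exponent functions) to coefficients.
\<close>

type_synonym ('x, 'k) mpoly = "('x \<Rightarrow>\<^sub>0 nat) \<Rightarrow>\<^sub>0 'k"

definition mpoly_ring :: "'x set \<Rightarrow> ('x, 'k::field) mpoly ring"
  where "mpoly_ring X =
    \<lparr>carrier = {f. \<forall>m\<in>Poly_Mapping.keys f. Poly_Mapping.keys m \<subseteq> X},
     mult = (*), one = 1, zero = 0, add = (+)\<rparr>"

definition mpoly_const :: "'k::field \<Rightarrow> ('x, 'k) mpoly"
  where "mpoly_const c = Poly_Mapping.single 0 c"

definition mpoly_var :: "'x \<Rightarrow> ('x, 'k::field) mpoly"
  where "mpoly_var x = Poly_Mapping.single (Poly_Mapping.single x 1) 1"

text \<open>
  For a vector space \<open>W\<close> of functions with values in \<open>'k\<close> (with pointwise operations),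
  \<open>Sym(W)\<close> is the polynomial ring on the set \<open>W\<close> modulo the relations which make the map from \<open>W\<close>
  to \<open>Sym(W)\<close> linear. It is not identified with the ring of polynomial functions, which is smaller
  over a finite field.
\<close>

definition sym_relations :: "('v \<Rightarrow> 'k::field) set \<Rightarrow> ('v \<Rightarrow> 'k, 'k) mpoly set"
  where "sym_relations W =
    {mpoly_var (\<lambda>v. l v + m v) - mpoly_var l - mpoly_var m | l m. l \<in> W \<and> m \<in> W} \<union>
    {mpoly_var (\<lambda>v. c * l v) - mpoly_const c * mpoly_var l | c l. l \<in> W}"

definition sym_ideal :: "('v \<Rightarrow> 'k::field) set \<Rightarrow> ('v \<Rightarrow> 'k, 'k) mpoly set"
  where "sym_ideal W = Idl\<^bsub>mpoly_ring W\<^esub> (sym_relations W)"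

definition sym_alg :: "('v \<Rightarrow> 'k::field) set \<Rightarrow> ('v \<Rightarrow> 'k, 'k) mpoly set ring"
  where "sym_alg W = mpoly_ring W Quot sym_ideal W"

definition sym_const :: "('v \<Rightarrow> 'k::field) set \<Rightarrow> 'k \<Rightarrow> ('v \<Rightarrow> 'k, 'k) mpoly set"
  where "sym_const W c = sym_ideal W +>\<^bsub>mpoly_ring W\<^esub> mpoly_const c"

definition sym_gen :: "('v \<Rightarrow> 'k::field) set \<Rightarrow> ('v \<Rightarrow> 'k) \<Rightarrow> ('v \<Rightarrow> 'k, 'k) mpoly set"
  where "sym_gen W l = sym_ideal W +>\<^bsub>mpoly_ring W\<^esub> mpoly_var l"

text \<open>
  The homomorphism of \<open>'k\<close>-algebras from \<open>Sym(W)\<close> to \<open>B\<close> determined by its restriction \<open>\<phi>\<close> to \<open>W\<close>;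
  the \<open>'k\<close>-algebra structure of \<open>B\<close> is the ring homomorphism \<open>\<kappa>\<close> from \<open>'k\<close> to \<open>B\<close>.
\<close>

definition sym_lift ::
  "('v \<Rightarrow> 'k::field) set \<Rightarrow> ('b, 'm) ring_scheme \<Rightarrow> ('k \<Rightarrow> 'b) \<Rightarrow> (('v \<Rightarrow> 'k) \<Rightarrow> 'b) \<Rightarrow>
    ('v \<Rightarrow> 'k, 'k) mpoly set \<Rightarrow> 'b"
  where "sym_lift W B \<kappa> \<phi> = (THE h.
    h \<in> ring_hom (sym_alg W) B \<and> h \<in> extensional (carrier (sym_alg W)) \<and>
    (\<forall>c. h (sym_const W c) = \<kappa> c) \<and> (\<forall>l\<in>W. h (sym_gen W l) = \<phi> l))"

type_synonym ('v, 'k) sym = "('v \<Rightarrow> 'k, 'k) mpoly set"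

text \<open>\<open>\<bbbF>\<^sub>q[V]\<close>\<close>

definition polys :: "('k::field \<Rightarrow> 'v::ab_group_add \<Rightarrow> 'v) \<Rightarrow> ('v, 'k) sym ring"
  where "polys scale = sym_alg (dual_space scale)"

text \<open>The dual action of \<open>g\<close> on \<open>V\<^sup>*\<close> is \<open>l \<mapsto> l \<circ> g\<^sup>-\<^sup>1\<close>.\<close>

definition polys_act ::
  "('k::field \<Rightarrow> 'v::ab_group_add \<Rightarrow> 'v) \<Rightarrow> ('v \<Rightarrow> 'v) \<Rightarrow> ('v, 'k) sym \<Rightarrow> ('v, 'k) sym"
  where "polys_act scale g =
    sym_lift (dual_space scale) (polys scale) (sym_const (dual_space scale))
      (\<lambda>l. sym_gen (dual_space scale) (l \<circ> Hilbert_Choice.inv g))"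


section \<open>Steenrod operations\<close>

text \<open>The homomorphism \<open>P(\<xi>)\<close>; the ring of polynomials in \<open>\<xi>\<close> over \<open>\<bbbF>\<^sub>q[V]\<close> is \<open>UP (polys scale)\<close>.\<close>

definition total_steenrod ::
  "('k::{field,finite} \<Rightarrow> 'v::ab_group_add \<Rightarrow> 'v) \<Rightarrow> ('v, 'k) sym \<Rightarrow> nat \<Rightarrow> ('v, 'k) sym"
  where "total_steenrod scale =
    sym_lift (dual_space scale) (UP (polys scale))
      (\<lambda>c. monom (UP (polys scale)) (sym_const (dual_space scale) c) 0)
      (\<lambda>l. monom (UP (polys scale)) (sym_gen (dual_space scale) l) 0
        \<oplus>\<^bsub>UP (polys scale)\<^esub>
        monom (UP (polys scale)) (sym_gen (dual_space scale) l [^]\<^bsub>polys scale\<^esub> CARD('k)) 1)"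

definition steenrod ::
  "('k::{field,finite} \<Rightarrow> 'v::ab_group_add \<Rightarrow> 'v) \<Rightarrow> nat \<Rightarrow> ('v, 'k) sym \<Rightarrow> ('v, 'k) sym"
  where "steenrod scale m f = coeff (UP (polys scale)) (total_steenrod scale f) m"

definition steenrod_invariant ::
  "('k::{field,finite} \<Rightarrow> 'v::ab_group_add \<Rightarrow> 'v) \<Rightarrow> ('v, 'k) sym set \<Rightarrow> bool"
  where "steenrod_invariant scale J \<longleftrightarrow> (\<forall>m. steenrod scale m ` J \<subseteq> J)"

end

theory Submission
  imports Defs "HOL-Number_Theory.Residues"
begin

text \<open>
  The operations \<open>P\<^sup>m\<close> are \<open>\<bbbF>\<^sub>q[G]\<close>-linear but not \<open>S\<close>-linear, so they do not act on an injective
  resolution over \<open>S[G]\<close>. They do act on cochains with values in \<open>R\<close>, through the values. The proof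
  therefore expresses the ideals \<open>J\<^sub>i\<close> by cochains and then argues with the Cartan formula.

  \<^bold>\<open>The Cartan argument.\<close> Let \<open>i > 0\<close>, let \<open>s \<in> J\<^sub>i\<close>, and let \<open>f\<close> be an \<open>i\<close>-cocycle of \<open>G\<close> in \<open>R\<close>. Then
  \<open>s f\<close> is a coboundary, and so is \<open>P\<^sup>m(s f) = (\<Sum>a\<le>m. P\<^sup>a(s) P\<^sup>m\<^sup>-\<^sup>a(f))\<close>, since \<open>P\<^sup>m\<close> is additive and
  equivariant. By induction on \<open>m\<close>, the summands with \<open>a < m\<close> are coboundaries, because the functions
  \<open>P\<^sup>m\<^sup>-\<^sup>a(f)\<close> are again cocycles. The remaining summand is \<open>P\<^sup>m(s) f\<close>, since \<open>P\<^sup>0\<close> is the identity. Hence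
  \<open>P\<^sup>m(s)\<close> kills the class of \<open>f\<close> (lemma \<open>kills_cochain_cohomology_Cartan\<close>). In degree \<open>0\<close> the
  cohomology is \<open>S\<close>, which contains \<open>1\<close>, so \<open>J\<^sub>0 = 0\<close>.

  \<^bold>\<open>The comparison.\<close> Let \<open>R \<rightarrow> E\<^sup>*\<close> be the injective resolution and let \<open>C\<^sup>p(G, M)\<close> be the group of
  equivariant functions from \<open>G\<^sup>p\<^sup>+\<^sup>1\<close> to \<open>M\<close>. In the double complex \<open>C\<^sup>p(G, E\<^sup>q)\<close>, taking cochains keeps the
  resolution exact, because an equivariant function is determined by its values on the tuples with
  first entry \<open>1\<close>, which are arbitrary (\<open>cochain_lift\<close>). In the other direction the complexes
  \<open>C\<^sup>*(G, E\<^sup>q)\<close> are acyclic because \<open>E\<^sup>q\<close> is injective (\<open>injective_module_acyclic\<close>). The two edges of the double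
  complex are the fixed points of \<open>E\<^sup>*\<close> and the cochains of \<open>R\<close>. The cohomology groups of
  the edges are not compared as such. For a fixed \<open>s\<close>, the property that \<open>s\<close> kills the classes at one
  position passes from each position to the neighbouring one, and so from one edge to the other
  (\<open>h_killed_iff_v_killed_edge\<close>).

  \<^bold>\<open>Acyclicity of an injective module \<open>E\<close>.\<close> The chains on tuples, with coefficients in \<open>S\<close>, form a
  complex of free \<open>S[G]\<close>-modules of finite rank, which is contracted by the cone that puts \<open>1\<close> in front
  of a tuple. A cocycle with values in \<open>E\<close> is a linear functional on chains that vanishes on boundaries.
  It factors through the boundary map, which gives a linear map on the submodule of cycles one degree
  lower. Injectivity extends this map to all chains of that degree, and the extension is a cochain
  whose coboundary is the given cocycle.

  \<^bold>\<open>The operations.\<close> Their properties hold because they hold for constants and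
  for linear forms and pass to sums and products (\<open>sym_induct\<close>). That the homomorphism \<open>P(\<xi>)\<close>
  exists is the linearity of \<open>l \<mapsto> l + l\<^sup>q \<xi>\<close>, that is, the linearity of the Frobenius map over \<open>\<bbbF>\<^sub>q\<close>.
\<close>

section \<open>Double complexes with exact rows and columns\<close>

lemma abelian_group_hom_additiveI:
  assumes "abelian_group M" "abelian_group N"
    and "\<And>x. x \<in> carrier M \<Longrightarrow> f x \<in> carrier N"
    and "\<And>x y. x \<in> carrier M \<Longrightarrow> y \<in> carrier M \<Longrightarrow> f (x \<oplus>\<^bsub>M\<^esub> y) = f x \<oplus>\<^bsub>N\<^esub> f y"
  shows "abelian_group_hom M N f"
proof (rule abelian_group_homI[OF assms(1,2)])
  show "group_hom (add_monoid M) (add_monoid N) f"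
    using abelian_group.a_group[OF assms(1)] abelian_group.a_group[OF assms(2)] assms(3,4)
    by (auto intro!: group_hom.intro group_hom_axioms.intro homI)
qed

text \<open>
  First quadrant double complexes that are exact away from both edges, with an endomorphism \<open>\<sigma>\<close>; in the
  application \<open>\<sigma>\<close> is multiplication by a ring element. Exactness says nothing about the kernels of
  \<open>v 0 q\<close> and \<open>h p 0\<close>: these kernels are the two edge complexes.
\<close>
locale double_complex =
  fixes X :: "nat \<Rightarrow> nat \<Rightarrow> ('a, 'm) ring_scheme"
    and v h \<sigma> :: "nat \<Rightarrow> nat \<Rightarrow> 'a \<Rightarrow> 'a"
  assumes v_hom: "abelian_group_hom (X p q) (X (Suc p) q) (v p q)"
    and h_hom: "abelian_group_hom (X p q) (X p (Suc q)) (h p q)"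
    and \<sigma>_hom: "abelian_group_hom (X p q) (X p q) (\<sigma> p q)"
    and h_v: "x \<in> carrier (X p q) \<Longrightarrow> h (Suc p) q (v p q x) = v p (Suc q) (h p q x)"
    and \<sigma>_v: "x \<in> carrier (X p q) \<Longrightarrow> \<sigma> (Suc p) q (v p q x) = v p q (\<sigma> p q x)"
    and \<sigma>_h: "x \<in> carrier (X p q) \<Longrightarrow> \<sigma> p (Suc q) (h p q x) = h p q (\<sigma> p q x)"
    and v_exact: "{x \<in> carrier (X (Suc p) q). v (Suc p) q x = \<zero>\<^bsub>X (Suc (Suc p)) q\<^esub>} =
      v p q ` carrier (X p q)"
    and h_exact: "{x \<in> carrier (X p (Suc q)). h p (Suc q) x = \<zero>\<^bsub>X p (Suc (Suc q))\<^esub>} =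
      h p q ` carrier (X p q)"
begin

lemma transpose: "double_complex (\<lambda>p q. X q p) (\<lambda>p q. h q p) (\<lambda>p q. v q p) (\<lambda>p q. \<sigma> q p)"
  by (rule double_complex.intro)
    (simp_all add: v_hom h_hom \<sigma>_hom h_v \<sigma>_v \<sigma>_h v_exact h_exact)

text \<open>
  Both properties say that \<open>\<sigma>\<close> kills cohomology at one position. For \<open>p = 0\<close>, \<open>h_killed\<close> says that \<open>\<sigma>\<close> maps
  the cocycles of the complex of kernels of \<open>v 0\<close> to coboundaries of this complex. Likewise, \<open>v_killed\<close>
  for \<open>q = 0\<close> concerns the complex of kernels of \<open>h _ 0\<close>. At the interior positions both concern the
  group of elements that are cocycles in both directions, modulo the image of the composite of
  \<open>h\<close> and \<open>v\<close>.
\<close>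
definition v_killed :: "nat \<Rightarrow> nat \<Rightarrow> bool"
  where "v_killed p q \<longleftrightarrow> (\<forall>b\<in>carrier (X (Suc p) q).
    v (Suc p) q b = \<zero>\<^bsub>X (Suc (Suc p)) q\<^esub> \<longrightarrow> h (Suc p) q b = \<zero>\<^bsub>X (Suc p) (Suc q)\<^esub> \<longrightarrow>
    (\<exists>a\<in>carrier (X p q). h p q a = \<zero>\<^bsub>X p (Suc q)\<^esub> \<and> \<sigma> (Suc p) q b = v p q a))"

definition h_killed :: "nat \<Rightarrow> nat \<Rightarrow> bool"
  where "h_killed p q \<longleftrightarrow> (\<forall>b\<in>carrier (X p (Suc q)).
    v p (Suc q) b = \<zero>\<^bsub>X (Suc p) (Suc q)\<^esub> \<longrightarrow> h p (Suc q) b = \<zero>\<^bsub>X p (Suc (Suc q))\<^esub> \<longrightarrow>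
    (\<exists>a\<in>carrier (X p q). v p q a = \<zero>\<^bsub>X (Suc p) q\<^esub> \<and> \<sigma> p (Suc q) b = h p q a))"

text \<open>
  One step of a zigzag: write \<open>b\<close> as \<open>h a\<close>, apply the hypothesis to \<open>v a\<close>, and correct \<open>\<sigma> a\<close> by the element
  that this provides.
\<close>
lemma v_killed_imp_h_killed:
  assumes "v_killed p q"
  shows "h_killed p q"
  unfolding h_killed_def
proof (intro ballI impI)
  fix b
  assume b: "b \<in> carrier (X p (Suc q))" "v p (Suc q) b = \<zero>\<^bsub>X (Suc p) (Suc q)\<^esub>"
    "h p (Suc q) b = \<zero>\<^bsub>X p (Suc (Suc q))\<^esub>"
  interpret v: abelian_group_hom "X p q" "X (Suc p) q" "v p q" by (rule v_hom)
  interpret h: abelian_group_hom "X p q" "X p (Suc q)" "h p q" by (rule h_hom)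
  interpret s: abelian_group_hom "X p q" "X p q" "\<sigma> p q" by (rule \<sigma>_hom)
  obtain a where a: "a \<in> carrier (X p q)" "b = h p q a"
    using b h_exact[of p q] by blast
  have "v (Suc p) q (v p q a) = \<zero>\<^bsub>X (Suc (Suc p)) q\<^esub>"
    using a v_exact[of p q] by blast
  moreover have "h (Suc p) q (v p q a) = \<zero>\<^bsub>X (Suc p) (Suc q)\<^esub>"
    using a b by (simp add: h_v)
  ultimately obtain a' where a': "a' \<in> carrier (X p q)" "h p q a' = \<zero>\<^bsub>X p (Suc q)\<^esub>"
    "\<sigma> (Suc p) q (v p q a) = v p q a'"
    using assms a unfolding v_killed_def by (meson v.hom_closed)
  have va': "v p q (\<sigma> p q a) = v p q a'" using a a' \<sigma>_v by simp
  \<comment> \<open>The correction removes the vertical coboundary of \<open>\<sigma> a\<close> without changing its horizontal one.\<close>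
  define c where "c = \<sigma> p q a \<oplus>\<^bsub>X p q\<^esub> (\<ominus>\<^bsub>X p q\<^esub> a')"
  have "c \<in> carrier (X p q)" using a a' by (simp add: c_def)
  moreover have "v p q c = \<zero>\<^bsub>X (Suc p) q\<^esub>"
    using a a' by (simp add: c_def va' v.H.r_neg)
  moreover have "\<sigma> p (Suc q) b = h p q c"
    using a a' by (simp add: c_def \<sigma>_h)
  ultimately show "\<exists>a\<in>carrier (X p q). v p q a = \<zero>\<^bsub>X (Suc p) q\<^esub> \<and> \<sigma> p (Suc q) b = h p q a"
    by blast
qed

end

context double_complex
begin

interpretation T: double_complex "\<lambda>p q. X q p" "\<lambda>p q. h q p" "\<lambda>p q. v q p" "\<lambda>p q. \<sigma> q p"
  by (rule transpose)

lemma v_killed_iff_h_killed: "v_killed p q \<longleftrightarrow> h_killed p q"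
  using v_killed_imp_h_killed[of p q] T.v_killed_imp_h_killed[of q p]
  unfolding v_killed_def h_killed_def T.v_killed_def T.h_killed_def by blast

text \<open>
  At the interior position \<open>(p + 1, q + 1)\<close> the two properties agree, because both kernels that
  occur in them are images from position \<open>(p, q)\<close>.
\<close>
lemma h_killed_Suc_iff: "h_killed (Suc p) q \<longleftrightarrow> v_killed p (Suc q)"
proof -
  have "(\<exists>a\<in>carrier (X (Suc p) q). v (Suc p) q a = \<zero>\<^bsub>X (Suc (Suc p)) q\<^esub> \<and> c = h (Suc p) q a) \<longleftrightarrow>
      (\<exists>a\<in>carrier (X p (Suc q)). h p (Suc q) a = \<zero>\<^bsub>X p (Suc (Suc q))\<^esub> \<and> c = v p (Suc q) a)"
    (is "?L \<longleftrightarrow> ?R") for c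
  proof -
    have "?L \<longleftrightarrow> (\<exists>a\<in>{x \<in> carrier (X (Suc p) q). v (Suc p) q x = \<zero>\<^bsub>X (Suc (Suc p)) q\<^esub>}.
        c = h (Suc p) q a)"
      by blast
    also have "\<dots> \<longleftrightarrow> (\<exists>x\<in>carrier (X p q). c = h (Suc p) q (v p q x))"
      unfolding v_exact by blast
    also have "\<dots> \<longleftrightarrow> (\<exists>x\<in>carrier (X p q). c = v p (Suc q) (h p q x))"
      by (simp add: h_v)
    also have "\<dots> \<longleftrightarrow> (\<exists>a\<in>{x \<in> carrier (X p (Suc q)). h p (Suc q) x = \<zero>\<^bsub>X p (Suc (Suc q))\<^esub>}.
        c = v p (Suc q) a)"
      unfolding h_exact by blast
    also have "\<dots> \<longleftrightarrow> ?R"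
      by blast
    finally show ?thesis .
  qed
  then show ?thesis
    unfolding h_killed_def v_killed_def by blast
qed

theorem h_killed_iff_v_killed_edge: "h_killed 0 n \<longleftrightarrow> v_killed n 0"
proof -
  have "h_killed 0 n \<longleftrightarrow> h_killed k (n - k)" if "k \<le> n" for k
    using that
  proof (induction k)
    case (Suc k)
    then have "n - k = Suc (n - Suc k)" by simp
    then show ?case
      using Suc by (simp add: v_killed_iff_h_killed h_killed_Suc_iff)
  qed simp
  from this[of n] show ?thesis by (simp add: v_killed_iff_h_killed)
qed

end

section \<open>Homogeneous cochains of a group\<close>

definition tuples :: "'g set \<Rightarrow> nat \<Rightarrow> 'g list set"
  where "tuples A n = {gs. set gs \<subseteq> A \<and> length gs = n}"

lemma Nil_in_tuples [simp]: "[] \<in> tuples A n \<longleftrightarrow> n = 0"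
  by (auto simp: tuples_def)

lemma Cons_in_tuples [simp]: "g # gs \<in> tuples A n \<longleftrightarrow> (\<exists>m. n = Suc m \<and> g \<in> A \<and> gs \<in> tuples A m)"
  by (cases n) (auto simp: tuples_def)

lemma tuples_0: "tuples A 0 = {[]}"
  by (auto simp: tuples_def)

lemma tuples_Suc: "tuples A (Suc n) = (\<lambda>(g, gs). g # gs) ` (A \<times> tuples A n)"
  by (auto simp: tuples_def length_Suc_conv image_def)

lemma finite_tuples: "finite A \<Longrightarrow> finite (tuples A n)"
  by (induction n) (auto simp: tuples_0 tuples_Suc)

lemma map_in_tuples: "gs \<in> tuples A n \<Longrightarrow> \<phi> \<in> A \<rightarrow> B \<Longrightarrow> map \<phi> gs \<in> tuples B n"
  by (auto simp: tuples_def)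

abbreviation translate :: "('g, 'm) monoid_scheme \<Rightarrow> 'g \<Rightarrow> 'g list \<Rightarrow> 'g list"
  where "translate G g gs \<equiv> map (\<lambda>k. g \<otimes>\<^bsub>G\<^esub> k) gs"

text \<open>
  The alternating sum of the values of \<open>f\<close> on the lists obtained by deleting one entry. The recursion
  separates the deletion of the first entry from the others. With it, \<open>d \<circ> d = 0\<close> and the
  contraction become inductions over the list, without sums over signed indices.
\<close>
primrec cobdry :: "('b, 'n) ring_scheme \<Rightarrow> ('g list \<Rightarrow> 'b) \<Rightarrow> 'g list \<Rightarrow> 'b"
  where
    "cobdry M f [] = \<zero>\<^bsub>M\<^esub>"
  | "cobdry M f (g # gs) = f gs \<ominus>\<^bsub>M\<^esub> cobdry M (\<lambda>hs. f (g # hs)) gs"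

lemma cobdry_map: "cobdry M (\<lambda>hs. f (map \<phi> hs)) gs = cobdry M f (map \<phi> gs)"
proof (induction gs arbitrary: f)
  case (Cons g gs)
  show ?case using Cons.IH[of "\<lambda>hs. f (\<phi> g # hs)"] by simp
qed simp

lemma cobdry_cong:
  assumes "\<And>hs. hs \<in> tuples A n \<Longrightarrow> f hs = f' hs" and "gs \<in> tuples A (Suc n)"
  shows "cobdry M f gs = cobdry M f' gs"
  using assms
proof (induction gs arbitrary: f f' n)
  case (Cons g gs)
  show ?case
  proof (cases n)
    case (Suc m)
    have "cobdry M (\<lambda>hs. f (g # hs)) gs = cobdry M (\<lambda>hs. f' (g # hs)) gs"
      using Cons.prems Suc by (intro Cons.IH[of m]) auto
    then show ?thesis using Cons.prems by simp
  qed (use Cons.prems in \<open>auto simp: tuples_0\<close>)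
qed simp

context abelian_group
begin

lemma minus_zero_right [simp]: "x \<in> carrier G \<Longrightarrow> x \<ominus> \<zero> = x"
  using add.inv_one by (simp add: a_minus_def a_inv_def)

lemma minus_self [simp]: "x \<in> carrier G \<Longrightarrow> x \<ominus> x = \<zero>"
  by (simp add: a_minus_def r_neg)

lemma minus_eq_zero_imp_eq:
  assumes "x \<in> carrier G" "y \<in> carrier G" "x \<ominus> y = \<zero>"
  shows "x = y"
proof -
  have "\<ominus> (\<ominus> y) = x"
    by (rule minus_equality) (use assms in \<open>simp_all add: a_minus_def\<close>)
  then show ?thesis using assms by simp
qed

lemma minus_add_swap:
  assumes "a \<in> carrier G" "b \<in> carrier G" "c \<in> carrier G" "d \<in> carrier G"
  shows "(a \<oplus> b) \<ominus> (c \<oplus> d) = (a \<ominus> c) \<oplus> (b \<ominus> d)"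
  using assms by (simp add: a_minus_def minus_add a_ac)

lemma cobdry_closed [simp]:
  "(\<And>hs. f hs \<in> carrier G) \<Longrightarrow> cobdry G f gs \<in> carrier G"
  by (induction gs arbitrary: f) simp_all

lemma cobdry_add:
  assumes "\<And>hs. f hs \<in> carrier G" "\<And>hs. f' hs \<in> carrier G"
  shows "cobdry G (\<lambda>hs. f hs \<oplus> f' hs) gs = cobdry G f gs \<oplus> cobdry G f' gs"
  using assms by (induction gs arbitrary: f f') (simp_all add: minus_add_swap)

lemma cobdry_cobdry:
  assumes "\<And>hs. f hs \<in> carrier G"
  shows "cobdry G (cobdry G f) gs = \<zero>"
  using assms
proof (induction gs arbitrary: f)
  case (Cons g gs)
  define f' where "f' = (\<lambda>hs. f (g # hs))"
  have f': "f' hs \<in> carrier G" for hs using Cons.prems by (simp add: f'_def)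
  have "cobdry G (\<lambda>hs. f hs \<ominus> cobdry G f' hs) gs \<oplus> cobdry G (cobdry G f') gs
      = cobdry G (\<lambda>hs. (f hs \<ominus> cobdry G f' hs) \<oplus> cobdry G f' hs) gs"
    using Cons.prems f' by (simp add: cobdry_add)
  also have "(\<lambda>hs. (f hs \<ominus> cobdry G f' hs) \<oplus> cobdry G f' hs) = f"
    using Cons.prems f' by (simp add: a_minus_def a_assoc l_neg)
  finally have "cobdry G (\<lambda>hs. f hs \<ominus> cobdry G f' hs) gs = cobdry G f gs"
    using Cons.prems f' by (simp add: Cons.IH)
  then show ?case
    using Cons.prems by (simp add: f'_def [symmetric] a_minus_def r_neg)
qed simp

end

lemma (in abelian_group_hom) hom_cobdry:
  assumes "\<And>hs. f hs \<in> carrier G"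
  shows "h (cobdry G f gs) = cobdry H (\<lambda>hs. h (f hs)) gs"
  using assms by (induction gs arbitrary: f) (simp_all add: a_minus_def)

locale equivariant_group = G?: group G + M?: abelian_group M
  for G (structure) and M (structure) and act +
  assumes act_hom: "g \<in> carrier G \<Longrightarrow> abelian_group_hom M M (act g)"
    and act_one: "x \<in> carrier M \<Longrightarrow> act \<one> x = x"
    and act_mult: "g \<in> carrier G \<Longrightarrow> h \<in> carrier G \<Longrightarrow> x \<in> carrier M \<Longrightarrow>
      act (g \<otimes>\<^bsub>G\<^esub> h) x = act g (act h x)"

text \<open>
  The cochains live on tuples of length \<open>n\<close>, so \<open>n = 1\<close> is cohomological degree \<open>0\<close>. They are defined on
  all lists, with value zero outside the tuples, so that sums and homomorphisms can be applied to the
  values without restricting the result.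
\<close>
definition cochains ::
  "('g, 'm) monoid_scheme \<Rightarrow> ('b, 'n) ring_scheme \<Rightarrow> ('g \<Rightarrow> 'b \<Rightarrow> 'b) \<Rightarrow> nat \<Rightarrow> ('g list \<Rightarrow> 'b) ring"
  where "cochains G M act n =
    \<lparr>carrier = {f. (\<forall>gs. f gs \<in> carrier M) \<and> (\<forall>gs. gs \<notin> tuples (carrier G) n \<longrightarrow> f gs = \<zero>\<^bsub>M\<^esub>) \<and>
       (\<forall>g\<in>carrier G. \<forall>gs\<in>tuples (carrier G) n. f (translate G g gs) = act g (f gs))},
     mult = undefined, one = undefined, zero = (\<lambda>_. \<zero>\<^bsub>M\<^esub>), add = (\<lambda>f f' gs. f gs \<oplus>\<^bsub>M\<^esub> f' gs)\<rparr>"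

definition cochain_d ::
  "('g, 'm) monoid_scheme \<Rightarrow> ('b, 'n) ring_scheme \<Rightarrow> nat \<Rightarrow> ('g list \<Rightarrow> 'b) \<Rightarrow> 'g list \<Rightarrow> 'b"
  where "cochain_d G M n f gs = (if gs \<in> tuples (carrier G) (Suc n) then cobdry M f gs else \<zero>\<^bsub>M\<^esub>)"

context equivariant_group
begin

lemma act_closed [simp]: "g \<in> carrier G \<Longrightarrow> x \<in> carrier M \<Longrightarrow> act g x \<in> carrier M"
  by (rule abelian_group_hom.hom_closed[OF act_hom])

lemma act_add [simp]: "g \<in> carrier G \<Longrightarrow> x \<in> carrier M \<Longrightarrow> y \<in> carrier M \<Longrightarrow>
    act g (x \<oplus>\<^bsub>M\<^esub> y) = act g x \<oplus>\<^bsub>M\<^esub> act g y"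
  by (rule abelian_group_hom.hom_add[OF act_hom])

lemma act_zero [simp]: "g \<in> carrier G \<Longrightarrow> act g \<zero>\<^bsub>M\<^esub> = \<zero>\<^bsub>M\<^esub>"
  by (rule abelian_group_hom.hom_zero[OF act_hom])

lemma act_a_inv [simp]: "g \<in> carrier G \<Longrightarrow> x \<in> carrier M \<Longrightarrow> act g (\<ominus>\<^bsub>M\<^esub> x) = \<ominus>\<^bsub>M\<^esub> act g x"
  by (rule abelian_group_hom.hom_a_inv[OF act_hom])

lemma translate_in_tuples [simp]:
  "g \<in> carrier G \<Longrightarrow> gs \<in> tuples (carrier G) n \<Longrightarrow> translate G g gs \<in> tuples (carrier G) n"
  by (rule map_in_tuples) auto

lemma abelian_group_cochains: "abelian_group (cochains G M act n)"
proof (rule abelian_groupI)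
  fix f assume f: "f \<in> carrier (cochains G M act n)"
  then have "(\<lambda>gs. \<ominus>\<^bsub>M\<^esub> f gs) \<in> carrier (cochains G M act n)"
    by (simp add: cochains_def)
  moreover have "(\<lambda>gs. \<ominus>\<^bsub>M\<^esub> f gs) \<oplus>\<^bsub>cochains G M act n\<^esub> f = \<zero>\<^bsub>cochains G M act n\<^esub>"
    using f by (simp add: cochains_def M.l_neg)
  ultimately show "\<exists>f'\<in>carrier (cochains G M act n).
      f' \<oplus>\<^bsub>cochains G M act n\<^esub> f = \<zero>\<^bsub>cochains G M act n\<^esub>"
    by blast
qed (auto simp: cochains_def M.a_ac)

lemma cochain_d_closed:
  assumes "f \<in> carrier (cochains G M act n)"
  shows "cochain_d G M n f \<in> carrier (cochains G M act (Suc n))"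
proof -
  have f: "f gs \<in> carrier M" for gs using assms by (simp add: cochains_def)
  have "cobdry M f (translate G g gs) = act g (cobdry M f gs)"
    if g: "g \<in> carrier G" and gs: "gs \<in> tuples (carrier G) (Suc n)" for g gs
  proof -
    have "cobdry M f (translate G g gs) = cobdry M (\<lambda>hs. f (translate G g hs)) gs"
      by (rule cobdry_map [symmetric])
    also have "\<dots> = cobdry M (\<lambda>hs. act g (f hs)) gs"
      using assms g by (intro cobdry_cong[OF _ gs]) (simp add: cochains_def)
    also have "\<dots> = act g (cobdry M f gs)"
      using f by (simp add: abelian_group_hom.hom_cobdry[OF act_hom[OF g]])
    finally show ?thesis .
  qed
  then show ?thesis
    using f by (simp add: cochains_def cochain_d_def)
qed

lemma cochain_d_hom:
  "abelian_group_hom (cochains G M act n) (cochains G M act (Suc n)) (cochain_d G M n)"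
proof (rule abelian_group_hom_additiveI[OF abelian_group_cochains abelian_group_cochains])
  fix f f'
  assume "f \<in> carrier (cochains G M act n)" "f' \<in> carrier (cochains G M act n)"
  then show "cochain_d G M n (f \<oplus>\<^bsub>cochains G M act n\<^esub> f') =
      cochain_d G M n f \<oplus>\<^bsub>cochains G M act (Suc n)\<^esub> cochain_d G M n f'"
    by (auto simp: cochains_def cochain_d_def cobdry_add fun_eq_iff)
qed (rule cochain_d_closed)

lemma cochain_d_cochain_d:
  assumes "f \<in> carrier (cochains G M act n)"
  shows "cochain_d G M (Suc n) (cochain_d G M n f) = (\<lambda>_. \<zero>\<^bsub>M\<^esub>)"
proof
  fix gs
  have f: "f gs \<in> carrier M" for gs using assms by (simp add: cochains_def)
  have "cobdry M (cochain_d G M n f) gs = cobdry M (cobdry M f) gs"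
    if "gs \<in> tuples (carrier G) (Suc (Suc n))"
    by (intro cobdry_cong[OF _ that]) (simp add: cochain_d_def)
  then show "cochain_d G M (Suc n) (cochain_d G M n f) gs = \<zero>\<^bsub>M\<^esub>"
    using f by (simp add: cochain_d_def[of _ _ "Suc n"] cobdry_cobdry)
qed

end

locale equivariant_hom =
  M: equivariant_group G M act + N: equivariant_group G N act' + abelian_group_hom M N \<phi>
  for G (structure) and M (structure) and N (structure) and act act' \<phi> +
  assumes equivariant: "g \<in> carrier G \<Longrightarrow> x \<in> carrier M \<Longrightarrow> \<phi> (act g x) = act' g (\<phi> x)"
begin

lemma cochain_map_hom:
  "abelian_group_hom (cochains G M act n) (cochains G N act' n) (\<lambda>f gs. \<phi> (f gs))"
  by (rule abelian_group_hom_additiveI[OF M.abelian_group_cochains N.abelian_group_cochains])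
    (auto simp: cochains_def equivariant)

lemma cochain_map_cochain_d:
  assumes "f \<in> carrier (cochains G M act n)"
  shows "(\<lambda>gs. \<phi> (cochain_d G M n f gs)) = cochain_d G N n (\<lambda>gs. \<phi> (f gs))"
  using assms by (auto simp: cochain_d_def cochains_def hom_cobdry)

text \<open>
  An equivariant function is determined by its values on tuples with first entry \<open>1\<close>, and these values
  are arbitrary. So a lift may be chosen on these tuples and then extended by equivariance.
\<close>
lemma cochain_lift:
  assumes b: "b \<in> carrier (cochains G N act' (Suc n))"
    and image: "\<And>gs. gs \<in> tuples (carrier G) (Suc n) \<Longrightarrow> b gs \<in> \<phi> ` carrier M"
  shows "\<exists>a\<in>carrier (cochains G M act (Suc n)). (\<lambda>gs. \<phi> (a gs)) = b"
proof -
  define c where "c gs = (SOME x. x \<in> carrier M \<and> \<phi> x = b (\<one> # gs))" for gs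
  have c: "c gs \<in> carrier M" "\<phi> (c gs) = b (\<one> # gs)" if "gs \<in> tuples (carrier G) n" for gs
  proof -
    have "\<exists>x. x \<in> carrier M \<and> \<phi> x = b (\<one> # gs)"
      using image[of "\<one> # gs"] that by auto
    from someI_ex[OF this] show "c gs \<in> carrier M" "\<phi> (c gs) = b (\<one> # gs)"
      by (auto simp: c_def)
  qed
  define a where "a gs = (if gs \<in> tuples (carrier G) (Suc n)
    then act (hd gs) (c (translate G (inv\<^bsub>G\<^esub> hd gs) (tl gs))) else \<zero>\<^bsub>M\<^esub>)" for gs
  have a_Cons: "a (g # gs) = act g (c (translate G (inv\<^bsub>G\<^esub> g) gs))"
    if "g \<in> carrier G" "gs \<in> tuples (carrier G) n" for g gs
    using that by (simp add: a_def)
  have "a (translate G g gs) = act g (a gs)"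
    if g: "g \<in> carrier G" and gs: "gs \<in> tuples (carrier G) (Suc n)" for g gs
  proof -
    obtain h hs where h: "gs = h # hs" "h \<in> carrier G" "hs \<in> tuples (carrier G) n"
      using gs by (auto simp: tuples_Suc)
    have "translate G (inv\<^bsub>G\<^esub> (g \<otimes>\<^bsub>G\<^esub> h)) (translate G g hs) = translate G (inv\<^bsub>G\<^esub> h) hs"
    proof -
      have "inv\<^bsub>G\<^esub> (g \<otimes>\<^bsub>G\<^esub> h) \<otimes>\<^bsub>G\<^esub> (g \<otimes>\<^bsub>G\<^esub> k) = inv\<^bsub>G\<^esub> h \<otimes>\<^bsub>G\<^esub> k" if "k \<in> carrier G" for k
      proof -
        have "inv\<^bsub>G\<^esub> (g \<otimes>\<^bsub>G\<^esub> h) \<otimes>\<^bsub>G\<^esub> (g \<otimes>\<^bsub>G\<^esub> k) = inv\<^bsub>G\<^esub> h \<otimes>\<^bsub>G\<^esub> (inv\<^bsub>G\<^esub> g \<otimes>\<^bsub>G\<^esub> (g \<otimes>\<^bsub>G\<^esub> k))"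
          using g h that by (simp add: M.G.inv_mult_group M.G.m_assoc)
        also have "inv\<^bsub>G\<^esub> g \<otimes>\<^bsub>G\<^esub> (g \<otimes>\<^bsub>G\<^esub> k) = k"
          using g that by (simp add: M.G.m_assoc [symmetric])
        finally show ?thesis .
      qed
      then show ?thesis using h by (auto simp: tuples_def)
    qed
    then show ?thesis
      using g h c by (simp add: a_Cons M.act_mult del: map_map)
  qed
  moreover have "a gs \<in> carrier M" for gs
    using c by (auto simp: a_def tuples_Suc)
  ultimately have "a \<in> carrier (cochains G M act (Suc n))"
    by (simp add: cochains_def) (simp add: a_def)
  moreover have "\<phi> (a gs) = b gs" for gs
  proof (cases "gs \<in> tuples (carrier G) (Suc n)")
    case True
    then obtain g hs where g: "gs = g # hs" "g \<in> carrier G" "hs \<in> tuples (carrier G) n"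
      by (auto simp: tuples_Suc)
    have "translate G g (translate G (inv\<^bsub>G\<^esub> g) hs) = hs"
      using g by (auto simp: tuples_def M.G.m_assoc [symmetric] intro!: map_idI)
    moreover have "act' g (b (\<one> # translate G (inv\<^bsub>G\<^esub> g) hs)) =
        b (translate G g (\<one> # translate G (inv\<^bsub>G\<^esub> g) hs))"
      using b g by (simp add: cochains_def del: list.map)
    ultimately show ?thesis
      using g c by (simp add: a_Cons equivariant del: map_map)
  qed (use b in \<open>simp add: a_def cochains_def\<close>)
  ultimately show ?thesis by (auto simp: fun_eq_iff)
qed

end

text \<open>
  The constant cochains with invariant value are the kernel of the coboundary map in degree \<open>0\<close>. They
  identify the fixed points with an edge of the double complex.
\<close>
definition constant_cochain ::
  "('g, 'm) monoid_scheme \<Rightarrow> ('b, 'n) ring_scheme \<Rightarrow> 'b \<Rightarrow> 'g list \<Rightarrow> 'b"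
  where "constant_cochain G M x gs = (if gs \<in> tuples (carrier G) 1 then x else \<zero>\<^bsub>M\<^esub>)"

context equivariant_group
begin

lemma constant_cochain_closed:
  assumes "x \<in> carrier M" "\<And>g. g \<in> carrier G \<Longrightarrow> act g x = x"
  shows "constant_cochain G M x \<in> carrier (cochains G M act (Suc 0))"
  using assms translate_in_tuples[of _ _ "Suc 0"] by (auto simp: constant_cochain_def cochains_def)

lemma cochain_d_constant_cochain:
  assumes "x \<in> carrier M"
  shows "cochain_d G M (Suc 0) (constant_cochain G M x) = (\<lambda>_. \<zero>\<^bsub>M\<^esub>)"
  using assms by (intro ext)
    (auto simp: cochain_d_def constant_cochain_def tuples_Suc tuples_0 image_iff)

lemma cocycle_1_constant:
  assumes f: "f \<in> carrier (cochains G M act (Suc 0))"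
    and cocycle: "cochain_d G M (Suc 0) f = (\<lambda>_. \<zero>\<^bsub>M\<^esub>)"
  shows "f [\<one>] \<in> carrier M" and "g \<in> carrier G \<Longrightarrow> act g (f [\<one>]) = f [\<one>]"
    and "f = constant_cochain G M (f [\<one>])"
proof -
  have closed: "f gs \<in> carrier M" for gs using f by (simp add: cochains_def)
  have const: "f [g] = f [\<one>]" if "g \<in> carrier G" for g
  proof -
    have "cochain_d G M (Suc 0) f [\<one>, g] = f [g] \<ominus>\<^bsub>M\<^esub> (f [\<one>] \<ominus>\<^bsub>M\<^esub> \<zero>\<^bsub>M\<^esub>)"
      using that by (simp add: cochain_d_def)
    then have "f [g] \<ominus>\<^bsub>M\<^esub> f [\<one>] = \<zero>\<^bsub>M\<^esub>"
      using closed by (simp add: cocycle)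
    from M.minus_eq_zero_imp_eq[OF closed closed this] show ?thesis .
  qed
  show "f [\<one>] \<in> carrier M" by (rule closed)
  show "f = constant_cochain G M (f [\<one>])"
  proof
    fix gs show "f gs = constant_cochain G M (f [\<one>]) gs"
    proof (cases "gs \<in> tuples (carrier G) 1")
      case True
      then obtain g where "gs = [g]" "g \<in> carrier G"
        by (auto simp: tuples_Suc tuples_0)
      then show ?thesis
        using True const[of g] by (simp only: constant_cochain_def if_True)
    qed (use f in \<open>simp add: constant_cochain_def cochains_def\<close>)
  qed
  show "act g (f [\<one>]) = f [\<one>]" if g: "g \<in> carrier G"
  proof -
    have "act g (f [\<one>]) = f (translate G g [\<one>])"
      using f g by (simp add: cochains_def tuples_Suc tuples_0 del: list.map)
    then show ?thesis using g const[of g] by simp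
  qed
qed

end

section \<open>Chains and their duality with cochains\<close>

context abelian_monoid
begin

lemma finsum_swap:
  assumes "finite A" "finite B" "\<And>x y. x \<in> A \<Longrightarrow> y \<in> B \<Longrightarrow> f x y \<in> carrier G"
  shows "(\<Oplus>x\<in>A. \<Oplus>y\<in>B. f x y) = (\<Oplus>y\<in>B. \<Oplus>x\<in>A. f x y)"
  using assms(1,3)
proof (induction A rule: finite_induct)
  case empty
  then show ?case by simp
next
  case (insert a A)
  have "(\<Oplus>x\<in>insert a A. \<Oplus>y\<in>B. f x y) = (\<Oplus>y\<in>B. f a y) \<oplus> (\<Oplus>y\<in>B. \<Oplus>x\<in>A. f x y)"
    using insert by (simp add: Pi_def)
  also have "\<dots> = (\<Oplus>y\<in>B. f a y \<oplus> (\<Oplus>x\<in>A. f x y))"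
    using insert by (intro finsum_addf [symmetric]) (auto simp: Pi_def)
  also have "\<dots> = (\<Oplus>y\<in>B. \<Oplus>x\<in>insert a A. f x y)"
    using insert by (intro finsum_cong') (auto simp: Pi_def)
  finally show ?case .
qed

lemma finsum_bij:
  assumes "bij_betw h A B" "\<And>y. y \<in> B \<Longrightarrow> f y \<in> carrier G"
  shows "(\<Oplus>x\<in>A. f (h x)) = (\<Oplus>y\<in>B. f y)"
  using assms finsum_reindex[of f h A] by (auto simp: bij_betw_def)

lemma finsum_tuples_Suc:
  assumes "finite A" "\<And>gs. f gs \<in> carrier G"
  shows "(\<Oplus>gs\<in>tuples A (Suc n). f gs) = (\<Oplus>g\<in>A. \<Oplus>gs\<in>tuples A n. f (g # gs))"
proof -
  have "(\<Oplus>gs\<in>(\<Union>g\<in>A. (#) g ` tuples A n). f gs) = (\<Oplus>g\<in>A. \<Oplus>gs\<in>(#) g ` tuples A n. f gs)"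
    using assms by (intro add.finprod_UN_disjoint) (auto simp: finite_tuples pairwise_def disjnt_def)
  also have "\<dots> = (\<Oplus>g\<in>A. \<Oplus>gs\<in>tuples A n. f (g # gs))"
    using assms by (intro finsum_cong' finsum_reindex) (auto simp: finite_tuples)
  also have "(\<Union>g\<in>A. (#) g ` tuples A n) = tuples A (Suc n)"
    by (auto simp: tuples_Suc)
  finally show ?thesis .
qed

lemma finsum_delta:
  assumes "finite A" "a \<in> A" "f a \<in> carrier G"
  shows "(\<Oplus>x\<in>A. if x = a then f x else \<zero>) = f a"
proof -
  have "(\<Oplus>x\<in>A. if x = a then f x else \<zero>) = (\<Oplus>x\<in>A. if a = x then f a else \<zero>)"
    using assms by (intro finsum_cong') auto
  then show ?thesis using finsum_singleton[OF assms(2,1), of "\<lambda>_. f a"] assms by simp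
qed

end

lemma (in abelian_group_hom) hom_finsum:
  assumes "\<And>x. x \<in> A \<Longrightarrow> f x \<in> carrier G"
  shows "h (\<Oplus>\<^bsub>G\<^esub>x\<in>A. f x) = (\<Oplus>\<^bsub>H\<^esub>x\<in>A. h (f x))"
  using assms by (induction A rule: infinite_finite_induct) (simp_all add: Pi_def)

lemma (in abelian_group) finsum_minus:
  assumes "\<And>x. x \<in> A \<Longrightarrow> f x \<in> carrier G" "\<And>x. x \<in> A \<Longrightarrow> f' x \<in> carrier G"
  shows "(\<Oplus>x\<in>A. f x \<ominus> f' x) = (\<Oplus>x\<in>A. f x) \<ominus> (\<Oplus>x\<in>A. f' x)"
  using assms
proof (induction A rule: infinite_finite_induct)
  case (insert a A)
  then show ?case by (simp add: Pi_def minus_add_swap)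
qed simp_all

text \<open>
  The transpose of \<^const>\<open>cobdry\<close>: a function \<open>x\<close> on lists represents the formal sum of the lists \<open>hs\<close> with
  coefficients \<open>x hs\<close>, and the value of its boundary at \<open>hs\<close> collects the coefficients of all lists that
  have \<open>hs\<close> as a face. A face that omits the first entry contributes to the sum over \<open>g\<close>, and the others
  are handled by the recursion.
\<close>
primrec bdry :: "('r, 'm) ring_scheme \<Rightarrow> 'g set \<Rightarrow> ('g list \<Rightarrow> 'r) \<Rightarrow> 'g list \<Rightarrow> 'r"
  where
    "bdry S A x [] = (\<Oplus>\<^bsub>S\<^esub>g\<in>A. x [g])"
  | "bdry S A x (h # hs) = (\<Oplus>\<^bsub>S\<^esub>g\<in>A. x (g # h # hs)) \<ominus>\<^bsub>S\<^esub> bdry S A (\<lambda>ks. x (h # ks)) hs"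

text \<open>
  The linear map on chains that sends a tuple \<open>hs\<close> to the tuple \<open>u # hs\<close>.
\<close>
definition cone :: "('r, 'm) ring_scheme \<Rightarrow> 'g \<Rightarrow> ('g list \<Rightarrow> 'r) \<Rightarrow> 'g list \<Rightarrow> 'r"
  where "cone S u x gs = (case gs of [] \<Rightarrow> \<zero>\<^bsub>S\<^esub> | g # hs \<Rightarrow> if g = u then x hs else \<zero>\<^bsub>S\<^esub>)"

context abelian_group
begin

lemma bdry_closed [simp]:
  "(\<And>hs. x hs \<in> carrier G) \<Longrightarrow> bdry G A x gs \<in> carrier G"
  by (induction gs arbitrary: x) simp_all

lemma bdry_add:
  assumes "\<And>hs. x hs \<in> carrier G" "\<And>hs. y hs \<in> carrier G"
  shows "bdry G A (\<lambda>hs. x hs \<oplus> y hs) gs = bdry G A x gs \<oplus> bdry G A y gs"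
  using assms by (induction gs arbitrary: x y) (simp_all add: finsum_addf minus_add_swap)

lemma bdry_zero [simp]: "bdry G A (\<lambda>_. \<zero>) gs = \<zero>"
  by (induction gs) simp_all

lemma bdry_cong:
  assumes "\<And>hs. hs \<in> tuples A (Suc n) \<Longrightarrow> x hs = y hs" "gs \<in> tuples A n"
    and "\<And>hs. y hs \<in> carrier G"
  shows "bdry G A x gs = bdry G A y gs"
  using assms
proof (induction gs arbitrary: x y n)
  case Nil
  then show ?case by (auto intro!: finsum_cong')
next
  case (Cons g gs)
  then obtain m where m: "n = Suc m" "g \<in> A" "gs \<in> tuples A m" by auto
  have "bdry G A (\<lambda>ks. x (g # ks)) gs = bdry G A (\<lambda>ks. y (g # ks)) gs"
    using Cons.prems m by (intro Cons.IH[of m]) auto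
  moreover have "(\<Oplus>h\<in>A. x (h # g # gs)) = (\<Oplus>h\<in>A. y (h # g # gs))"
    using Cons.prems by (intro finsum_cong') auto
  ultimately show ?case by simp
qed

text \<open>
  Omitting the first entry of \<open>u # hs\<close> gives \<open>hs\<close> back. Hence the cone is a contracting homotopy.
\<close>
lemma bdry_cone:
  assumes "finite A" "u \<in> A" "\<And>hs. x hs \<in> carrier G"
  shows "bdry G A (cone G u x) gs = x gs \<ominus> cone G u (bdry G A x) gs"
proof (cases gs)
  case Nil
  then show ?thesis using assms finsum_delta[OF assms(1,2), of "\<lambda>_. x []"] by (simp add: cone_def)
next
  case (Cons h hs)
  have "(\<Oplus>g\<in>A. cone G u x (g # h # hs)) = x (h # hs)"
    using assms finsum_delta[OF assms(1,2), of "\<lambda>_. x (h # hs)"] by (simp add: cone_def)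
  moreover have "(\<lambda>ks. cone G u x (h # ks)) = (if h = u then x else (\<lambda>_. \<zero>))"
    by (simp add: cone_def)
  ultimately show ?thesis
    by (simp add: Cons cone_def)
qed

end

lemma (in abelian_group_hom) hom_bdry:
  assumes "\<And>hs. x hs \<in> carrier G"
  shows "h (bdry G A x gs) = bdry H A (\<lambda>hs. h (x hs)) gs"
  using assms by (induction gs arbitrary: x) (simp_all add: a_minus_def hom_finsum)

lemma bdry_map:
  assumes "abelian_group S" "bij_betw \<phi> A A" "\<And>gs. x gs \<in> carrier S"
  shows "bdry S A (\<lambda>hs. x (map \<phi> hs)) gs = bdry S A x (map \<phi> gs)"
  using assms(3)
proof (induction gs arbitrary: x)
  case Nil
  then show ?case
    using assms abelian_monoid.finsum_bij[OF abelian_group.axioms(1)[OF assms(1)] assms(2), of "\<lambda>g. x [g]"]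
    by simp
next
  case (Cons g gs)
  show ?case
    using assms Cons.prems Cons.IH[of "\<lambda>ks. x (\<phi> g # ks)"]
      abelian_monoid.finsum_bij[OF abelian_group.axioms(1)[OF assms(1)] assms(2),
        of "\<lambda>h. x (h # \<phi> g # map \<phi> gs)"]
    by simp
qed

locale biadditive = S?: abelian_group S + M?: abelian_group M + N?: abelian_group N
  for S (structure) and M (structure) and N (structure) +
  fixes \<beta>
  assumes left_hom: "y \<in> carrier M \<Longrightarrow> abelian_group_hom S N (\<lambda>x. \<beta> x y)"
    and right_hom: "x \<in> carrier S \<Longrightarrow> abelian_group_hom M N (\<beta> x)"
begin

lemma \<beta>_closed [simp]: "x \<in> carrier S \<Longrightarrow> y \<in> carrier M \<Longrightarrow> \<beta> x y \<in> carrier N"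
  by (rule abelian_group_hom.hom_closed[OF right_hom])

lemma \<beta>_minus_left: "x \<in> carrier S \<Longrightarrow> x' \<in> carrier S \<Longrightarrow> y \<in> carrier M \<Longrightarrow>
    \<beta> (x \<ominus>\<^bsub>S\<^esub> x') y = \<beta> x y \<ominus>\<^bsub>N\<^esub> \<beta> x' y"
  using abelian_group_hom.hom_add[OF left_hom, of y x "\<ominus>\<^bsub>S\<^esub> x'"]
    abelian_group_hom.hom_a_inv[OF left_hom, of y x']
  by (simp add: a_minus_def)

lemma \<beta>_minus_right: "x \<in> carrier S \<Longrightarrow> y \<in> carrier M \<Longrightarrow> y' \<in> carrier M \<Longrightarrow>
    \<beta> x (y \<ominus>\<^bsub>M\<^esub> y') = \<beta> x y \<ominus>\<^bsub>N\<^esub> \<beta> x y'"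
  using abelian_group_hom.hom_add[OF right_hom, of x y "\<ominus>\<^bsub>M\<^esub> y'"]
    abelian_group_hom.hom_a_inv[OF right_hom, of x y']
  by (simp add: a_minus_def)

text \<open>
  Both sides sum over all pairs of a tuple and one of its faces. The recursions for the two maps separate
  the same face, the one that omits the first entry, and the induction hypothesis accounts for the others.
\<close>
lemma bdry_cobdry_adjoint:
  assumes "finite A" "\<And>gs. x gs \<in> carrier S" "\<And>gs. f gs \<in> carrier M"
  shows "(\<Oplus>\<^bsub>N\<^esub>gs\<in>tuples A n. \<beta> (bdry S A x gs) (f gs)) =
    (\<Oplus>\<^bsub>N\<^esub>gs\<in>tuples A (Suc n). \<beta> (x gs) (cobdry M f gs))"
  using assms(2,3)
proof (induction n arbitrary: x f)
  case 0
  then show ?case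
    using assms(1)
    by (simp add: tuples_0 N.finsum_tuples_Suc abelian_group_hom.hom_finsum[OF left_hom])
next
  case (Suc n)
  define I where "I g = (\<Oplus>\<^bsub>N\<^esub>hs\<in>tuples A n. \<beta> (bdry S A (\<lambda>ks. x (g # ks)) hs) (f (g # hs)))" for g
  have I: "I g \<in> carrier N" for g
    using Suc.prems by (simp add: I_def)
  have fin: "finite (tuples A k)" for k using assms(1) by (rule finite_tuples)
  have "(\<Oplus>\<^bsub>N\<^esub>gs\<in>tuples A (Suc n). \<beta> (bdry S A x gs) (f gs)) =
    (\<Oplus>\<^bsub>N\<^esub>h\<in>A. \<Oplus>\<^bsub>N\<^esub>hs\<in>tuples A n. (\<Oplus>\<^bsub>N\<^esub>g\<in>A. \<beta> (x (g # h # hs)) (f (h # hs)))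
      \<ominus>\<^bsub>N\<^esub> \<beta> (bdry S A (\<lambda>ks. x (h # ks)) hs) (f (h # hs)))"
    using assms(1) Suc.prems
    by (simp add: N.finsum_tuples_Suc \<beta>_minus_left abelian_group_hom.hom_finsum[OF left_hom])
  also have "\<dots> = (\<Oplus>\<^bsub>N\<^esub>h\<in>A. \<Oplus>\<^bsub>N\<^esub>hs\<in>tuples A n. \<Oplus>\<^bsub>N\<^esub>g\<in>A. \<beta> (x (g # h # hs)) (f (h # hs)))
      \<ominus>\<^bsub>N\<^esub> (\<Oplus>\<^bsub>N\<^esub>h\<in>A. I h)"
    using Suc.prems by (simp add: N.finsum_minus I_def)
  also have "(\<Oplus>\<^bsub>N\<^esub>h\<in>A. \<Oplus>\<^bsub>N\<^esub>hs\<in>tuples A n. \<Oplus>\<^bsub>N\<^esub>g\<in>A. \<beta> (x (g # h # hs)) (f (h # hs))) =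
      (\<Oplus>\<^bsub>N\<^esub>gs\<in>tuples A (Suc n). \<Oplus>\<^bsub>N\<^esub>g\<in>A. \<beta> (x (g # gs)) (f gs))"
    using assms(1) Suc.prems by (simp add: N.finsum_tuples_Suc)
  also have "\<dots> = (\<Oplus>\<^bsub>N\<^esub>g\<in>A. \<Oplus>\<^bsub>N\<^esub>gs\<in>tuples A (Suc n). \<beta> (x (g # gs)) (f gs))"
    using assms(1) Suc.prems fin by (intro N.finsum_swap) auto
  also have "\<dots> \<ominus>\<^bsub>N\<^esub> (\<Oplus>\<^bsub>N\<^esub>h\<in>A. I h) =
      (\<Oplus>\<^bsub>N\<^esub>g\<in>A. (\<Oplus>\<^bsub>N\<^esub>gs\<in>tuples A (Suc n). \<beta> (x (g # gs)) (f gs)) \<ominus>\<^bsub>N\<^esub> I g)"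
    using Suc.prems I by (simp add: N.finsum_minus)
  also have "\<dots> = (\<Oplus>\<^bsub>N\<^esub>g\<in>A. \<Oplus>\<^bsub>N\<^esub>gs\<in>tuples A (Suc n). \<beta> (x (g # gs)) (cobdry M f (g # gs)))"
    using Suc.prems by (simp add: Suc.IH I_def N.finsum_minus \<beta>_minus_right)
  also have "\<dots> = (\<Oplus>\<^bsub>N\<^esub>gs\<in>tuples A (Suc (Suc n)). \<beta> (x gs) (cobdry M f gs))"
    using assms(1) Suc.prems
    by (simp add: N.finsum_tuples_Suc[of A "\<lambda>gs. \<beta> (x gs) (cobdry M f gs)" "Suc n"] del: cobdry.simps)
  finally show ?case .
qed

end

lemma (in ring) biadditive_mult: "biadditive R R R (\<otimes>)"
proof (intro biadditive.intro biadditive_axioms.intro is_abelian_group)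
  show "abelian_group_hom R R (\<lambda>x. x \<otimes> y)" if "y \<in> carrier R" for y
    using that by (intro abelian_group_hom_additiveI) (auto simp: l_distr is_abelian_group)
  show "abelian_group_hom R R ((\<otimes>) x)" if "x \<in> carrier R" for x
    using that by (intro abelian_group_hom_additiveI) (auto simp: r_distr is_abelian_group)
qed

text \<open>
  This is dual to \<open>cobdry_cobdry\<close>: pair the double boundary with the indicator function of \<open>gs\<close>.
\<close>
lemma (in ring) bdry_bdry:
  assumes "finite A" "\<And>gs. x gs \<in> carrier R" "gs \<in> tuples A n"
  shows "bdry R A (bdry R A x) gs = \<zero>"
proof -
  interpret biadditive R R R "(\<otimes>)" by (rule biadditive_mult)
  define f where "f hs = (if hs = gs then \<one> else \<zero>)" for hs
  have f: "f hs \<in> carrier R" for hs by (simp add: f_def)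
  have "bdry R A (bdry R A x) gs = (\<Oplus>hs\<in>tuples A n. if hs = gs then bdry R A (bdry R A x) hs else \<zero>)"
    using assms by (intro finsum_delta [symmetric]) (auto simp: finite_tuples)
  also have "\<dots> = (\<Oplus>hs\<in>tuples A n. bdry R A (bdry R A x) hs \<otimes> f hs)"
    using assms by (intro finsum_cong') (auto simp: f_def)
  also have "\<dots> = \<zero>"
    using assms f by (simp add: bdry_cobdry_adjoint cobdry_cobdry)
  finally show ?thesis .
qed

section \<open>Group rings and free modules\<close>

lemma (in group) bij_betw_translate: "g \<in> carrier G \<Longrightarrow> bij_betw (\<lambda>k. g \<otimes> k) (carrier G) (carrier G)"
  by (rule bij_betwI[where g = "\<lambda>k. inv g \<otimes> k"]) (auto simp: m_assoc [symmetric])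

lemma (in group) translate_inv_translate:
  assumes "g \<in> carrier G" "gs \<in> tuples (carrier G) n"
  shows "translate G (inv g) (translate G g gs) = gs"
    and "translate G g (translate G (inv g) gs) = gs"
  using assms by (auto simp: tuples_def m_assoc [symmetric] intro!: map_idI)

lemma (in group) translate_mult:
  assumes "g \<in> carrier G" "h \<in> carrier G" "gs \<in> tuples (carrier G) n"
  shows "translate G (g \<otimes> h) gs = translate G g (translate G h gs)"
  using assms by (auto simp: tuples_def m_assoc)

lemma (in group) translate_one: "gs \<in> tuples (carrier G) n \<Longrightarrow> translate G \<one> gs = gs"
  by (auto simp: tuples_def intro!: map_idI)

lemma (in group) translate_tuples:
  "g \<in> carrier G \<Longrightarrow> gs \<in> tuples (carrier G) n \<Longrightarrow> translate G g gs \<in> tuples (carrier G) n"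
  by (rule map_in_tuples) auto

lemma (in group) bij_betw_translate_tuples:
  "g \<in> carrier G \<Longrightarrow> bij_betw (translate G g) (tuples (carrier G) n) (tuples (carrier G) n)"
  by (rule bij_betwI[where g = "translate G (inv g)"])
    (simp_all add: translate_tuples translate_inv_translate del: map_map)

text \<open>
  The free \<open>S\<close>-module on the tuples of length \<open>n\<close>, with \<open>G\<close> acting on the basis by translation. For \<open>n > 0\<close> it
  is free over the group ring, since \<open>G\<close> acts freely on the tuples.
\<close>
definition free_module ::
  "('r, 'm) ring_scheme \<Rightarrow> ('g, 'n) monoid_scheme \<Rightarrow> nat \<Rightarrow> ('g \<Rightarrow> 'r, 'g list \<Rightarrow> 'r) module"
  where "free_module S G n =
    \<lparr>carrier = {x. (\<forall>gs. x gs \<in> carrier S) \<and> (\<forall>gs. gs \<notin> tuples (carrier G) n \<longrightarrow> x gs = \<zero>\<^bsub>S\<^esub>)},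
     mult = undefined, one = undefined, zero = (\<lambda>_. \<zero>\<^bsub>S\<^esub>), add = (\<lambda>x y gs. x gs \<oplus>\<^bsub>S\<^esub> y gs),
     smult = (\<lambda>a x gs. if gs \<in> tuples (carrier G) n
       then \<Oplus>\<^bsub>S\<^esub>g\<in>carrier G. a g \<otimes>\<^bsub>S\<^esub> x (translate G (inv\<^bsub>G\<^esub> g) gs) else \<zero>\<^bsub>S\<^esub>)\<rparr>"

locale finite_group_ring = S?: cring S + G?: group G
  for S :: "('r, 'm) ring_scheme" (structure) and G :: "('g, 'n) monoid_scheme" (structure) +
  assumes finite_group: "finite (carrier G)"
begin

abbreviation A where "A \<equiv> group_ring S G"

abbreviation Free where "Free \<equiv> free_module S G"

abbreviation single where "single \<equiv> group_ring_single S G"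

lemma single_closed [simp]: "s \<in> carrier S \<Longrightarrow> single s g \<in> carrier A"
  by (auto simp: group_ring_single_def group_ring_def)

lemma sum_single:
  assumes "s \<in> carrier S" "g \<in> carrier G" "\<And>k. k \<in> carrier G \<Longrightarrow> F k \<in> carrier S"
  shows "(\<Oplus>k\<in>carrier G. single s g k \<otimes> F k) = s \<otimes> F g"
proof -
  have "(\<Oplus>k\<in>carrier G. single s g k \<otimes> F k) =
      (\<Oplus>k\<in>carrier G. if k = g then s \<otimes> F k else \<zero>)"
    using assms by (intro S.finsum_cong') (auto simp: group_ring_single_def)
  then show ?thesis using assms finite_group by (simp add: S.finsum_delta)
qed

text \<open>
  The reindexing behind associativity, both for the product of the group ring and for its action on
  functions on a \<open>G\<close>-set.
\<close>
lemma convolution_assoc: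
  assumes "\<And>g. g \<in> carrier G \<Longrightarrow> a g \<in> carrier S" "\<And>g. g \<in> carrier G \<Longrightarrow> b g \<in> carrier S"
    "\<And>g. g \<in> carrier G \<Longrightarrow> y g \<in> carrier S"
  shows "(\<Oplus>g\<in>carrier G. (\<Oplus>k\<in>carrier G. a k \<otimes> b (inv\<^bsub>G\<^esub> k \<otimes>\<^bsub>G\<^esub> g)) \<otimes> y g) =
    (\<Oplus>k\<in>carrier G. a k \<otimes> (\<Oplus>g\<in>carrier G. b g \<otimes> y (k \<otimes>\<^bsub>G\<^esub> g)))"
proof -
  have "(\<Oplus>g\<in>carrier G. (\<Oplus>k\<in>carrier G. a k \<otimes> b (inv\<^bsub>G\<^esub> k \<otimes>\<^bsub>G\<^esub> g)) \<otimes> y g) =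
      (\<Oplus>g\<in>carrier G. \<Oplus>k\<in>carrier G. a k \<otimes> (b (inv\<^bsub>G\<^esub> k \<otimes>\<^bsub>G\<^esub> g) \<otimes> y g))"
    using assms finite_group
    by (intro S.finsum_cong') (auto simp: S.finsum_ldistr S.m_assoc intro!: S.finsum_cong')
  also have "\<dots> = (\<Oplus>k\<in>carrier G. \<Oplus>g\<in>carrier G. a k \<otimes> (b (inv\<^bsub>G\<^esub> k \<otimes>\<^bsub>G\<^esub> g) \<otimes> y g))"
    using assms finite_group by (intro S.finsum_swap) auto
  also have "\<dots> = (\<Oplus>k\<in>carrier G. a k \<otimes> (\<Oplus>g\<in>carrier G. b (inv\<^bsub>G\<^esub> k \<otimes>\<^bsub>G\<^esub> g) \<otimes> y g))"
    using assms finite_group by (intro S.finsum_cong') (auto simp: S.finsum_rdistr)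
  also have "\<dots> = (\<Oplus>k\<in>carrier G. a k \<otimes> (\<Oplus>g\<in>carrier G. b g \<otimes> y (k \<otimes>\<^bsub>G\<^esub> g)))"
  proof -
    have "(\<Oplus>g\<in>carrier G. b (inv\<^bsub>G\<^esub> k \<otimes>\<^bsub>G\<^esub> g) \<otimes> y g) = (\<Oplus>g\<in>carrier G. b g \<otimes> y (k \<otimes>\<^bsub>G\<^esub> g))"
      if k: "k \<in> carrier G" for k
    proof -
      have "(\<Oplus>g\<in>carrier G. b (inv\<^bsub>G\<^esub> k \<otimes>\<^bsub>G\<^esub> g) \<otimes> y g) =
          (\<Oplus>g\<in>carrier G. b (inv\<^bsub>G\<^esub> k \<otimes>\<^bsub>G\<^esub> (k \<otimes>\<^bsub>G\<^esub> g)) \<otimes> y (k \<otimes>\<^bsub>G\<^esub> g))"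
        using assms k by (intro S.finsum_bij [symmetric] G.bij_betw_translate) auto
      also have "\<dots> = (\<Oplus>g\<in>carrier G. b g \<otimes> y (k \<otimes>\<^bsub>G\<^esub> g))"
        using assms k by (intro S.finsum_cong') (auto simp: G.m_assoc [symmetric])
      finally show ?thesis .
    qed
    then show ?thesis using assms by (intro S.finsum_cong') auto
  qed
  finally show ?thesis .
qed

lemma group_ring_add_apply [simp]:
  "x \<in> carrier G \<Longrightarrow> (a \<oplus>\<^bsub>A\<^esub> b) x = a x \<oplus> b x"
  by (simp add: group_ring_def)

lemma group_ring_mult_apply:
  "x \<in> carrier G \<Longrightarrow> (a \<otimes>\<^bsub>A\<^esub> b) x = (\<Oplus>g\<in>carrier G. a g \<otimes> b (inv\<^bsub>G\<^esub> g \<otimes>\<^bsub>G\<^esub> x))"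
  by (simp add: group_ring_def)

lemma carrier_group_ring: "carrier A = carrier G \<rightarrow>\<^sub>E carrier S"
  by (simp add: group_ring_def)

lemma group_ring_one: "\<one>\<^bsub>A\<^esub> = single \<one> \<one>\<^bsub>G\<^esub>"
  by (simp add: group_ring_def group_ring_single_def)

lemma group_ring_apply_closed [simp]:
  "a \<in> carrier A \<Longrightarrow> g \<in> carrier G \<Longrightarrow> a g \<in> carrier S"
  by (auto simp: carrier_group_ring)

lemma group_ring_mult_closed:
  assumes "a \<in> carrier A" "b \<in> carrier A" shows "a \<otimes>\<^bsub>A\<^esub> b \<in> carrier A"
  using assms by (auto simp: group_ring_def intro!: S.finsum_closed)

lemma group_ring_add_closed:
  assumes "a \<in> carrier A" "b \<in> carrier A" shows "a \<oplus>\<^bsub>A\<^esub> b \<in> carrier A"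
  using assms by (auto simp: group_ring_def)

lemma group_ring_zero_closed: "\<zero>\<^bsub>A\<^esub> \<in> carrier A"
  by (simp add: group_ring_def)

lemma group_ring_zero_apply [simp]: "x \<in> carrier G \<Longrightarrow> \<zero>\<^bsub>A\<^esub> x = \<zero>"
  by (simp add: group_ring_def)

lemma group_ring_eqI:
  assumes "a \<in> carrier A" "b \<in> carrier A" "\<And>x. x \<in> carrier G \<Longrightarrow> a x = b x"
  shows "a = b"
  using assms unfolding carrier_group_ring by (rule PiE_ext)

lemma sum_add_left:
  assumes "a \<in> carrier A" "b \<in> carrier A" "\<And>g. g \<in> carrier G \<Longrightarrow> y g \<in> carrier S"
  shows "(\<Oplus>g\<in>carrier G. (a \<oplus>\<^bsub>A\<^esub> b) g \<otimes> y g) =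
    (\<Oplus>g\<in>carrier G. a g \<otimes> y g) \<oplus> (\<Oplus>g\<in>carrier G. b g \<otimes> y g)"
proof -
  have "(\<Oplus>g\<in>carrier G. (a \<oplus>\<^bsub>A\<^esub> b) g \<otimes> y g) =
      (\<Oplus>g\<in>carrier G. a g \<otimes> y g \<oplus> b g \<otimes> y g)"
    using assms by (intro S.finsum_cong') (auto simp: S.l_distr)
  also have "\<dots> = (\<Oplus>g\<in>carrier G. a g \<otimes> y g) \<oplus> (\<Oplus>g\<in>carrier G. b g \<otimes> y g)"
    using assms by (intro S.finsum_addf) auto
  finally show ?thesis .
qed

lemma sum_add_right:
  assumes "a \<in> carrier A" "\<And>g. g \<in> carrier G \<Longrightarrow> y g \<in> carrier S"
    "\<And>g. g \<in> carrier G \<Longrightarrow> z g \<in> carrier S"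
  shows "(\<Oplus>g\<in>carrier G. a g \<otimes> (y g \<oplus> z g)) =
    (\<Oplus>g\<in>carrier G. a g \<otimes> y g) \<oplus> (\<Oplus>g\<in>carrier G. a g \<otimes> z g)"
proof -
  have "(\<Oplus>g\<in>carrier G. a g \<otimes> (y g \<oplus> z g)) =
      (\<Oplus>g\<in>carrier G. a g \<otimes> y g \<oplus> a g \<otimes> z g)"
    using assms by (intro S.finsum_cong') (auto simp: S.r_distr)
  also have "\<dots> = (\<Oplus>g\<in>carrier G. a g \<otimes> y g) \<oplus> (\<Oplus>g\<in>carrier G. a g \<otimes> z g)"
    using assms by (intro S.finsum_addf) auto
  finally show ?thesis .
qed

lemma ring_group_ring: "ring A"
proof (rule ringI)
  show "abelian_group A"
  proof (rule abelian_groupI)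
    fix a b c assume abc: "a \<in> carrier A" "b \<in> carrier A" "c \<in> carrier A"
    show "a \<oplus>\<^bsub>A\<^esub> b \<oplus>\<^bsub>A\<^esub> c = a \<oplus>\<^bsub>A\<^esub> (b \<oplus>\<^bsub>A\<^esub> c)"
      using abc by (intro group_ring_eqI) (simp_all add: group_ring_add_closed S.a_assoc)
  next
    fix a b assume ab: "a \<in> carrier A" "b \<in> carrier A"
    show "a \<oplus>\<^bsub>A\<^esub> b = b \<oplus>\<^bsub>A\<^esub> a"
      using ab by (intro group_ring_eqI) (simp_all add: group_ring_add_closed S.a_comm)
  next
    fix a assume a: "a \<in> carrier A"
    show "\<zero>\<^bsub>A\<^esub> \<oplus>\<^bsub>A\<^esub> a = a"
      using a by (intro group_ring_eqI) (simp_all add: group_ring_add_closed group_ring_zero_closed)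
    have minus: "(\<lambda>x\<in>carrier G. \<ominus> a x) \<in> carrier A"
      using a by (simp add: carrier_group_ring)
    have "(\<lambda>x\<in>carrier G. \<ominus> a x) \<oplus>\<^bsub>A\<^esub> a = \<zero>\<^bsub>A\<^esub>"
      using a minus
      by (intro group_ring_eqI) (simp_all add: group_ring_add_closed group_ring_zero_closed S.l_neg)
    with minus show "\<exists>b\<in>carrier A. b \<oplus>\<^bsub>A\<^esub> a = \<zero>\<^bsub>A\<^esub>" by blast
  qed (simp_all add: group_ring_add_closed group_ring_zero_closed)
  show "Group.monoid A"
  proof (rule monoidI)
    fix a b c assume abc: "a \<in> carrier A" "b \<in> carrier A" "c \<in> carrier A"
    show "a \<otimes>\<^bsub>A\<^esub> b \<otimes>\<^bsub>A\<^esub> c = a \<otimes>\<^bsub>A\<^esub> (b \<otimes>\<^bsub>A\<^esub> c)"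
    proof (rule group_ring_eqI)
      fix x assume x: "x \<in> carrier G"
      have "(a \<otimes>\<^bsub>A\<^esub> b \<otimes>\<^bsub>A\<^esub> c) x = (\<Oplus>g\<in>carrier G.
          (\<Oplus>k\<in>carrier G. a k \<otimes> b (inv\<^bsub>G\<^esub> k \<otimes>\<^bsub>G\<^esub> g)) \<otimes> c (inv\<^bsub>G\<^esub> g \<otimes>\<^bsub>G\<^esub> x))"
        using abc x by (subst group_ring_mult_apply[OF x], intro S.finsum_cong')
          (auto simp: group_ring_mult_apply)
      also have "\<dots> = (\<Oplus>k\<in>carrier G. a k \<otimes>
          (\<Oplus>g\<in>carrier G. b g \<otimes> c (inv\<^bsub>G\<^esub> (k \<otimes>\<^bsub>G\<^esub> g) \<otimes>\<^bsub>G\<^esub> x)))"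
        using abc x by (intro convolution_assoc) auto
      also have "\<dots> = (\<Oplus>k\<in>carrier G. a k \<otimes> (b \<otimes>\<^bsub>A\<^esub> c) (inv\<^bsub>G\<^esub> k \<otimes>\<^bsub>G\<^esub> x))"
      proof (rule S.finsum_cong')
        fix k assume k: "k \<in> carrier G"
        have "(b \<otimes>\<^bsub>A\<^esub> c) (inv\<^bsub>G\<^esub> k \<otimes>\<^bsub>G\<^esub> x) =
            (\<Oplus>g\<in>carrier G. b g \<otimes> c (inv\<^bsub>G\<^esub> (k \<otimes>\<^bsub>G\<^esub> g) \<otimes>\<^bsub>G\<^esub> x))"
          using abc x k by (subst group_ring_mult_apply, simp, intro S.finsum_cong')
            (auto simp: G.inv_mult_group G.m_assoc)
        then show "a k \<otimes> (\<Oplus>g\<in>carrier G. b g \<otimes> c (inv\<^bsub>G\<^esub> (k \<otimes>\<^bsub>G\<^esub> g) \<otimes>\<^bsub>G\<^esub> x)) =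
            a k \<otimes> (b \<otimes>\<^bsub>A\<^esub> c) (inv\<^bsub>G\<^esub> k \<otimes>\<^bsub>G\<^esub> x)"
          by simp
      qed (use abc x in \<open>auto simp: group_ring_mult_closed\<close>)
      also have "\<dots> = (a \<otimes>\<^bsub>A\<^esub> (b \<otimes>\<^bsub>A\<^esub> c)) x"
        using x by (simp add: group_ring_mult_apply)
      finally show "(a \<otimes>\<^bsub>A\<^esub> b \<otimes>\<^bsub>A\<^esub> c) x = (a \<otimes>\<^bsub>A\<^esub> (b \<otimes>\<^bsub>A\<^esub> c)) x" .
    qed (use abc in \<open>simp_all add: group_ring_mult_closed\<close>)
  next
    fix a assume a: "a \<in> carrier A"
    show "\<one>\<^bsub>A\<^esub> \<otimes>\<^bsub>A\<^esub> a = a"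
      using a by (intro group_ring_eqI)
        (auto simp: group_ring_mult_closed group_ring_one group_ring_mult_apply sum_single)
    show "a \<otimes>\<^bsub>A\<^esub> \<one>\<^bsub>A\<^esub> = a"
    proof (rule group_ring_eqI)
      fix x assume x: "x \<in> carrier G"
      have "(a \<otimes>\<^bsub>A\<^esub> \<one>\<^bsub>A\<^esub>) x = (\<Oplus>g\<in>carrier G. if g = x then a g else \<zero>)"
        unfolding group_ring_mult_apply[OF x]
      proof (rule S.finsum_cong')
        fix g assume g: "g \<in> carrier G"
        have "inv\<^bsub>G\<^esub> g \<otimes>\<^bsub>G\<^esub> x = \<one>\<^bsub>G\<^esub> \<longleftrightarrow> g = x"
          using g x by (metis G.inv_closed G.inv_equality G.inv_inv G.l_inv)
        then show "a g \<otimes> \<one>\<^bsub>A\<^esub> (inv\<^bsub>G\<^esub> g \<otimes>\<^bsub>G\<^esub> x) = (if g = x then a g else \<zero>)"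
          using a g x by (simp add: group_ring_def)
      qed (use a in auto)
      then show "(a \<otimes>\<^bsub>A\<^esub> \<one>\<^bsub>A\<^esub>) x = a x" using a x finite_group by (simp add: S.finsum_delta)
    qed (use a in \<open>simp_all add: group_ring_mult_closed group_ring_one\<close>)
  qed (simp_all add: group_ring_mult_closed group_ring_one)
next
  fix a b c assume abc: "a \<in> carrier A" "b \<in> carrier A" "c \<in> carrier A"
  show "(a \<oplus>\<^bsub>A\<^esub> b) \<otimes>\<^bsub>A\<^esub> c = a \<otimes>\<^bsub>A\<^esub> c \<oplus>\<^bsub>A\<^esub> b \<otimes>\<^bsub>A\<^esub> c"
  proof (rule group_ring_eqI)
    fix x assume x: "x \<in> carrier G"
    show "((a \<oplus>\<^bsub>A\<^esub> b) \<otimes>\<^bsub>A\<^esub> c) x = (a \<otimes>\<^bsub>A\<^esub> c \<oplus>\<^bsub>A\<^esub> b \<otimes>\<^bsub>A\<^esub> c) x"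
      using abc x by (simp add: group_ring_mult_apply sum_add_left)
  qed (use abc in \<open>simp_all add: group_ring_mult_closed group_ring_add_closed\<close>)
  show "c \<otimes>\<^bsub>A\<^esub> (a \<oplus>\<^bsub>A\<^esub> b) = c \<otimes>\<^bsub>A\<^esub> a \<oplus>\<^bsub>A\<^esub> c \<otimes>\<^bsub>A\<^esub> b"
  proof (rule group_ring_eqI)
    fix x assume x: "x \<in> carrier G"
    show "(c \<otimes>\<^bsub>A\<^esub> (a \<oplus>\<^bsub>A\<^esub> b)) x = (c \<otimes>\<^bsub>A\<^esub> a \<oplus>\<^bsub>A\<^esub> c \<otimes>\<^bsub>A\<^esub> b) x"
    proof -
      have "(c \<otimes>\<^bsub>A\<^esub> (a \<oplus>\<^bsub>A\<^esub> b)) x = (\<Oplus>g\<in>carrier G. c g \<otimes>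
          (a (inv\<^bsub>G\<^esub> g \<otimes>\<^bsub>G\<^esub> x) \<oplus> b (inv\<^bsub>G\<^esub> g \<otimes>\<^bsub>G\<^esub> x)))"
        using abc x by (subst group_ring_mult_apply[OF x], intro S.finsum_cong') auto
      then show ?thesis
        using abc x by (simp add: group_ring_mult_apply sum_add_right)
    qed
  qed (use abc in \<open>simp_all add: group_ring_mult_closed group_ring_add_closed\<close>)
qed

sublocale A?: ring A by (rule ring_group_ring)

lemma single_mult:
  assumes "s \<in> carrier S" "t \<in> carrier S" "g \<in> carrier G" "h \<in> carrier G"
  shows "single s g \<otimes>\<^bsub>A\<^esub> single t h = single (s \<otimes> t) (g \<otimes>\<^bsub>G\<^esub> h)"
proof (rule group_ring_eqI)
  fix x assume x: "x \<in> carrier G"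
  have "inv\<^bsub>G\<^esub> g \<otimes>\<^bsub>G\<^esub> x = h \<longleftrightarrow> x = g \<otimes>\<^bsub>G\<^esub> h"
    using assms x by (metis G.inv_solve_left)
  then show "(single s g \<otimes>\<^bsub>A\<^esub> single t h) x = single (s \<otimes> t) (g \<otimes>\<^bsub>G\<^esub> h) x"
    using assms x by (simp add: group_ring_mult_apply sum_single) (simp add: group_ring_single_def)
qed (use assms in simp_all)

lemma single_add:
  assumes "s \<in> carrier S" "t \<in> carrier S"
  shows "single (s \<oplus> t) g = single s g \<oplus>\<^bsub>A\<^esub> single t g"
  using assms
  by (intro group_ring_eqI) (simp_all add: group_ring_add_closed, simp add: group_ring_single_def)

lemma finsum_group_ring_apply:
  assumes "\<And>i. i \<in> I \<Longrightarrow> F i \<in> carrier A" "x \<in> carrier G"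
  shows "(\<Oplus>\<^bsub>A\<^esub>i\<in>I. F i) x = (\<Oplus>i\<in>I. F i x)"
  using assms
proof (induction I rule: infinite_finite_induct)
  case (insert i I)
  then show ?case by (simp add: Pi_def)
qed simp_all

lemma group_ring_decomposition:
  assumes "a \<in> carrier A"
  shows "a = (\<Oplus>\<^bsub>A\<^esub>g\<in>carrier G. single (a g) g)"
proof (rule group_ring_eqI[OF assms])
  fix x assume x: "x \<in> carrier G"
  have "(\<Oplus>\<^bsub>A\<^esub>g\<in>carrier G. single (a g) g) x = (\<Oplus>g\<in>carrier G. if g = x then a g else \<zero>)"
    using assms x by (subst finsum_group_ring_apply)
      (auto simp: group_ring_single_def carrier_group_ring intro!: S.finsum_cong')
  then show "a x = (\<Oplus>\<^bsub>A\<^esub>g\<in>carrier G. single (a g) g) x"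
    using assms x finite_group by (simp add: S.finsum_delta)
qed (use assms in \<open>auto intro!: A.finsum_closed\<close>)

lemma single_split:
  assumes "s \<in> carrier S" "g \<in> carrier G"
  shows "single s g = single s \<one>\<^bsub>G\<^esub> \<otimes>\<^bsub>A\<^esub> single \<one> g"
    and "single s g = single \<one> g \<otimes>\<^bsub>A\<^esub> single s \<one>\<^bsub>G\<^esub>"
  using assms by (simp_all add: single_mult)

end

context left_module
begin

lemma smult_hom: "a \<in> carrier A \<Longrightarrow> abelian_group_hom M M (\<lambda>x. a \<odot>\<^bsub>M\<^esub> x)"
  by (intro abelian_group_hom_additiveI M.abelian_group_axioms) (simp_all add: smult_closed smult_r_distr)

lemma scalar_hom:
  assumes "x \<in> carrier M"
  shows "abelian_group_hom A M (\<lambda>a. a \<odot>\<^bsub>M\<^esub> x)"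
  using assms
  by (intro abelian_group_hom_additiveI M.abelian_group_axioms A.is_abelian_group)
    (simp_all add: smult_closed smult_l_distr)

end

lemma left_module_hom_abelian_group_hom:
  assumes "left_module A M" "left_module A N" "\<phi> \<in> left_module_hom A M N"
  shows "abelian_group_hom M N \<phi>"
  using assms left_module.axioms(2)[OF assms(1)] left_module.axioms(2)[OF assms(2)]
  by (intro abelian_group_hom_additiveI) (auto simp: left_module_hom_def)

context finite_group_ring
begin

text \<open>
  The elements \<open>s g\<close> span the group ring additively, so linearity need only be tested on them.
\<close>
lemma left_module_homI:
  assumes M: "left_module A M" and N: "left_module A N" and \<phi>: "abelian_group_hom M N \<phi>"
    and single: "\<And>s g x. s \<in> carrier S \<Longrightarrow> g \<in> carrier G \<Longrightarrow> x \<in> carrier M \<Longrightarrow>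
      \<phi> (single s g \<odot>\<^bsub>M\<^esub> x) = single s g \<odot>\<^bsub>N\<^esub> \<phi> x"
  shows "\<phi> \<in> left_module_hom A M N"
proof -
  interpret M: left_module A M by (rule M)
  interpret N: left_module A N by (rule N)
  interpret \<phi>: abelian_group_hom M N \<phi> by (rule \<phi>)
  have "\<phi> (a \<odot>\<^bsub>M\<^esub> x) = a \<odot>\<^bsub>N\<^esub> \<phi> x" if a: "a \<in> carrier A" and x: "x \<in> carrier M" for a x
  proof -
    have s: "single (a g) g \<in> carrier A" if "g \<in> carrier G" for g
      using a that by simp
    have "a \<odot>\<^bsub>M\<^esub> x = (\<Oplus>\<^bsub>M\<^esub>g\<in>carrier G. single (a g) g \<odot>\<^bsub>M\<^esub> x)"
      using abelian_group_hom.hom_finsum[OF M.scalar_hom[OF x] s, of "carrier G" "\<lambda>g. g"]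
        group_ring_decomposition[OF a]
      by simp
    then have "\<phi> (a \<odot>\<^bsub>M\<^esub> x) = (\<Oplus>\<^bsub>N\<^esub>g\<in>carrier G. \<phi> (single (a g) g \<odot>\<^bsub>M\<^esub> x))"
      using s x by (simp add: \<phi>.hom_finsum M.smult_closed)
    also have "\<dots> = (\<Oplus>\<^bsub>N\<^esub>g\<in>carrier G. single (a g) g \<odot>\<^bsub>N\<^esub> \<phi> x)"
      using a x by (intro N.M.finsum_cong') (simp_all add: single N.smult_closed)
    also have "\<dots> = a \<odot>\<^bsub>N\<^esub> \<phi> x"
      using abelian_group_hom.hom_finsum[OF N.scalar_hom[OF \<phi>.hom_closed[OF x]] s,
          of "carrier G" "\<lambda>g. g"]
        group_ring_decomposition[OF a]
      by simp
    finally show ?thesis .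
  qed
  then show ?thesis
    by (auto simp: left_module_hom_def)
qed

lemma equivariant_group_left_module:
  assumes "left_module A M"
  shows "equivariant_group G M (\<lambda>g x. single \<one> g \<odot>\<^bsub>M\<^esub> x)"
proof -
  interpret M: left_module A M by (rule assms)
  show ?thesis
  proof (intro equivariant_group.intro equivariant_group_axioms.intro G.is_group M.M.abelian_group_axioms)
    fix g h x assume g: "g \<in> carrier G" and h: "h \<in> carrier G" and x: "x \<in> carrier M"
    have "single \<one> (g \<otimes>\<^bsub>G\<^esub> h) = single \<one> g \<otimes>\<^bsub>A\<^esub> single \<one> h"
      using g h by (simp add: single_mult)
    then show "single \<one> (g \<otimes>\<^bsub>G\<^esub> h) \<odot>\<^bsub>M\<^esub> x = single \<one> g \<odot>\<^bsub>M\<^esub> (single \<one> h \<odot>\<^bsub>M\<^esub> x)"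
      using x by (simp add: M.smult_assoc)
  qed (use M.smult_one in \<open>simp_all add: M.smult_hom group_ring_one\<close>)
qed

lemma free_module_abelian_group: "abelian_group (Free n)"
proof (rule abelian_groupI)
  fix x assume x: "x \<in> carrier (Free n)"
  then have "(\<lambda>gs. \<ominus> x gs) \<in> carrier (Free n)"
    by (simp add: free_module_def)
  moreover have "(\<lambda>gs. \<ominus> x gs) \<oplus>\<^bsub>Free n\<^esub> x = \<zero>\<^bsub>Free n\<^esub>"
    using x by (simp add: free_module_def S.l_neg)
  ultimately show "\<exists>y\<in>carrier (Free n). y \<oplus>\<^bsub>Free n\<^esub> x = \<zero>\<^bsub>Free n\<^esub>"
    by blast
qed (auto simp: free_module_def S.a_ac)

lemma free_module_single_smult:
  assumes "s \<in> carrier S" "g \<in> carrier G" "x \<in> carrier (Free n)"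
  shows "single s g \<odot>\<^bsub>Free n\<^esub> x = (\<lambda>gs. if gs \<in> tuples (carrier G) n
    then s \<otimes> x (translate G (inv\<^bsub>G\<^esub> g) gs) else \<zero>)"
  using assms by (auto simp: free_module_def sum_single)

lemma left_module_free_module: "left_module A (Free n)"
proof (intro left_module.intro left_module_axioms.intro ring_group_ring free_module_abelian_group)
  let ?F = "Free n"
  fix a b x y assume a: "a \<in> carrier A" and b: "b \<in> carrier A"
    and x: "x \<in> carrier ?F" and y: "y \<in> carrier ?F"
  have cl: "a g \<in> carrier S" "b g \<in> carrier S" if "g \<in> carrier G" for g
    using a b that by simp_all
  have xy: "x gs \<in> carrier S" "y gs \<in> carrier S" for gs
    using x y by (simp_all add: free_module_def)
  show "a \<odot>\<^bsub>?F\<^esub> x \<in> carrier ?F"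
    using cl xy by (auto simp: free_module_def intro!: S.finsum_closed)
  show "(a \<oplus>\<^bsub>A\<^esub> b) \<odot>\<^bsub>?F\<^esub> x = a \<odot>\<^bsub>?F\<^esub> x \<oplus>\<^bsub>?F\<^esub> b \<odot>\<^bsub>?F\<^esub> x"
    using a b xy by (auto simp: free_module_def sum_add_left)
  show "a \<odot>\<^bsub>?F\<^esub> (x \<oplus>\<^bsub>?F\<^esub> y) = a \<odot>\<^bsub>?F\<^esub> x \<oplus>\<^bsub>?F\<^esub> a \<odot>\<^bsub>?F\<^esub> y"
    using a xy by (auto simp: free_module_def sum_add_right)
  show "(a \<otimes>\<^bsub>A\<^esub> b) \<odot>\<^bsub>?F\<^esub> x = a \<odot>\<^bsub>?F\<^esub> (b \<odot>\<^bsub>?F\<^esub> x)"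
  proof
    fix gs
    show "((a \<otimes>\<^bsub>A\<^esub> b) \<odot>\<^bsub>?F\<^esub> x) gs = (a \<odot>\<^bsub>?F\<^esub> (b \<odot>\<^bsub>?F\<^esub> x)) gs"
    proof (cases "gs \<in> tuples (carrier G) n")
      case gs: True
      have "((a \<otimes>\<^bsub>A\<^esub> b) \<odot>\<^bsub>?F\<^esub> x) gs = (\<Oplus>g\<in>carrier G.
          (\<Oplus>k\<in>carrier G. a k \<otimes> b (inv\<^bsub>G\<^esub> k \<otimes>\<^bsub>G\<^esub> g)) \<otimes> x (translate G (inv\<^bsub>G\<^esub> g) gs))"
        using gs cl xy by (auto simp: free_module_def group_ring_mult_apply intro!: S.finsum_cong' S.m_closed S.finsum_closed)
      also have "\<dots> = (\<Oplus>k\<in>carrier G. a k \<otimes>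
          (\<Oplus>g\<in>carrier G. b g \<otimes> x (translate G (inv\<^bsub>G\<^esub> (k \<otimes>\<^bsub>G\<^esub> g)) gs)))"
        using cl xy by (intro convolution_assoc) auto
      also have "\<dots> = (\<Oplus>k\<in>carrier G. a k \<otimes> (b \<odot>\<^bsub>?F\<^esub> x) (translate G (inv\<^bsub>G\<^esub> k) gs))"
      proof (rule S.finsum_cong')
        fix k assume k: "k \<in> carrier G"
        have "(b \<odot>\<^bsub>?F\<^esub> x) (translate G (inv\<^bsub>G\<^esub> k) gs) = (\<Oplus>g\<in>carrier G. b g \<otimes>
            x (translate G (inv\<^bsub>G\<^esub> g) (translate G (inv\<^bsub>G\<^esub> k) gs)))"
          using G.translate_tuples[OF G.inv_closed[OF k] gs] by (simp add: free_module_def)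
        also have "\<dots> = (\<Oplus>g\<in>carrier G. b g \<otimes> x (translate G (inv\<^bsub>G\<^esub> (k \<otimes>\<^bsub>G\<^esub> g)) gs))"
          using k gs cl xy by (intro S.finsum_cong')
            (auto simp: G.inv_mult_group G.translate_mult simp del: map_map)
        finally show "a k \<otimes> (\<Oplus>g\<in>carrier G. b g \<otimes>
            x (translate G (inv\<^bsub>G\<^esub> (k \<otimes>\<^bsub>G\<^esub> g)) gs)) =
            a k \<otimes> (b \<odot>\<^bsub>?F\<^esub> x) (translate G (inv\<^bsub>G\<^esub> k) gs)"
          by simp
      qed (use cl xy in \<open>auto simp: free_module_def intro!: S.m_closed S.finsum_closed\<close>)
      also have "\<dots> = (a \<odot>\<^bsub>?F\<^esub> (b \<odot>\<^bsub>?F\<^esub> x)) gs"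
        using gs by (simp add: free_module_def)
      finally show ?thesis .
    qed (simp add: free_module_def)
  qed
next
  let ?F = "Free n"
  fix x assume x: "x \<in> carrier ?F"
  show "\<one>\<^bsub>A\<^esub> \<odot>\<^bsub>?F\<^esub> x = x"
    unfolding group_ring_one
    by (subst free_module_single_smult[OF _ _ x])
      (use x in \<open>auto simp: free_module_def fun_eq_iff tuples_def map_idI subset_iff\<close>)
qed

end

section \<open>Acyclicity of injective modules\<close>

text \<open>
  A copy of a module in another type. Injectivity of \<open>E\<close> is tested with modules in the type
  \<^typ>\<open>nat \<Rightarrow> 'a\<close>, and the free modules used here are moved into it by this construction.
\<close>
definition transport_module ::
  "('c \<Rightarrow> 'd) \<Rightarrow> ('a, 'c) module \<Rightarrow> ('a, 'd) module"
  where "transport_module j N =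
    (let i = inv_into (carrier N) j in
      \<lparr>carrier = j ` carrier N, mult = undefined, one = undefined, zero = j \<zero>\<^bsub>N\<^esub>,
       add = (\<lambda>x y. j (i x \<oplus>\<^bsub>N\<^esub> i y)), smult = (\<lambda>a x. j (a \<odot>\<^bsub>N\<^esub> i x))\<rparr>)"

lemma transport_module_simps:
  assumes "inj_on j (carrier N)"
  shows "carrier (transport_module j N) = j ` carrier N"
    and "\<zero>\<^bsub>transport_module j N\<^esub> = j \<zero>\<^bsub>N\<^esub>"
    and "x \<in> carrier N \<Longrightarrow> y \<in> carrier N \<Longrightarrow> j x \<oplus>\<^bsub>transport_module j N\<^esub> j y = j (x \<oplus>\<^bsub>N\<^esub> y)"
    and "x \<in> carrier N \<Longrightarrow> a \<odot>\<^bsub>transport_module j N\<^esub> j x = j (a \<odot>\<^bsub>N\<^esub> x)"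
  using assms by (simp_all add: transport_module_def Let_def)

lemma left_module_transport:
  assumes "left_module A N" and inj: "inj_on j (carrier N)"
  shows "left_module A (transport_module j N)"
proof -
  interpret N: left_module A N by (rule assms)
  note [simp] = transport_module_simps[OF inj]
  have "abelian_group (transport_module j N)"
  proof (rule abelian_groupI)
    fix x assume "x \<in> carrier (transport_module j N)"
    then obtain x' where "x = j x'" "x' \<in> carrier N" by auto
    then show "\<exists>y\<in>carrier (transport_module j N). y \<oplus>\<^bsub>transport_module j N\<^esub> x = \<zero>\<^bsub>transport_module j N\<^esub>"
      by (intro bexI[of _ "j (\<ominus>\<^bsub>N\<^esub> x')"]) (simp_all add: N.M.l_neg)
  qed (auto simp: N.M.a_ac)
  then show ?thesis
    by (intro left_module.intro left_module_axioms.intro N.A.ring_axioms)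
      (auto simp: N.smult_closed N.smult_l_distr N.smult_r_distr N.smult_assoc N.smult_one)
qed

definition kernel_module ::
  "('a, 'c) module \<Rightarrow> ('c \<Rightarrow> 'd) \<Rightarrow> ('a, 'd) module \<Rightarrow> ('a, 'c) module"
  where "kernel_module N \<phi> N' = N\<lparr>carrier := {x \<in> carrier N. \<phi> x = \<zero>\<^bsub>N'\<^esub>}\<rparr>"

lemma left_module_kernel:
  assumes N: "left_module A N" and N': "left_module A N'" and \<phi>: "\<phi> \<in> left_module_hom A N N'"
  shows "left_module A (kernel_module N \<phi> N')"
proof -
  interpret N: left_module A N by (rule N)
  interpret N': left_module A N' by (rule N')
  interpret \<phi>: abelian_group_hom N N' \<phi>
    by (rule left_module_hom_abelian_group_hom[OF N N' \<phi>])
  have "abelian_group (kernel_module N \<phi> N')"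
  proof (rule abelian_groupI)
    fix x assume "x \<in> carrier (kernel_module N \<phi> N')"
    then show "\<exists>y\<in>carrier (kernel_module N \<phi> N'). y \<oplus>\<^bsub>kernel_module N \<phi> N'\<^esub> x = \<zero>\<^bsub>kernel_module N \<phi> N'\<^esub>"
      using abelian_group_hom.hom_zero[OF N'.smult_hom]
      by (intro bexI[of _ "\<ominus>\<^bsub>N\<^esub> x"])
        (simp_all add: kernel_module_def N.M.l_neg N'.M.minus_equality)
  qed (auto simp: kernel_module_def N.M.a_ac)
  moreover have "\<phi> (a \<odot>\<^bsub>N\<^esub> x) = \<zero>\<^bsub>N'\<^esub>" if "a \<in> carrier A" "x \<in> carrier N" "\<phi> x = \<zero>\<^bsub>N'\<^esub>" for a x
    using \<phi> that abelian_group_hom.hom_zero[OF N'.smult_hom[OF that(1)]]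
    by (auto simp: left_module_hom_def)
  ultimately show ?thesis
    by (intro left_module.intro left_module_axioms.intro N.A.ring_axioms)
      (auto simp: kernel_module_def N.smult_closed N.smult_l_distr N.smult_r_distr N.smult_assoc N.smult_one)
qed

text \<open>
  The extension property for a submodule that is the kernel of a linear map, and for modules of
  arbitrary type, as long as their elements can be encoded in the type of the test modules.
\<close>
lemma injective_module_extend_from_kernel:
  fixes A :: "('a, 'm) ring_scheme" and N :: "('a, 'c) module" and j :: "'c \<Rightarrow> nat \<Rightarrow> 'a"
  assumes E: "injective_module A E"
    and N: "left_module A N" and N': "left_module A N'" and \<phi>: "\<phi> \<in> left_module_hom A N N'"
    and g: "g \<in> left_module_hom A (kernel_module N \<phi> N') E"
    and inj: "inj_on j (carrier N)"
  obtains h where "h \<in> left_module_hom A N E"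
    and "\<And>x. x \<in> carrier N \<Longrightarrow> \<phi> x = \<zero>\<^bsub>N'\<^esub> \<Longrightarrow> h x = g x"
proof -
  define K where "K = kernel_module N \<phi> N'"
  have K: "left_module A K" unfolding K_def by (rule left_module_kernel[OF N N' \<phi>])
  have K_simps: "carrier K = {x \<in> carrier N. \<phi> x = \<zero>\<^bsub>N'\<^esub>}" "add K = add N" "smult K = smult N"
    by (simp_all add: K_def kernel_module_def)
  have injK: "inj_on j (carrier K)" using inj by (rule inj_on_subset) (auto simp: K_simps)
  define i where "i = inv_into (carrier N) j"
  have i: "i (j x) = x" if "x \<in> carrier N" for x using inj that by (simp add: i_def)
  interpret N: left_module A N by (rule N)
  interpret K: left_module A K by (rule K)
  let ?tN = "transport_module j N" and ?tK = "transport_module j K"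
  note [simp] = transport_module_simps[OF inj] transport_module_simps[OF injK]
  have "(\<lambda>x. x) \<in> left_module_hom A ?tK ?tN"
    using K_simps by (auto simp: left_module_hom_def)
  moreover have "(\<lambda>x. g (i x)) \<in> left_module_hom A ?tK E"
    using g i K.smult_closed K.M.a_closed
    unfolding left_module_hom_def K_def [symmetric] by (auto simp: K_simps)
  ultimately obtain h where h: "h \<in> left_module_hom A ?tN E" "\<forall>x\<in>carrier ?tK. h x = g (i x)"
    using E left_module_transport[OF N inj] left_module_transport[OF K injK]
    unfolding injective_module_def by (metis inj_on_id2)
  show thesis
  proof
    show "(\<lambda>x. h (j x)) \<in> left_module_hom A N E"
      using h(1) by (auto simp: left_module_hom_def N.smult_closed simp flip: transport_module_simps(3,4)[OF inj])
    show "h (j x) = g x" if "x \<in> carrier N" "\<phi> x = \<zero>\<^bsub>N'\<^esub>" for x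
      using h(2) that i by (simp add: K_simps)
  qed
qed

definition chain_d ::
  "('r, 'm) ring_scheme \<Rightarrow> ('g, 'n) monoid_scheme \<Rightarrow> nat \<Rightarrow> ('g list \<Rightarrow> 'r) \<Rightarrow> 'g list \<Rightarrow> 'r"
  where "chain_d S G n x gs = (if gs \<in> tuples (carrier G) n then bdry S (carrier G) x gs else \<zero>\<^bsub>S\<^esub>)"

definition basis_tuple :: "('r, 'm) ring_scheme \<Rightarrow> 'g list \<Rightarrow> 'g list \<Rightarrow> 'r"
  where "basis_tuple S gs hs = (if hs = gs then \<one>\<^bsub>S\<^esub> else \<zero>\<^bsub>S\<^esub>)"

context finite_group_ring
begin

lemma free_module_apply_closed: "x \<in> carrier (Free n) \<Longrightarrow> x gs \<in> carrier S"
  by (simp add: free_module_def)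

lemma chain_d_linear: "chain_d S G n \<in> left_module_hom A (Free (Suc n)) (Free n)"
proof (rule left_module_homI[OF left_module_free_module left_module_free_module])
  show "abelian_group_hom (Free (Suc n)) (Free n) (chain_d S G n)"
    by (rule abelian_group_hom_additiveI[OF free_module_abelian_group free_module_abelian_group])
      (auto simp: free_module_def chain_d_def S.bdry_add)
  fix s g x
  assume s: "s \<in> carrier S" and g: "g \<in> carrier G" and x: "x \<in> carrier (Free (Suc n))"
  have xS: "x hs \<in> carrier S" for hs using x by (rule free_module_apply_closed)
  have hom: "abelian_group_hom S S (\<lambda>t. s \<otimes> t)"
    using s S.biadditive_mult by (rule biadditive.right_hom[rotated])
  have "chain_d S G n (single s g \<odot>\<^bsub>Free (Suc n)\<^esub> x) gs =
      (single s g \<odot>\<^bsub>Free n\<^esub> chain_d S G n x) gs" for gs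
  proof (cases "gs \<in> tuples (carrier G) n")
    case gs: True
    have "chain_d S G n (single s g \<odot>\<^bsub>Free (Suc n)\<^esub> x) gs =
        bdry S (carrier G) (\<lambda>hs. s \<otimes> x (translate G (inv\<^bsub>G\<^esub> g) hs)) gs"
      using s xS gs unfolding free_module_single_smult[OF s g x] chain_d_def
      by (subst S.bdry_cong[OF _ gs]) auto
    also have "\<dots> = s \<otimes> bdry S (carrier G) x (translate G (inv\<^bsub>G\<^esub> g) gs)"
      using xS abelian_group_hom.hom_bdry[OF hom, of "\<lambda>hs. x (translate G (inv\<^bsub>G\<^esub> g) hs)" "carrier G" gs]
        bdry_map[OF S.is_abelian_group G.bij_betw_translate[OF G.inv_closed[OF g]], of x gs]
      by simp
    finally show ?thesis
      using s g x gs left_module_free_module G.translate_tuples[OF G.inv_closed[OF g] gs]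
      by (subst free_module_single_smult[OF s g])
        (auto simp: chain_d_def free_module_def)
  next
    case False
    then show ?thesis by (simp add: chain_d_def free_module_def)
  qed
  then show "chain_d S G n (single s g \<odot>\<^bsub>Free (Suc n)\<^esub> x) =
      single s g \<odot>\<^bsub>Free n\<^esub> chain_d S G n x"
    by (rule ext)
qed

lemma chain_d_closed:
  "x \<in> carrier (Free (Suc n)) \<Longrightarrow> chain_d S G n x \<in> carrier (Free n)"
  using chain_d_linear[of n] by (auto simp: left_module_hom_def)

lemma chain_d_chain_d:
  assumes "x \<in> carrier (Free (Suc (Suc n)))"
  shows "chain_d S G n (chain_d S G (Suc n) x) = (\<lambda>_. \<zero>)"
proof
  fix gs
  have x: "x hs \<in> carrier S" for hs using assms by (rule free_module_apply_closed)
  have "bdry S (carrier G) (chain_d S G (Suc n) x) gs = \<zero>" if gs: "gs \<in> tuples (carrier G) n"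
  proof -
    have "bdry S (carrier G) (chain_d S G (Suc n) x) gs = bdry S (carrier G) (bdry S (carrier G) x) gs"
      using x by (intro S.bdry_cong[OF _ gs]) (auto simp: chain_d_def)
    then show ?thesis using S.bdry_bdry[OF finite_group x gs] by simp
  qed
  then show "chain_d S G n (chain_d S G (Suc n) x) gs = \<zero>"
    by (simp add: chain_d_def[of _ _ n])
qed

lemma cone_closed:
  "x \<in> carrier (Free n) \<Longrightarrow> cone S \<one>\<^bsub>G\<^esub> x \<in> carrier (Free (Suc n))"
  by (auto simp: free_module_def cone_def split: list.split)

text \<open>
  The contraction shows that cycles are boundaries. It is linear over \<open>S\<close> but does not commute with \<open>G\<close>.
\<close>
lemma cone_homotopy:
  assumes x: "x \<in> carrier (Free (Suc n))"
  shows "x = chain_d S G (Suc n) (cone S \<one>\<^bsub>G\<^esub> x) \<oplus>\<^bsub>Free (Suc n)\<^esub>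
    cone S \<one>\<^bsub>G\<^esub> (chain_d S G n x)"
proof
  fix gs
  have xS: "x hs \<in> carrier S" for hs using x by (rule free_module_apply_closed)
  have "x gs = chain_d S G (Suc n) (cone S \<one>\<^bsub>G\<^esub> x) gs \<oplus> cone S \<one>\<^bsub>G\<^esub> (chain_d S G n x) gs"
  proof (cases "gs \<in> tuples (carrier G) (Suc n)")
    case gs: True
    then obtain g hs where "gs = g # hs" "hs \<in> tuples (carrier G) n"
      by (auto simp: tuples_Suc)
    then have "cone S \<one>\<^bsub>G\<^esub> (chain_d S G n x) gs = cone S \<one>\<^bsub>G\<^esub> (bdry S (carrier G) x) gs"
      by (simp add: cone_def chain_d_def)
    moreover have "cone S \<one>\<^bsub>G\<^esub> (bdry S (carrier G) x) gs \<in> carrier S"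
      using xS by (simp add: cone_def split: list.split)
    moreover have "chain_d S G (Suc n) (cone S \<one>\<^bsub>G\<^esub> x) gs =
        x gs \<ominus> cone S \<one>\<^bsub>G\<^esub> (bdry S (carrier G) x) gs"
      using xS gs finite_group by (simp add: chain_d_def S.bdry_cone)
    ultimately show ?thesis
      using xS by (simp add: a_minus_def S.a_assoc S.l_neg)
  next
    case False
    then show ?thesis
      using x by (auto simp: free_module_def chain_d_def cone_def split: list.split)
  qed
  then show "x gs = (chain_d S G (Suc n) (cone S \<one>\<^bsub>G\<^esub> x) \<oplus>\<^bsub>Free (Suc n)\<^esub>
    cone S \<one>\<^bsub>G\<^esub> (chain_d S G n x)) gs"
    by (simp add: free_module_def)
qed

text \<open>
  The functional on chains that takes the value \<open>f gs\<close> at the basis element \<open>gs\<close>.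
\<close>
definition pairing
  where "pairing E n f x = (\<Oplus>\<^bsub>E\<^esub>gs\<in>tuples (carrier G) n. single (x gs) \<one>\<^bsub>G\<^esub> \<odot>\<^bsub>E\<^esub> f gs)"

lemma biadditive_smult:
  assumes "left_module A E"
  shows "biadditive S E E (\<lambda>s y. single s \<one>\<^bsub>G\<^esub> \<odot>\<^bsub>E\<^esub> y)"
proof -
  interpret E: left_module A E by (rule assms)
  show ?thesis
    by (intro biadditive.intro biadditive_axioms.intro S.is_abelian_group E.M.abelian_group_axioms
        abelian_group_hom_additiveI)
      (simp_all add: E.smult_closed single_add E.smult_l_distr E.smult_r_distr)
qed

lemma pairing_linear:
  assumes E: "left_module A E"
    and f: "f \<in> carrier (cochains G E (\<lambda>g x. single \<one> g \<odot>\<^bsub>E\<^esub> x) n)"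
  shows "pairing E n f \<in> left_module_hom A (Free n) E"
proof (rule left_module_homI[OF left_module_free_module E])
  interpret E: left_module A E by (rule E)
  interpret b: biadditive S E E "\<lambda>s y. single s \<one>\<^bsub>G\<^esub> \<odot>\<^bsub>E\<^esub> y" by (rule biadditive_smult[OF E])
  have fE: "f gs \<in> carrier E" for gs using f by (simp add: cochains_def)
  show "abelian_group_hom (Free n) E (pairing E n f)"
  proof (rule abelian_group_hom_additiveI[OF free_module_abelian_group E.M.abelian_group_axioms])
    fix x y assume x: "x \<in> carrier (Free n)" and y: "y \<in> carrier (Free n)"
    show "pairing E n f x \<in> carrier E"
      using x fE by (simp add: pairing_def E.smult_closed free_module_apply_closed)
    have "pairing E n f (x \<oplus>\<^bsub>Free n\<^esub> y) = (\<Oplus>\<^bsub>E\<^esub>gs\<in>tuples (carrier G) n.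
        single (x gs) \<one>\<^bsub>G\<^esub> \<odot>\<^bsub>E\<^esub> f gs \<oplus>\<^bsub>E\<^esub> single (y gs) \<one>\<^bsub>G\<^esub> \<odot>\<^bsub>E\<^esub> f gs)"
      unfolding pairing_def using x y fE
      by (intro E.M.finsum_cong') (auto simp: free_module_def single_add E.smult_l_distr E.smult_closed)
    then show "pairing E n f (x \<oplus>\<^bsub>Free n\<^esub> y) = pairing E n f x \<oplus>\<^bsub>E\<^esub> pairing E n f y"
      using x y fE by (simp add: pairing_def E.M.finsum_addf E.smult_closed free_module_apply_closed)
  qed
  fix s g x
  assume s: "s \<in> carrier S" and g: "g \<in> carrier G" and x: "x \<in> carrier (Free n)"
  let ?t = "translate G g"
  have xS: "x gs \<in> carrier S" for gs using x by (rule free_module_apply_closed)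
  have "pairing E n f (single s g \<odot>\<^bsub>Free n\<^esub> x) = (\<Oplus>\<^bsub>E\<^esub>gs\<in>tuples (carrier G) n.
      single ((single s g \<odot>\<^bsub>Free n\<^esub> x) (?t gs)) \<one>\<^bsub>G\<^esub> \<odot>\<^bsub>E\<^esub> f (?t gs))"
    unfolding pairing_def using s g x xS fE
    by (intro E.M.finsum_bij [symmetric] G.bij_betw_translate_tuples)
      (auto simp: free_module_single_smult E.smult_closed)
  also have "\<dots> = (\<Oplus>\<^bsub>E\<^esub>gs\<in>tuples (carrier G) n.
      single s g \<odot>\<^bsub>E\<^esub> (single (x gs) \<one>\<^bsub>G\<^esub> \<odot>\<^bsub>E\<^esub> f gs))"
  proof (rule E.M.finsum_cong')
    fix gs assume gs: "gs \<in> tuples (carrier G) n"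
    have "(single s g \<odot>\<^bsub>Free n\<^esub> x) (?t gs) = s \<otimes> x gs"
      using G.translate_tuples[OF g gs] G.translate_inv_translate[OF g gs]
      by (simp add: free_module_single_smult[OF s g x] del: map_map)
    moreover have "f (?t gs) = single \<one> g \<odot>\<^bsub>E\<^esub> f gs"
      using f g gs by (simp add: cochains_def)
    ultimately show "single ((single s g \<odot>\<^bsub>Free n\<^esub> x) (?t gs)) \<one>\<^bsub>G\<^esub> \<odot>\<^bsub>E\<^esub> f (?t gs) =
        single s g \<odot>\<^bsub>E\<^esub> (single (x gs) \<one>\<^bsub>G\<^esub> \<odot>\<^bsub>E\<^esub> f gs)"
      using s g xS fE by (simp add: E.smult_assoc [symmetric] single_mult)
  qed (use s xS fE in \<open>auto simp: E.smult_closed\<close>)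
  also have "\<dots> = single s g \<odot>\<^bsub>E\<^esub> pairing E n f x"
    using xS fE s by (simp add: pairing_def abelian_group_hom.hom_finsum[OF E.smult_hom] E.smult_closed)
  finally show "pairing E n f (single s g \<odot>\<^bsub>Free n\<^esub> x) = single s g \<odot>\<^bsub>E\<^esub> pairing E n f x" .
qed

lemma pairing_chain_d:
  assumes E: "left_module A E"
    and f: "f \<in> carrier (cochains G E act n)" and x: "x \<in> carrier (Free (Suc n))"
  shows "pairing E n f (chain_d S G n x) = pairing E (Suc n) (cochain_d G E n f) x"
proof -
  interpret E: left_module A E by (rule E)
  interpret b: biadditive S E E "\<lambda>s y. single s \<one>\<^bsub>G\<^esub> \<odot>\<^bsub>E\<^esub> y" by (rule biadditive_smult[OF E])
  have fE: "f gs \<in> carrier E" and xS: "x gs \<in> carrier S" for gs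
    using f x by (simp_all add: cochains_def free_module_apply_closed)
  have "pairing E n f (chain_d S G n x) =
      (\<Oplus>\<^bsub>E\<^esub>gs\<in>tuples (carrier G) n. single (bdry S (carrier G) x gs) \<one>\<^bsub>G\<^esub> \<odot>\<^bsub>E\<^esub> f gs)"
    unfolding pairing_def using xS fE
    by (intro E.M.finsum_cong') (auto simp: chain_d_def E.smult_closed)
  also have "\<dots> = (\<Oplus>\<^bsub>E\<^esub>gs\<in>tuples (carrier G) (Suc n). single (x gs) \<one>\<^bsub>G\<^esub> \<odot>\<^bsub>E\<^esub> cobdry E f gs)"
    by (rule b.bdry_cobdry_adjoint[OF finite_group xS fE])
  also have "\<dots> = pairing E (Suc n) (cochain_d G E n f) x"
    unfolding pairing_def using xS fE
    by (intro E.M.finsum_cong') (auto simp: cochain_d_def E.smult_closed)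
  finally show ?thesis .
qed

lemma basis_tuple_closed:
  "gs \<in> tuples (carrier G) n \<Longrightarrow> basis_tuple S gs \<in> carrier (Free n)"
  by (auto simp: basis_tuple_def free_module_def)

lemma pairing_basis_tuple:
  assumes "left_module A E" "\<And>gs. f gs \<in> carrier E" "gs \<in> tuples (carrier G) n"
  shows "pairing E n f (basis_tuple S gs) = f gs"
proof -
  interpret E: left_module A E by (rule assms)
  interpret b: biadditive S E E "\<lambda>s y. single s \<one>\<^bsub>G\<^esub> \<odot>\<^bsub>E\<^esub> y" by (rule biadditive_smult[OF assms(1)])
  have "pairing E n f (basis_tuple S gs) = (\<Oplus>\<^bsub>E\<^esub>hs\<in>tuples (carrier G) n. if hs = gs then f hs else \<zero>\<^bsub>E\<^esub>)"
    unfolding pairing_def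
  proof (rule E.M.finsum_cong')
    fix hs
    show "single (basis_tuple S gs hs) \<one>\<^bsub>G\<^esub> \<odot>\<^bsub>E\<^esub> f hs = (if hs = gs then f hs else \<zero>\<^bsub>E\<^esub>)"
      using abelian_group_hom.hom_zero[OF b.left_hom] E.smult_one assms(2)
      by (simp add: basis_tuple_def group_ring_one)
  qed (use assms in auto)
  then show ?thesis
    using assms finite_group by (simp add: E.M.finsum_delta finite_tuples)
qed

lemma linear_map_eq_pairing:
  assumes E: "left_module A E" and h: "h \<in> left_module_hom A (Free n) E"
    and x: "x \<in> carrier (Free n)"
  shows "h x = pairing E n (\<lambda>gs. if gs \<in> tuples (carrier G) n then h (basis_tuple S gs) else \<zero>\<^bsub>E\<^esub>) x"
proof -
  interpret E: left_module A E by (rule E)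
  let ?F = "Free n"
  interpret F: left_module A ?F by (rule left_module_free_module)
  interpret h: abelian_group_hom ?F E h
    by (rule left_module_hom_abelian_group_hom[OF left_module_free_module E h])
  have xS: "x gs \<in> carrier S" for gs using x by (rule free_module_apply_closed)
  have summand: "single (x gs) \<one>\<^bsub>G\<^esub> \<odot>\<^bsub>?F\<^esub> basis_tuple S gs \<in> carrier ?F"
    if "gs \<in> tuples (carrier G) n" for gs
    using that xS by (simp add: F.smult_closed basis_tuple_closed)
  have apply_sum: "(\<Oplus>\<^bsub>?F\<^esub>i\<in>I. y i) hs = (\<Oplus>i\<in>I. y i hs)"
    if "\<And>i. i \<in> I \<Longrightarrow> y i \<in> carrier ?F" for y hs and I :: "'g list set"
  proof (rule abelian_group_hom.hom_finsum[OF _ that])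
    show "abelian_group_hom ?F S (\<lambda>y. y hs)"
      by (intro abelian_group_hom_additiveI free_module_abelian_group S.is_abelian_group)
        (simp_all add: free_module_def)
  qed
  have "x = (\<Oplus>\<^bsub>?F\<^esub>gs\<in>tuples (carrier G) n. single (x gs) \<one>\<^bsub>G\<^esub> \<odot>\<^bsub>?F\<^esub> basis_tuple S gs)"
  proof
    fix hs
    have "(\<Oplus>gs\<in>tuples (carrier G) n. (single (x gs) \<one>\<^bsub>G\<^esub> \<odot>\<^bsub>?F\<^esub> basis_tuple S gs) hs) =
        (\<Oplus>gs\<in>tuples (carrier G) n. if gs = hs then x gs else \<zero>)"
    proof (rule S.finsum_cong')
      fix gs assume gs: "gs \<in> tuples (carrier G) n"
      show "(single (x gs) \<one>\<^bsub>G\<^esub> \<odot>\<^bsub>?F\<^esub> basis_tuple S gs) hs = (if gs = hs then x gs else \<zero>)"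
        using gs xS G.translate_one
        by (auto simp: free_module_single_smult basis_tuple_closed basis_tuple_def)
    qed (use xS in auto)
    also have "\<dots> = x hs"
    proof (cases "hs \<in> tuples (carrier G) n")
      case True
      then show ?thesis using xS finite_group by (simp add: S.finsum_delta finite_tuples)
    next
      case False
      then have "(\<Oplus>gs\<in>tuples (carrier G) n. if gs = hs then x gs else \<zero>) =
          (\<Oplus>gs\<in>tuples (carrier G) n. \<zero>)"
        by (intro S.finsum_cong') auto
      then show ?thesis using False x by (simp add: free_module_def)
    qed
    finally show "x hs = (\<Oplus>\<^bsub>?F\<^esub>gs\<in>tuples (carrier G) n. single (x gs) \<one>\<^bsub>G\<^esub> \<odot>\<^bsub>?F\<^esub> basis_tuple S gs) hs"
      by (subst apply_sum) (erule summand, simp)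
  qed
  then have "h x = h (\<Oplus>\<^bsub>?F\<^esub>gs\<in>tuples (carrier G) n. single (x gs) \<one>\<^bsub>G\<^esub> \<odot>\<^bsub>?F\<^esub> basis_tuple S gs)"
    by simp
  also have "\<dots> = (\<Oplus>\<^bsub>E\<^esub>gs\<in>tuples (carrier G) n. h (single (x gs) \<one>\<^bsub>G\<^esub> \<odot>\<^bsub>?F\<^esub> basis_tuple S gs))"
    using summand by (rule h.hom_finsum)
  also have "\<dots> = pairing E n (\<lambda>gs. if gs \<in> tuples (carrier G) n then h (basis_tuple S gs) else \<zero>\<^bsub>E\<^esub>) x"
    unfolding pairing_def using h xS
    by (intro E.M.finsum_cong') (auto simp: left_module_hom_def basis_tuple_closed E.smult_closed)
  finally show ?thesis .
qed

lemma cone_add: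
  assumes "x \<in> carrier (Free n)" "y \<in> carrier (Free n)"
  shows "cone S u (x \<oplus>\<^bsub>Free n\<^esub> y) =
    cone S u x \<oplus>\<^bsub>Free (Suc n)\<^esub> cone S u y"
  by (auto simp: free_module_def cone_def fun_eq_iff split: list.split)

lemma cone_zero [simp]: "cone S u (\<lambda>_. \<zero>) = (\<lambda>_. \<zero>)"
  by (auto simp: cone_def fun_eq_iff split: list.split)

lemma chain_d_cone_cycle:
  assumes "x \<in> carrier (Free (Suc n))" "chain_d S G n x = (\<lambda>_. \<zero>)"
  shows "chain_d S G (Suc n) (cone S \<one>\<^bsub>G\<^esub> x) = x"
proof -
  have "chain_d S G (Suc n) (cone S \<one>\<^bsub>G\<^esub> x) \<in> carrier (Free (Suc n))"
    using assms by (simp add: chain_d_closed cone_closed)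
  then show ?thesis
    using cone_homotopy[OF assms(1)] assms(2) by (simp add: free_module_def)
qed

text \<open>
  The cocycle \<open>f\<close> gives a functional \<open>\<phi>\<close> on chains that vanishes on boundaries, hence on cycles. On the
  cycles of the next lower degree, \<open>\<phi>\<close> composed with the cone is a linear map, although the cone itself
  is not equivariant: the failure is a cycle, which \<open>\<phi>\<close> kills. An extension \<open>\<psi>\<close> of this map to all
  chains, evaluated on the basis, is the required cochain, since \<open>\<psi> \<circ> \<partial> = \<phi>\<close> by the homotopy formula.
\<close>
theorem injective_module_acyclic:
  fixes E :: "('g \<Rightarrow> 'r, 'b) module"
  assumes inj: "injective_module A E"
    and f: "f \<in> carrier (cochains G E (\<lambda>g x. single \<one> g \<odot>\<^bsub>E\<^esub> x) (Suc (Suc p)))"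
    and cocycle: "cochain_d G E (Suc (Suc p)) f = (\<lambda>_. \<zero>\<^bsub>E\<^esub>)"
  shows "\<exists>f'\<in>carrier (cochains G E (\<lambda>g x. single \<one> g \<odot>\<^bsub>E\<^esub> x) (Suc p)). cochain_d G E (Suc p) f' = f"
proof -
  let ?F = Free and ?n = "Suc p"
  have E: "left_module A E" using inj by (simp add: injective_module_def)
  interpret E: left_module A E by (rule E)
  have F: "left_module A (?F n)" for n by (rule left_module_free_module)
  interpret F: left_module A "?F n" for n by (rule F)
  define \<phi> where "\<phi> = pairing E (Suc ?n) f"
  have \<phi>: "\<phi> \<in> left_module_hom A (?F (Suc ?n)) E"
    unfolding \<phi>_def by (rule pairing_linear[OF E f])
  interpret \<phi>: abelian_group_hom "?F (Suc ?n)" E \<phi>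
    by (rule left_module_hom_abelian_group_hom[OF F E \<phi>])
  have zeroF: "\<zero>\<^bsub>?F m\<^esub> = (\<lambda>_. \<zero>)" for m by (simp add: free_module_def)
  have \<phi>_bdry: "\<phi> (chain_d S G (Suc ?n) x) = \<zero>\<^bsub>E\<^esub>" if x: "x \<in> carrier (?F (Suc (Suc ?n)))" for x
    unfolding \<phi>_def pairing_chain_d[OF E f x] cocycle
    using abelian_group_hom.hom_zero[OF E.smult_hom] x
    by (auto simp: pairing_def free_module_apply_closed intro!: E.M.add.finprod_one_eqI)
  have \<phi>_cycle: "\<phi> x = \<zero>\<^bsub>E\<^esub>" if "x \<in> carrier (?F (Suc ?n))" "chain_d S G ?n x = (\<lambda>_. \<zero>)" for x
    using \<phi>_bdry[OF cone_closed[OF that(1)]] by (simp add: chain_d_cone_cycle[OF that])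
  define K where "K = kernel_module (?F ?n) (chain_d S G p) (?F p)"
  have K: "left_module A K"
    unfolding K_def by (rule left_module_kernel[OF F F chain_d_linear])
  interpret K: left_module A K by (rule K)
  have K_simps: "carrier K = {x \<in> carrier (?F ?n). chain_d S G p x = (\<lambda>_. \<zero>)}"
    "add K = add (?F ?n)" "smult K = smult (?F ?n)"
    by (simp_all add: K_def kernel_module_def zeroF)
  have g: "(\<lambda>y. \<phi> (cone S \<one>\<^bsub>G\<^esub> y)) \<in> left_module_hom A K E"
  proof (rule left_module_homI[OF K E])
    show "abelian_group_hom K E (\<lambda>y. \<phi> (cone S \<one>\<^bsub>G\<^esub> y))"
      by (intro abelian_group_hom_additiveI K.M.abelian_group_axioms E.M.abelian_group_axioms)
        (simp_all add: K_simps cone_closed cone_add)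
    fix s g y assume s: "s \<in> carrier S" and g: "g \<in> carrier G" and y: "y \<in> carrier K"
    let ?a = "single s g"
    have a: "?a \<in> carrier A" using s by simp
    have yF: "y \<in> carrier (?F ?n)" and dy: "chain_d S G p y = (\<lambda>_. \<zero>)"
      using y by (simp_all add: K_simps)
    have ay: "?a \<odot>\<^bsub>?F ?n\<^esub> y \<in> carrier (?F ?n)" "chain_d S G p (?a \<odot>\<^bsub>?F ?n\<^esub> y) = (\<lambda>_. \<zero>)"
      using K.smult_closed[OF a y] by (simp_all add: K_simps)
    have c: "cone S \<one>\<^bsub>G\<^esub> y \<in> carrier (?F (Suc ?n))" "cone S \<one>\<^bsub>G\<^esub> (?a \<odot>\<^bsub>?F ?n\<^esub> y) \<in> carrier (?F (Suc ?n))"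
      using yF ay by (simp_all add: cone_closed)
    interpret d: abelian_group_hom "?F (Suc ?n)" "?F ?n" "chain_d S G ?n"
      by (rule left_module_hom_abelian_group_hom[OF F F chain_d_linear])
    \<comment> \<open>The failure of the cone to commute with \<open>?a\<close>; both terms have boundary \<open>?a y\<close>.\<close>
    define z where "z = cone S \<one>\<^bsub>G\<^esub> (?a \<odot>\<^bsub>?F ?n\<^esub> y) \<ominus>\<^bsub>?F (Suc ?n)\<^esub> ?a \<odot>\<^bsub>?F (Suc ?n)\<^esub> cone S \<one>\<^bsub>G\<^esub> y"
    have z: "z \<in> carrier (?F (Suc ?n))"
      using a c by (simp add: z_def F.smult_closed)
    have "chain_d S G ?n (?a \<odot>\<^bsub>?F (Suc ?n)\<^esub> cone S \<one>\<^bsub>G\<^esub> y) = ?a \<odot>\<^bsub>?F ?n\<^esub> y"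
      using chain_d_linear[of ?n] a c by (simp add: left_module_hom_def chain_d_cone_cycle[OF yF dy])
    then have "chain_d S G ?n z = \<zero>\<^bsub>?F ?n\<^esub>"
      using a c ay yF
      by (simp add: z_def a_minus_def F.smult_closed chain_d_cone_cycle[OF ay] F.M.r_neg)
    then have "\<phi> z = \<zero>\<^bsub>E\<^esub>" by (intro \<phi>_cycle z) (simp add: zeroF)
    then have "\<phi> (cone S \<one>\<^bsub>G\<^esub> (?a \<odot>\<^bsub>?F ?n\<^esub> y)) \<ominus>\<^bsub>E\<^esub> ?a \<odot>\<^bsub>E\<^esub> \<phi> (cone S \<one>\<^bsub>G\<^esub> y) = \<zero>\<^bsub>E\<^esub>"
      using a c \<phi> by (simp add: z_def a_minus_def F.smult_closed left_module_hom_def)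
    then show "\<phi> (cone S \<one>\<^bsub>G\<^esub> (?a \<odot>\<^bsub>K\<^esub> y)) = ?a \<odot>\<^bsub>E\<^esub> \<phi> (cone S \<one>\<^bsub>G\<^esub> y)"
      unfolding K_simps
      by (rule E.M.minus_eq_zero_imp_eq[rotated 2]) (simp_all add: a c E.smult_closed)
  qed
  obtain j :: "('g list \<Rightarrow> 'r) \<Rightarrow> nat \<Rightarrow> 'g \<Rightarrow> 'r" where j: "inj_on j (carrier (?F ?n))"
  proof -
    obtain e :: "nat \<Rightarrow> 'g list" where
      "bij_betw e {0..<card (tuples (carrier G) ?n)} (tuples (carrier G) ?n)"
      using ex_bij_betw_nat_finite[OF finite_tuples[OF finite_group]] by blast
    then have e: "tuples (carrier G) ?n \<subseteq> range e"
      unfolding bij_betw_def by blast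
    \<comment> \<open>A chain is encoded by the sequence of its coefficients, each written as a constant function on \<open>G\<close>.\<close>
    have "inj_on (\<lambda>x k (g::'g). x (e k)) (carrier (?F ?n))"
    proof (rule inj_onI, rule ext)
      fix x y gs
      assume x: "x \<in> carrier (?F ?n)" and y: "y \<in> carrier (?F ?n)"
        and eq: "(\<lambda>k (g::'g). x (e k)) = (\<lambda>k g. y (e k))"
      show "x gs = y gs"
      proof (cases "gs \<in> tuples (carrier G) ?n")
        case True
        then obtain k where "gs = e k" using e by blast
        then show ?thesis using fun_cong[OF fun_cong[OF eq, of k]] by simp
      qed (use x y in \<open>simp add: free_module_def\<close>)
    qed
    then show thesis by (rule that)
  qed
  obtain \<psi> where \<psi>: "\<psi> \<in> left_module_hom A (?F ?n) E"
    and \<psi>_K: "\<And>y. y \<in> carrier (?F ?n) \<Longrightarrow> chain_d S G p y = \<zero>\<^bsub>?F p\<^esub> \<Longrightarrow> \<psi> y = \<phi> (cone S \<one>\<^bsub>G\<^esub> y)"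
    using injective_module_extend_from_kernel[OF inj F F chain_d_linear g[unfolded K_def] j] by metis
  define f' where "f' gs = (if gs \<in> tuples (carrier G) ?n then \<psi> (basis_tuple S gs) else \<zero>\<^bsub>E\<^esub>)" for gs
  have f': "f' \<in> carrier (cochains G E (\<lambda>g x. single \<one> g \<odot>\<^bsub>E\<^esub> x) ?n)"
  proof -
    have "\<psi> (basis_tuple S (translate G g gs)) = single \<one> g \<odot>\<^bsub>E\<^esub> \<psi> (basis_tuple S gs)"
      if g: "g \<in> carrier G" and gs: "gs \<in> tuples (carrier G) ?n" for g gs
    proof -
      have "basis_tuple S (translate G g gs) = single \<one> g \<odot>\<^bsub>?F ?n\<^esub> basis_tuple S gs"
      proof
        fix hs
        have "hs = translate G g gs \<longleftrightarrow> translate G (inv\<^bsub>G\<^esub> g) hs = gs"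
          if "hs \<in> tuples (carrier G) ?n"
          using G.translate_inv_translate[OF g gs] G.translate_inv_translate[OF g that] by metis
        then show "basis_tuple S (translate G g gs) hs = (single \<one> g \<odot>\<^bsub>?F ?n\<^esub> basis_tuple S gs) hs"
          using G.translate_tuples[OF g gs]
          by (auto simp: free_module_single_smult[OF _ g basis_tuple_closed[OF gs]] basis_tuple_def)
      qed
      then show ?thesis
        using \<psi> basis_tuple_closed[OF gs] by (simp add: left_module_hom_def)
    qed
    moreover have "\<psi> (basis_tuple S gs) \<in> carrier E" if "gs \<in> tuples (carrier G) ?n" for gs
      using \<psi> basis_tuple_closed[OF that] by (auto simp: left_module_hom_def)
    ultimately show ?thesis
      using G.translate_tuples by (simp add: cochains_def f'_def)
  qed
  have "cochain_d G E ?n f' gs = f gs" for gs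
  proof (cases "gs \<in> tuples (carrier G) (Suc ?n)")
    case gs: True
    let ?e = "basis_tuple S gs"
    have e: "?e \<in> carrier (?F (Suc ?n))" by (rule basis_tuple_closed[OF gs])
    have de: "chain_d S G ?n ?e \<in> carrier (?F ?n)" using e by (rule chain_d_closed)
    have "cochain_d G E ?n f' gs = pairing E (Suc ?n) (cochain_d G E ?n f') ?e"
    proof (rule pairing_basis_tuple [symmetric, OF E _ gs])
      show "cochain_d G E ?n f' hs \<in> carrier E" for hs
        using f' by (simp add: cochain_d_def cochains_def)
    qed
    also have "\<dots> = pairing E ?n f' (chain_d S G ?n ?e)"
      by (rule pairing_chain_d [symmetric, OF E f' e])
    also have "\<dots> = \<psi> (chain_d S G ?n ?e)"
      using linear_map_eq_pairing[OF E \<psi> de] by (simp add: f'_def [abs_def])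
    also have "\<dots> = \<phi> (cone S \<one>\<^bsub>G\<^esub> (chain_d S G ?n ?e))"
      using de by (rule \<psi>_K) (simp add: chain_d_chain_d[OF e] zeroF)
    also have "\<dots> = \<phi> (chain_d S G (Suc ?n) (cone S \<one>\<^bsub>G\<^esub> ?e)) \<oplus>\<^bsub>E\<^esub> \<phi> (cone S \<one>\<^bsub>G\<^esub> (chain_d S G ?n ?e))"
      using e de by (simp add: \<phi>_bdry cone_closed)
    also have "\<dots> = \<phi> ?e"
      using e de arg_cong[OF cone_homotopy[OF e], of \<phi>] by (simp add: cone_closed chain_d_closed)
    also have "\<dots> = f gs"
      unfolding \<phi>_def using f by (intro pairing_basis_tuple[OF E _ gs]) (simp add: cochains_def)
    finally show ?thesis .
  qed (use f in \<open>simp add: cochains_def cochain_d_def\<close>)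
  then show ?thesis using f' by blast
qed

end

section \<open>Annihilators of cohomology modules\<close>

text \<open>
  A scalar acts on a coset through its elements. Since it preserves the coboundaries, it sends the coset of \<open>z\<close> to
  the coset of \<open>s z\<close>, which is zero if and only if \<open>s z\<close> is a coboundary.
\<close>
lemma annihilator_cohomology:
  fixes C :: "nat \<Rightarrow> ('a, 'b) module"
  assumes C: "abelian_group (C n)"
    and cocycles: "cocycles C \<delta> n \<subseteq> carrier (C n)"
    and B: "additive_subgroup (coboundaries C \<delta> n) (C n)"
    and smult: "\<And>s. s \<in> carrier S \<Longrightarrow> abelian_group_hom (C n) (C n) (\<lambda>x. s \<odot>\<^bsub>C n\<^esub> x)"
    and smult_B: "\<And>s x. s \<in> carrier S \<Longrightarrow> x \<in> coboundaries C \<delta> n \<Longrightarrow> s \<odot>\<^bsub>C n\<^esub> x \<in> coboundaries C \<delta> n"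
  shows "annihilator S (cohomology C \<delta> n) =
    {s \<in> carrier S. \<forall>z\<in>cocycles C \<delta> n. s \<odot>\<^bsub>C n\<^esub> z \<in> coboundaries C \<delta> n}"
proof -
  interpret C: abelian_group "C n" by (rule C)
  define B where "B = coboundaries C \<delta> n"
  interpret B: additive_subgroup B "C n" using B by (simp add: B_def)
  have coset: "B +>\<^bsub>C n\<^esub> x = {b \<oplus>\<^bsub>C n\<^esub> x |b. b \<in> B}" for x
    by (auto simp: a_r_coset_def')
  have coset_B: "B +>\<^bsub>C n\<^esub> x = B" if "x \<in> B" for x
  proof -
    have xC: "x \<in> carrier (C n)" using that by simp
    have "b \<in> B +>\<^bsub>C n\<^esub> x" if b: "b \<in> B" for b
    proof -
      have "b = (b \<ominus>\<^bsub>C n\<^esub> x) \<oplus>\<^bsub>C n\<^esub> x"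
        using b xC by (simp add: a_minus_def C.a_assoc C.l_neg)
      moreover have "b \<ominus>\<^bsub>C n\<^esub> x \<in> B" using b \<open>x \<in> B\<close> by (simp add: a_minus_def B.a_inv_closed)
      ultimately show ?thesis unfolding coset by blast
    qed
    then show ?thesis using that by (auto simp: coset)
  qed
  have "(\<Union>x\<in>B +>\<^bsub>C n\<^esub> z. B +>\<^bsub>C n\<^esub> (s \<odot>\<^bsub>C n\<^esub> x)) = B \<longleftrightarrow> s \<odot>\<^bsub>C n\<^esub> z \<in> B"
    if s: "s \<in> carrier S" and z: "z \<in> cocycles C \<delta> n" for s z
  proof -
    interpret s: abelian_group_hom "C n" "C n" "\<lambda>x. s \<odot>\<^bsub>C n\<^esub> x" by (rule smult[OF s])
    have zC: "z \<in> carrier (C n)" using z cocycles by blast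
    have self: "x \<in> B +>\<^bsub>C n\<^esub> x" if "x \<in> carrier (C n)" for x
      unfolding coset using B.zero_closed C.l_zero[OF that, symmetric] by blast
    show ?thesis
    proof
      assume "(\<Union>x\<in>B +>\<^bsub>C n\<^esub> z. B +>\<^bsub>C n\<^esub> (s \<odot>\<^bsub>C n\<^esub> x)) = B"
      then show "s \<odot>\<^bsub>C n\<^esub> z \<in> B"
        using self[OF zC] self[OF s.hom_closed[OF zC]] by blast
    next
      assume sz: "s \<odot>\<^bsub>C n\<^esub> z \<in> B"
      have "B +>\<^bsub>C n\<^esub> (s \<odot>\<^bsub>C n\<^esub> x) = B" if x: "x \<in> B +>\<^bsub>C n\<^esub> z" for x
      proof -
        obtain b where b: "b \<in> B" "x = b \<oplus>\<^bsub>C n\<^esub> z" using x by (auto simp: coset)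
        then have "s \<odot>\<^bsub>C n\<^esub> x = s \<odot>\<^bsub>C n\<^esub> b \<oplus>\<^bsub>C n\<^esub> s \<odot>\<^bsub>C n\<^esub> z"
          using zC by simp
        then have "s \<odot>\<^bsub>C n\<^esub> x \<in> B"
          using smult_B[OF s] b sz by (simp add: B_def [symmetric])
        then show ?thesis by (rule coset_B)
      qed
      then show "(\<Union>x\<in>B +>\<^bsub>C n\<^esub> z. B +>\<^bsub>C n\<^esub> (s \<odot>\<^bsub>C n\<^esub> x)) = B"
        using self[OF zC] by blast
    qed
  qed
  moreover have "annihilator S (cohomology C \<delta> n) = {s \<in> carrier S. \<forall>z\<in>cocycles C \<delta> n.
      (\<Union>x\<in>B +>\<^bsub>C n\<^esub> z. B +>\<^bsub>C n\<^esub> (s \<odot>\<^bsub>C n\<^esub> x)) = B}"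
    by (simp add: annihilator_def cohomology_def B_def)
  ultimately show ?thesis
    unfolding B_def [symmetric] by blast
qed

section \<open>Cochains of a ring with a group action\<close>

locale ring_action = R?: cring R + G?: group G
  for R :: "'r ring" (structure) and G :: "('g, 'n) monoid_scheme" (structure)
    and act :: "'g \<Rightarrow> 'r \<Rightarrow> 'r" +
  assumes finite_group: "finite (carrier G)"
    and act_ring_hom: "g \<in> carrier G \<Longrightarrow> act g \<in> ring_hom R R"
    and act_one: "x \<in> carrier R \<Longrightarrow> act \<one>\<^bsub>G\<^esub> x = x"
    and act_mult: "g \<in> carrier G \<Longrightarrow> h \<in> carrier G \<Longrightarrow> x \<in> carrier R \<Longrightarrow>
      act (g \<otimes>\<^bsub>G\<^esub> h) x = act g (act h x)"
begin

abbreviation S where "S \<equiv> invariant_ring R G act"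

lemma equivariant_group: "equivariant_group G R act"
  using act_one act_mult
  by (intro equivariant_group.intro equivariant_group_axioms.intro abelian_group_hom_additiveI
      G.is_group R.is_abelian_group)
    (auto simp: ring_hom_closed[OF act_ring_hom] ring_hom_add[OF act_ring_hom])

sublocale aR: equivariant_group G R act by (rule equivariant_group)

lemma carrier_S: "carrier S = {r \<in> carrier R. \<forall>g\<in>carrier G. act g r = r}"
  and S_ops [simp]: "monoid.mult S = monoid.mult R" "\<one>\<^bsub>S\<^esub> = \<one>" "add S = add R" "\<zero>\<^bsub>S\<^esub> = \<zero>"
  by (simp_all add: invariant_ring_def)

lemma S_subset: "s \<in> carrier S \<Longrightarrow> s \<in> carrier R"
  by (simp add: carrier_S)

lemma cring_S: "cring S"
proof (rule cringI)
  show "abelian_group S"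
  proof (rule abelian_groupI)
    fix x assume "x \<in> carrier S"
    then show "\<exists>y\<in>carrier S. y \<oplus>\<^bsub>S\<^esub> x = \<zero>\<^bsub>S\<^esub>"
      by (intro bexI[of _ "\<ominus> x"]) (auto simp: carrier_S R.l_neg)
  qed (auto simp: carrier_S R.a_ac)
  show "Group.comm_monoid S"
    by (intro comm_monoidI)
      (auto simp: carrier_S R.m_ac ring_hom_mult[OF act_ring_hom] ring_hom_one[OF act_ring_hom])
qed (auto simp: carrier_S R.l_distr)

sublocale gr: finite_group_ring S G
  by (intro finite_group_ring.intro finite_group_ring_axioms.intro cring_S G.is_group finite_group)

lemma one_in_S [simp]: "\<one> \<in> carrier S"
  using gr.S.one_closed by simp

lemma single_smult_group_ring_module:
  assumes "s \<in> carrier S" "g \<in> carrier G" "r \<in> carrier R"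
  shows "gr.single s g \<odot>\<^bsub>group_ring_module R G act\<^esub> r = s \<otimes> act g r"
proof -
  have "gr.single s g \<odot>\<^bsub>group_ring_module R G act\<^esub> r =
      (\<Oplus>k\<in>carrier G. if k = g then s \<otimes> act k r else \<zero>)"
    unfolding group_ring_module_def using assms S_subset
    by (simp, intro R.finsum_cong') (auto simp: group_ring_single_def)
  then show ?thesis
    using assms S_subset finite_group by (simp add: R.finsum_delta)
qed

abbreviation cobounding :: "nat \<Rightarrow> ('g list \<Rightarrow> 'r) set"
  where "cobounding n \<equiv> cochain_d G R n ` carrier (cochains G R act n)"

text \<open>
  Here \<open>s\<close> kills the cochain cohomology in degree \<open>n + 1\<close>, since tuples of length \<open>n + 2\<close> carry the cochains of
  that degree.
\<close>
definition kills_cochain_cohomology :: "'r \<Rightarrow> nat \<Rightarrow> bool"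
  where "kills_cochain_cohomology s n \<longleftrightarrow>
    (\<forall>f\<in>carrier (cochains G R act (Suc (Suc n))). cochain_d G R (Suc (Suc n)) f = (\<lambda>_. \<zero>) \<longrightarrow>
      (\<lambda>gs. s \<otimes> f gs) \<in> cobounding (Suc n))"

lemma cobounding_add:
  assumes "x \<in> cobounding n"
    and "y \<in> cobounding n"
  shows "(\<lambda>gs. x gs \<oplus> y gs) \<in> cobounding n"
proof -
  interpret d: abelian_group_hom "cochains G R act n" "cochains G R act (Suc n)" "cochain_d G R n"
    by (rule aR.cochain_d_hom)
  from assms obtain x' y' where *: "x' \<in> carrier (cochains G R act n)" "x = cochain_d G R n x'"
    "y' \<in> carrier (cochains G R act n)" "y = cochain_d G R n y'" by blast
  have "(\<lambda>gs. x gs \<oplus> y gs) = x \<oplus>\<^bsub>cochains G R act (Suc n)\<^esub> y"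
    by (simp add: cochains_def)
  also have "\<dots> = cochain_d G R n (x' \<oplus>\<^bsub>cochains G R act n\<^esub> y')"
    using * by simp
  finally show ?thesis using * by blast
qed

lemma invariant_mult_equivariant:
  assumes r: "r \<in> carrier S"
  shows "equivariant_hom G R R act act (\<lambda>x. r \<otimes> x)"
proof (intro equivariant_hom.intro equivariant_hom_axioms.intro equivariant_group
    biadditive.right_hom[OF R.biadditive_mult])
  show "r \<in> carrier R" using r by (rule S_subset)
  show "r \<otimes> act g x = act g (r \<otimes> x)" if "g \<in> carrier G" "x \<in> carrier R" for g x
    using r that by (simp add: ring_hom_mult[OF act_ring_hom] carrier_S)
qed

lemma cobounding_equivariant_image:
  assumes "equivariant_hom G R R act act \<phi>"
    and x: "x \<in> cobounding n"
  shows "(\<lambda>gs. \<phi> (x gs)) \<in> cobounding n"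
proof -
  interpret \<phi>: equivariant_hom G R R act act \<phi> by (rule assms)
  obtain y where y: "y \<in> carrier (cochains G R act n)" "x = cochain_d G R n y" using x by blast
  then show ?thesis
    using \<phi>.cochain_map_cochain_d[OF y(1)] abelian_group_hom.hom_closed[OF \<phi>.cochain_map_hom y(1)]
    by blast
qed

lemma cobounding_finsum:
  assumes "finite I" "\<And>i. i \<in> I \<Longrightarrow> F i \<in> cobounding n"
  shows "(\<lambda>gs. \<Oplus>i\<in>I. F i gs) \<in> cobounding n"
  using assms
proof (induction I rule: finite_induct)
  case empty
  interpret d: abelian_group_hom "cochains G R act n" "cochains G R act (Suc n)" "cochain_d G R n"
    by (rule aR.cochain_d_hom)
  show ?case
    using d.hom_zero d.G.zero_closed by (auto simp: cochains_def image_iff)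
next
  case (insert i I)
  have closed: "F k gs \<in> carrier R" if "k \<in> insert i I" for k gs
    using insert.prems[OF that] aR.cochain_d_closed by (auto simp: cochains_def)
  have "(\<lambda>gs. F i gs \<oplus> (\<Oplus>k\<in>I. F k gs)) \<in> cobounding n"
    using insert by (intro cobounding_add) auto
  then show ?case using insert closed by (simp add: Pi_def)
qed

lemma ideal_kills_cochain_cohomology: "ideal {s \<in> carrier S. kills_cochain_cohomology s n} S"
proof -
  let ?J = "{s \<in> carrier S. kills_cochain_cohomology s n}"
  have mult: "r \<otimes> s \<in> ?J" if r: "r \<in> carrier S" and s: "s \<in> ?J" for r s
  proof -
    have "(\<lambda>gs. (r \<otimes> s) \<otimes> f gs) \<in> cobounding (Suc n)"
      if f: "f \<in> carrier (cochains G R act (Suc (Suc n)))"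
        and "cochain_d G R (Suc (Suc n)) f = (\<lambda>_. \<zero>)" for f
    proof -
      have "(\<lambda>gs. s \<otimes> f gs) \<in> cobounding (Suc n)"
        using s that by (simp add: kills_cochain_cohomology_def)
      from cobounding_equivariant_image[OF invariant_mult_equivariant[OF r] this]
      show ?thesis using r s f S_subset by (simp add: R.m_assoc cochains_def)
    qed
    then show ?thesis
      using r s gr.S.m_closed[of r s] by (simp add: kills_cochain_cohomology_def)
  qed
  have add: "r \<oplus> s \<in> ?J" if r: "r \<in> ?J" and s: "s \<in> ?J" for r s
  proof -
    have "(\<lambda>gs. (r \<oplus> s) \<otimes> f gs) \<in> cobounding (Suc n)"
      if f: "f \<in> carrier (cochains G R act (Suc (Suc n)))"
        and "cochain_d G R (Suc (Suc n)) f = (\<lambda>_. \<zero>)" for f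
      using cobounding_add[of "\<lambda>gs. r \<otimes> f gs" "Suc n" "\<lambda>gs. s \<otimes> f gs"] r s that S_subset
      by (simp add: kills_cochain_cohomology_def R.l_distr cochains_def)
    then show ?thesis
      using r s gr.S.a_closed[of r s] by (simp add: kills_cochain_cohomology_def)
  qed
  have zero: "\<zero> \<in> ?J"
  proof -
    have "(\<lambda>gs. \<zero> \<otimes> f gs) \<in> cobounding (Suc n)"
      if f: "f \<in> carrier (cochains G R act (Suc (Suc n)))" for f
      using cobounding_finsum[of "{}" "\<lambda>_. f" "Suc n"] f by (simp add: cochains_def)
    then show ?thesis using gr.S.zero_closed by (simp add: kills_cochain_cohomology_def)
  qed
  show ?thesis
  proof (rule idealI[OF gr.S.ring_axioms])
    show "subgroup ?J (add_monoid S)"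
    proof (rule subgroup.intro)
      show "inv\<^bsub>add_monoid S\<^esub> s \<in> ?J" if "s \<in> ?J" for s
      proof -
        have "\<ominus>\<^bsub>S\<^esub> \<one>\<^bsub>S\<^esub> \<in> carrier S"
          using gr.S.one_closed by (rule gr.S.a_inv_closed)
        from mult[OF this that] have "(\<ominus>\<^bsub>S\<^esub> \<one>\<^bsub>S\<^esub>) \<otimes>\<^bsub>S\<^esub> s \<in> ?J" by simp
        also have "(\<ominus>\<^bsub>S\<^esub> \<one>\<^bsub>S\<^esub>) \<otimes>\<^bsub>S\<^esub> s = \<ominus>\<^bsub>S\<^esub> s"
          using gr.S.l_minus[OF gr.S.one_closed, of s] gr.S.l_one[of s] that by simp
        finally show ?thesis by (simp add: a_inv_def)
      qed
    qed (use add zero in auto)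
    fix r s assume "s \<in> ?J" "r \<in> carrier S"
    then show "r \<otimes>\<^bsub>S\<^esub> s \<in> ?J" "s \<otimes>\<^bsub>S\<^esub> r \<in> ?J"
      using mult[of r s] gr.S.m_comm[of r s] by simp_all
  qed
qed

text \<open>
  The sequence \<open>P\<close> may be any sequence of additive equivariant operations that starts with the identity and
  satisfies the Cartan formula. By induction on \<open>m\<close>, all summands of \<open>P m (s f)\<close> other than \<open>P m s \<otimes> f\<close> are
  coboundaries, and so is the sum.
\<close>
theorem kills_cochain_cohomology_Cartan:
  fixes P :: "nat \<Rightarrow> 'r \<Rightarrow> 'r"
  assumes P: "\<And>m. equivariant_hom G R R act act (P m)"
    and P_0: "\<And>x. x \<in> carrier R \<Longrightarrow> P 0 x = x"
    and Cartan: "\<And>m x y. x \<in> carrier R \<Longrightarrow> y \<in> carrier R \<Longrightarrow>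
      P m (x \<otimes> y) = (\<Oplus>a\<in>{..m}. P a x \<otimes> P (m - a) y)"
    and s: "s \<in> carrier S" and kills: "kills_cochain_cohomology s n"
  shows "P m s \<in> carrier S" and "kills_cochain_cohomology (P m s) n"
proof -
  have P_closed: "P m x \<in> carrier R" if "x \<in> carrier R" for m x
    using abelian_group_hom.hom_closed[OF equivariant_hom.axioms(3)[OF P] that] .
  show P_S: "P m s \<in> carrier S" for m
    using s P_closed equivariant_hom.equivariant[OF P, symmetric] by (simp add: carrier_S)
  show "kills_cochain_cohomology (P m s) n"
  proof (induction m rule: less_induct)
    case (less m)
    let ?B = "cobounding (Suc n)"
    show ?case
      unfolding kills_cochain_cohomology_def
    proof (intro ballI impI)
      fix f assume f: "f \<in> carrier (cochains G R act (Suc (Suc n)))"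
        and df: "cochain_d G R (Suc (Suc n)) f = (\<lambda>_. \<zero>)"
      have fR: "f gs \<in> carrier R" for gs using f by (simp add: cochains_def)
      have sR: "s \<in> carrier R" using s by (rule S_subset)
      have lower: "(\<lambda>gs. P a s \<otimes> P (m - a) (f gs)) \<in> ?B" if "a < m" for a
      proof -
        interpret P: equivariant_hom G R R act act "P (m - a)" by (rule P)
        have "(\<lambda>gs. P (m - a) (f gs)) \<in> carrier (cochains G R act (Suc (Suc n)))"
          by (rule abelian_group_hom.hom_closed[OF P.cochain_map_hom f])
        moreover have "cochain_d G R (Suc (Suc n)) (\<lambda>gs. P (m - a) (f gs)) = (\<lambda>_. \<zero>)"
          using P.cochain_map_cochain_d[OF f] df by simp
        ultimately show ?thesis
          using less.IH[OF that] by (simp add: kills_cochain_cohomology_def)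
      qed
      have "(\<lambda>gs. s \<otimes> f gs) \<in> ?B"
        using kills f df by (simp add: kills_cochain_cohomology_def)
      then have total: "(\<lambda>gs. P m (s \<otimes> f gs)) \<in> ?B"
        by (rule cobounding_equivariant_image[OF P])
      \<comment> \<open>Subtraction is written as multiplication by the invariant element \<open>-1\<close>.\<close>
      have minus: "equivariant_hom G R R act act (\<lambda>x. (\<ominus>\<^bsub>S\<^esub> \<one>\<^bsub>S\<^esub>) \<otimes> x)"
        by (rule invariant_mult_equivariant) (use gr.S.one_closed in \<open>simp del: S_ops one_in_S\<close>)
      let ?c = "\<lambda>gs. \<Oplus>a\<in>{..<m}. P a s \<otimes> P (m - a) (f gs)"
      have "(\<lambda>gs. (\<ominus>\<^bsub>S\<^esub> \<one>\<^bsub>S\<^esub>) \<otimes> ?c gs) \<in> ?B"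
        by (intro cobounding_equivariant_image[OF minus] cobounding_finsum) (use lower in auto)
      from cobounding_add[OF total this]
      have "(\<lambda>gs. P m (s \<otimes> f gs) \<oplus> (\<ominus>\<^bsub>S\<^esub> \<one>\<^bsub>S\<^esub>) \<otimes> ?c gs) \<in> ?B" .
      moreover have "P m (s \<otimes> f gs) \<oplus> (\<ominus>\<^bsub>S\<^esub> \<one>\<^bsub>S\<^esub>) \<otimes> ?c gs = P m s \<otimes> f gs" for gs
      proof -
        have closed: "P a s \<otimes> P (m - a) (f gs) \<in> carrier R" for a
          using sR fR by (simp add: P_closed)
        then have c: "?c gs \<in> carrier R" by simp
        have top: "P m s \<otimes> f gs \<in> carrier R" using sR fR by (simp add: P_closed)
        have "{..m} = insert m {..<m}" by auto
        then have "P m (s \<otimes> f gs) = P m s \<otimes> f gs \<oplus> ?c gs"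
          using closed top by (simp add: Cartan[OF sR fR] P_0[OF fR] Pi_def)
        moreover have m1: "\<ominus>\<^bsub>S\<^esub> \<one>\<^bsub>S\<^esub> \<in> carrier R"
          by (rule S_subset) (use gr.S.one_closed in \<open>simp del: S_ops one_in_S\<close>)
        moreover have "?c gs \<oplus> (\<ominus>\<^bsub>S\<^esub> \<one>\<^bsub>S\<^esub>) \<otimes> ?c gs = \<zero>"
        proof -
          have "\<one> \<oplus> (\<ominus>\<^bsub>S\<^esub> \<one>\<^bsub>S\<^esub>) = \<zero>"
            using gr.S.r_neg[OF gr.S.one_closed] by simp
          then show ?thesis
            using R.l_distr[OF R.one_closed m1 c] c by simp
        qed
        ultimately show ?thesis
          using c top by (simp add: R.a_assoc)
      qed
      ultimately show "(\<lambda>gs. P m s \<otimes> f gs) \<in> ?B" by simp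
    qed
  qed
qed

end

section \<open>Comparison of an injective resolution with cochains\<close>

locale resolved_ring_action = ring_action R G act
  for R :: "'r ring" (structure) and G :: "('g, 'n) monoid_scheme" (structure) and act +
  fixes \<epsilon> :: "'r \<Rightarrow> 'b" and E :: "nat \<Rightarrow> ('g \<Rightarrow> 'r, 'b) module" and \<delta> :: "nat \<Rightarrow> 'b \<Rightarrow> 'b"
  assumes resolution:
    "injective_resolution (group_ring (invariant_ring R G act) G) (group_ring_module R G act) \<epsilon> E \<delta>"
begin

abbreviation act_E where "act_E n g x \<equiv> gr.single \<one> g \<odot>\<^bsub>E n\<^esub> x"

lemma injective_E: "injective_module gr.A (E n)"
  using resolution by (simp add: injective_resolution_def)

lemma left_module_E: "left_module gr.A (E n)"
  using injective_E by (simp add: injective_module_def)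

sublocale E: left_module gr.A "E n" for n by (rule left_module_E)

sublocale aE: equivariant_group G "E n" "act_E n" for n
  using gr.equivariant_group_left_module[OF left_module_E] by simp

lemma \<delta>_hom: "\<delta> n \<in> left_module_hom gr.A (E n) (E (Suc n))"
  using resolution by (simp add: injective_resolution_def)

sublocale \<delta>: equivariant_hom G "E n" "E (Suc n)" "act_E n" "act_E (Suc n)" "\<delta> n" for n
proof (intro equivariant_hom.intro equivariant_hom_axioms.intro aE.equivariant_group_axioms)
  show "abelian_group_hom (E n) (E (Suc n)) (\<delta> n)"
    by (rule left_module_hom_abelian_group_hom[OF left_module_E left_module_E \<delta>_hom])
  show "\<delta> n (act_E n g x) = act_E (Suc n) g (\<delta> n x)" if "g \<in> carrier G" "x \<in> carrier (E n)" for g x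
    using \<delta>_hom[of n] that by (simp add: left_module_hom_def)
qed

lemma \<delta>_exact: "\<delta> n ` carrier (E n) = {x \<in> carrier (E (Suc n)). \<delta> (Suc n) x = \<zero>\<^bsub>E (Suc (Suc n))\<^esub>}"
  using resolution by (simp add: injective_resolution_def)

lemma \<epsilon>_exact: "\<epsilon> ` carrier R = {x \<in> carrier (E 0). \<delta> 0 x = \<zero>\<^bsub>E (Suc 0)\<^esub>}"
  using resolution by (simp add: injective_resolution_def group_ring_module_def)

lemma inj_\<epsilon>: "inj_on \<epsilon> (carrier R)"
  using resolution by (simp add: injective_resolution_def group_ring_module_def)

lemma \<epsilon>_smult:
  assumes "s \<in> carrier S" "g \<in> carrier G" "r \<in> carrier R"
  shows "\<epsilon> (s \<otimes> act g r) = gr.single s g \<odot>\<^bsub>E 0\<^esub> \<epsilon> r"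
proof -
  have "\<epsilon> \<in> left_module_hom gr.A (group_ring_module R G act) (E 0)"
    using resolution by (simp add: injective_resolution_def)
  then have "\<epsilon> (gr.single s g \<odot>\<^bsub>group_ring_module R G act\<^esub> r) = gr.single s g \<odot>\<^bsub>E 0\<^esub> \<epsilon> r"
    using assms by (simp add: left_module_hom_def group_ring_module_def)
  then show ?thesis using assms by (simp add: single_smult_group_ring_module)
qed

sublocale \<epsilon>: equivariant_hom G R "E 0" act "act_E 0" \<epsilon>
proof (intro equivariant_hom.intro equivariant_hom_axioms.intro aE.equivariant_group_axioms
    equivariant_group abelian_group_hom_additiveI R.is_abelian_group E.M.abelian_group_axioms)
  have "\<epsilon> \<in> left_module_hom gr.A (group_ring_module R G act) (E 0)"
    using resolution by (simp add: injective_resolution_def)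
  then show "\<epsilon> x \<in> carrier (E 0)" "\<epsilon> (x \<oplus> y) = \<epsilon> x \<oplus>\<^bsub>E 0\<^esub> \<epsilon> y"
    if "x \<in> carrier R" "y \<in> carrier R" for x y
    using that by (auto simp: left_module_hom_def group_ring_module_def)
  show "\<epsilon> (act g x) = act_E 0 g (\<epsilon> x)" if "g \<in> carrier G" "x \<in> carrier R" for g x
    using \<epsilon>_smult[OF one_in_S that] that by simp
qed

lemma smult_equivariant:
  assumes s: "s \<in> carrier S"
  shows "equivariant_hom G (E n) (E n) (act_E n) (act_E n) (\<lambda>x. gr.single s \<one>\<^bsub>G\<^esub> \<odot>\<^bsub>E n\<^esub> x)"
proof (intro equivariant_hom.intro equivariant_hom_axioms.intro aE.equivariant_group_axioms E.smult_hom)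
  show "gr.single s \<one>\<^bsub>G\<^esub> \<in> carrier gr.A" using s by simp
  fix g x assume "g \<in> carrier G" "x \<in> carrier (E n)"
  then show "gr.single s \<one>\<^bsub>G\<^esub> \<odot>\<^bsub>E n\<^esub> act_E n g x = act_E n g (gr.single s \<one>\<^bsub>G\<^esub> \<odot>\<^bsub>E n\<^esub> x)"
    using s gr.single_split[of s g] by (simp add: E.smult_assoc [symmetric])
qed

text \<open>
  The vertical direction is that of cochains and the horizontal one is that of the resolution.
\<close>
lemma double_complex_E:
  assumes s: "s \<in> carrier S"
  shows "double_complex (\<lambda>p q. cochains G (E q) (act_E q) (Suc p)) (\<lambda>p q. cochain_d G (E q) (Suc p))
    (\<lambda>p q f gs. \<delta> q (f gs)) (\<lambda>p q f gs. gr.single s \<one>\<^bsub>G\<^esub> \<odot>\<^bsub>E q\<^esub> f gs)"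
proof (rule double_complex.intro)
  fix p q :: nat
  interpret s: equivariant_hom G "E q" "E q" "act_E q" "act_E q" "\<lambda>x. gr.single s \<one>\<^bsub>G\<^esub> \<odot>\<^bsub>E q\<^esub> x"
    by (rule smult_equivariant[OF s])
  show "abelian_group_hom (cochains G (E q) (act_E q) (Suc p)) (cochains G (E q) (act_E q) (Suc (Suc p)))
      (cochain_d G (E q) (Suc p))"
    by (rule aE.cochain_d_hom)
  show "abelian_group_hom (cochains G (E q) (act_E q) (Suc p))
      (cochains G (E (Suc q)) (act_E (Suc q)) (Suc p)) (\<lambda>f gs. \<delta> q (f gs))"
    by (rule \<delta>.cochain_map_hom)
  show "abelian_group_hom (cochains G (E q) (act_E q) (Suc p)) (cochains G (E q) (act_E q) (Suc p))
      (\<lambda>f gs. gr.single s \<one>\<^bsub>G\<^esub> \<odot>\<^bsub>E q\<^esub> f gs)"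
    by (rule s.cochain_map_hom)
  show "{x \<in> carrier (cochains G (E q) (act_E q) (Suc (Suc p))). cochain_d G (E q) (Suc (Suc p)) x =
      \<zero>\<^bsub>cochains G (E q) (act_E q) (Suc (Suc (Suc p)))\<^esub>} =
      cochain_d G (E q) (Suc p) ` carrier (cochains G (E q) (act_E q) (Suc p))" (is "?K = ?I")
  proof
    show "?I \<subseteq> ?K"
      using aE.cochain_d_closed aE.cochain_d_cochain_d by (auto simp: cochains_def[of _ _ _ "Suc (Suc (Suc p))"])
    show "?K \<subseteq> ?I"
    proof
      fix f assume f: "f \<in> ?K"
      then have "cochain_d G (E q) (Suc (Suc p)) f = (\<lambda>_. \<zero>\<^bsub>E q\<^esub>)"
        by (simp add: cochains_def[of _ _ _ "Suc (Suc (Suc p))"])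
      then show "f \<in> ?I"
        using gr.injective_module_acyclic[OF injective_E[of q], of f p] f by auto
    qed
  qed
  show "{x \<in> carrier (cochains G (E (Suc q)) (act_E (Suc q)) (Suc p)). (\<lambda>gs. \<delta> (Suc q) (x gs)) =
      \<zero>\<^bsub>cochains G (E (Suc (Suc q))) (act_E (Suc (Suc q))) (Suc p)\<^esub>} =
      (\<lambda>f gs. \<delta> q (f gs)) ` carrier (cochains G (E q) (act_E q) (Suc p))" (is "?K = ?I")
  proof
    show "?I \<subseteq> ?K"
    proof
      fix b assume "b \<in> ?I"
      then obtain f where f: "f \<in> carrier (cochains G (E q) (act_E q) (Suc p))" "b = (\<lambda>gs. \<delta> q (f gs))"
        by blast
      have "\<delta> (Suc q) (\<delta> q (f gs)) = \<zero>\<^bsub>E (Suc (Suc q))\<^esub>" for gs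
        using f(1) \<delta>_exact[of q] by (auto simp: cochains_def)
      then show "b \<in> ?K"
        using abelian_group_hom.hom_closed[OF \<delta>.cochain_map_hom f(1)] f(2)
        by (simp add: cochains_def[of _ "E (Suc (Suc q))"])
    qed
    show "?K \<subseteq> ?I"
    proof
      fix b assume b: "b \<in> ?K"
      then have "b gs \<in> \<delta> q ` carrier (E q)" for gs
        unfolding \<delta>_exact by (auto simp: cochains_def fun_eq_iff)
      then obtain a where "a \<in> carrier (cochains G (E q) (act_E q) (Suc p))" "(\<lambda>gs. \<delta> q (a gs)) = b"
        using \<delta>.cochain_lift[of b q p] b by blast
      then show "b \<in> ?I" by blast
    qed
  qed
  fix f assume f: "f \<in> carrier (cochains G (E q) (act_E q) (Suc p))"
  show "(\<lambda>gs. \<delta> q (cochain_d G (E q) (Suc p) f gs)) = cochain_d G (E (Suc q)) (Suc p) (\<lambda>gs. \<delta> q (f gs))"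
    using f by (rule \<delta>.cochain_map_cochain_d)
  show "(\<lambda>gs. gr.single s \<one>\<^bsub>G\<^esub> \<odot>\<^bsub>E q\<^esub> cochain_d G (E q) (Suc p) f gs) =
      cochain_d G (E q) (Suc p) (\<lambda>gs. gr.single s \<one>\<^bsub>G\<^esub> \<odot>\<^bsub>E q\<^esub> f gs)"
    using f by (rule s.cochain_map_cochain_d)
  show "(\<lambda>gs. gr.single s \<one>\<^bsub>G\<^esub> \<odot>\<^bsub>E (Suc q)\<^esub> \<delta> q (f gs)) = (\<lambda>gs. \<delta> q (gr.single s \<one>\<^bsub>G\<^esub> \<odot>\<^bsub>E q\<^esub> f gs))"
    using f \<delta>_hom[of q] s by (auto simp: cochains_def left_module_hom_def)
qed

abbreviation fixed_E where "fixed_E n \<equiv> fixed_points S G (E n)"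

lemma carrier_fixed_E: "carrier (fixed_E n) = {x \<in> carrier (E n). \<forall>g\<in>carrier G. act_E n g x = x}"
  and fixed_E_ops [simp]: "\<zero>\<^bsub>fixed_E n\<^esub> = \<zero>\<^bsub>E n\<^esub>" "add (fixed_E n) = add (E n)"
    "s \<odot>\<^bsub>fixed_E n\<^esub> x = gr.single s \<one>\<^bsub>G\<^esub> \<odot>\<^bsub>E n\<^esub> x"
  by (simp_all add: fixed_points_def)

lemma abelian_group_fixed_E: "abelian_group (fixed_E n)"
proof (rule abelian_groupI)
  fix x assume "x \<in> carrier (fixed_E n)"
  then show "\<exists>y\<in>carrier (fixed_E n). y \<oplus>\<^bsub>fixed_E n\<^esub> x = \<zero>\<^bsub>fixed_E n\<^esub>"
    by (intro bexI[of _ "\<ominus>\<^bsub>E n\<^esub> x"]) (auto simp: carrier_fixed_E E.M.l_neg)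
qed (auto simp: carrier_fixed_E E.M.a_ac)

lemma \<delta>_fixed_E: "abelian_group_hom (fixed_E n) (fixed_E (Suc n)) (\<delta> n)"
  by (intro abelian_group_hom_additiveI abelian_group_fixed_E)
    (auto simp: carrier_fixed_E \<delta>.equivariant [symmetric])

lemma smult_fixed_E:
  assumes "s \<in> carrier S"
  shows "abelian_group_hom (fixed_E n) (fixed_E n) (\<lambda>x. gr.single s \<one>\<^bsub>G\<^esub> \<odot>\<^bsub>E n\<^esub> x)"
proof -
  interpret s: equivariant_hom G "E n" "E n" "act_E n" "act_E n" "\<lambda>x. gr.single s \<one>\<^bsub>G\<^esub> \<odot>\<^bsub>E n\<^esub> x"
    by (rule smult_equivariant[OF assms])
  show ?thesis
    by (intro abelian_group_hom_additiveI abelian_group_fixed_E)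
      (auto simp: carrier_fixed_E s.equivariant [symmetric])
qed

lemma smult_\<delta>:
  assumes "s \<in> carrier S" "x \<in> carrier (E n)"
  shows "gr.single s \<one>\<^bsub>G\<^esub> \<odot>\<^bsub>E (Suc n)\<^esub> \<delta> n x = \<delta> n (gr.single s \<one>\<^bsub>G\<^esub> \<odot>\<^bsub>E n\<^esub> x)"
  using \<delta>_hom[of n] assms by (auto simp: left_module_hom_def)

lemma mem_annihilator_group_cohomology:
  "s \<in> annihilator S (group_cohomology S G E \<delta> i) \<longleftrightarrow> s \<in> carrier S \<and>
    (\<forall>z\<in>cocycles fixed_E \<delta> i. gr.single s \<one>\<^bsub>G\<^esub> \<odot>\<^bsub>E i\<^esub> z \<in> coboundaries fixed_E \<delta> i)"
proof -
  have "annihilator S (cohomology fixed_E \<delta> i) =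
    {s \<in> carrier S. \<forall>z\<in>cocycles fixed_E \<delta> i. s \<odot>\<^bsub>fixed_E i\<^esub> z \<in> coboundaries fixed_E \<delta> i}"
  proof (rule annihilator_cohomology[OF abelian_group_fixed_E])
    show "additive_subgroup (coboundaries fixed_E \<delta> i) (fixed_E i)"
    proof (cases i)
      case 0
      interpret abelian_group "fixed_E 0" by (rule abelian_group_fixed_E)
      show ?thesis
        unfolding 0 using add.triv_subgroup by (simp add: additive_subgroup_def del: fixed_E_ops)
    next
      case (Suc n)
      interpret abelian_group_hom "fixed_E n" "fixed_E (Suc n)" "\<delta> n" by (rule \<delta>_fixed_E)
      show ?thesis
        unfolding Suc using group_hom.img_is_subgroup[OF a_group_hom]
        by (simp add: additive_subgroup_def)
    qed
    fix s x assume s: "s \<in> carrier S" and x: "x \<in> coboundaries fixed_E \<delta> i"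
    show "s \<odot>\<^bsub>fixed_E i\<^esub> x \<in> coboundaries fixed_E \<delta> i"
    proof (cases i)
      case 0
      then show ?thesis
        using x abelian_group_hom.hom_zero[OF smult_fixed_E[OF s, of 0]] by simp
    next
      case (Suc n)
      then obtain y where "y \<in> carrier (fixed_E n)" "x = \<delta> n y" using x by auto
      then have "s \<odot>\<^bsub>fixed_E i\<^esub> x = \<delta> n (s \<odot>\<^bsub>fixed_E n\<^esub> y)" "s \<odot>\<^bsub>fixed_E n\<^esub> y \<in> carrier (fixed_E n)"
        using s Suc abelian_group_hom.hom_closed[OF smult_fixed_E[OF s, of n]]
        by (auto simp: smult_\<delta> carrier_fixed_E)
      then show ?thesis using Suc by auto
    qed
  qed (auto simp: cocycles_def smult_fixed_E)
  then show ?thesis by (simp add: group_cohomology_def)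
qed

context
  fixes s assumes s: "s \<in> carrier S"
begin

interpretation D: double_complex "\<lambda>p q. cochains G (E q) (act_E q) (Suc p)"
  "\<lambda>p q. cochain_d G (E q) (Suc p)" "\<lambda>p q f gs. \<delta> q (f gs)"
  "\<lambda>p q f gs. gr.single s \<one>\<^bsub>G\<^esub> \<odot>\<^bsub>E q\<^esub> f gs"
  by (rule double_complex_E[OF s])

lemma zero_cochains: "\<zero>\<^bsub>cochains G M a n\<^esub> = (\<lambda>_. \<zero>\<^bsub>M\<^esub>)"
  by (simp add: cochains_def)

text \<open>
  An element at \<open>p = 0\<close> that the vertical map kills is a constant cochain whose value is a fixed point, so
  this edge is the complex of fixed points.
\<close>
lemma h_killed_iff:
  "D.h_killed 0 n \<longleftrightarrow>
    (\<forall>z\<in>cocycles fixed_E \<delta> (Suc n). gr.single s \<one>\<^bsub>G\<^esub> \<odot>\<^bsub>E (Suc n)\<^esub> z \<in> coboundaries fixed_E \<delta> (Suc n))"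
proof
  assume killed: "D.h_killed 0 n"
  show "\<forall>z\<in>cocycles fixed_E \<delta> (Suc n). gr.single s \<one>\<^bsub>G\<^esub> \<odot>\<^bsub>E (Suc n)\<^esub> z \<in> coboundaries fixed_E \<delta> (Suc n)"
  proof
    fix z assume "z \<in> cocycles fixed_E \<delta> (Suc n)"
    then have z: "z \<in> carrier (E (Suc n))" "\<And>g. g \<in> carrier G \<Longrightarrow> act_E (Suc n) g z = z"
      and \<delta>z: "\<delta> (Suc n) z = \<zero>\<^bsub>E (Suc (Suc n))\<^esub>"
      by (auto simp: cocycles_def carrier_fixed_E)
    let ?b = "constant_cochain G (E (Suc n)) z"
    have "(\<lambda>gs. \<delta> (Suc n) (?b gs)) = (\<lambda>_. \<zero>\<^bsub>E (Suc (Suc n))\<^esub>)"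
      using \<delta>z by (auto simp: constant_cochain_def)
    then obtain a where a: "a \<in> carrier (cochains G (E n) (act_E n) (Suc 0))"
      "cochain_d G (E n) (Suc 0) a = (\<lambda>_. \<zero>\<^bsub>E n\<^esub>)"
      "(\<lambda>gs. gr.single s \<one>\<^bsub>G\<^esub> \<odot>\<^bsub>E (Suc n)\<^esub> ?b gs) = (\<lambda>gs. \<delta> n (a gs))"
      using killed aE.constant_cochain_closed[OF z] aE.cochain_d_constant_cochain[OF z(1)]
      unfolding D.h_killed_def zero_cochains by blast
    have "gr.single s \<one>\<^bsub>G\<^esub> \<odot>\<^bsub>E (Suc n)\<^esub> z = \<delta> n (a [\<one>\<^bsub>G\<^esub>])"
      using fun_cong[OF a(3), of "[\<one>\<^bsub>G\<^esub>]"] by (simp add: constant_cochain_def)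
    moreover have "a [\<one>\<^bsub>G\<^esub>] \<in> carrier (fixed_E n)"
      using aE.cocycle_1_constant(1,2)[OF a(1,2)] by (simp add: carrier_fixed_E)
    ultimately show "gr.single s \<one>\<^bsub>G\<^esub> \<odot>\<^bsub>E (Suc n)\<^esub> z \<in> coboundaries fixed_E \<delta> (Suc n)"
      by simp
  qed
next
  assume *: "\<forall>z\<in>cocycles fixed_E \<delta> (Suc n). gr.single s \<one>\<^bsub>G\<^esub> \<odot>\<^bsub>E (Suc n)\<^esub> z \<in> coboundaries fixed_E \<delta> (Suc n)"
  show "D.h_killed 0 n"
    unfolding D.h_killed_def zero_cochains
  proof (intro ballI impI)
    fix b assume b: "b \<in> carrier (cochains G (E (Suc n)) (act_E (Suc n)) (Suc 0))"
      "cochain_d G (E (Suc n)) (Suc 0) b = (\<lambda>_. \<zero>\<^bsub>E (Suc n)\<^esub>)"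
      "(\<lambda>gs. \<delta> (Suc n) (b gs)) = (\<lambda>_. \<zero>\<^bsub>E (Suc (Suc n))\<^esub>)"
    define z where "z = b [\<one>\<^bsub>G\<^esub>]"
    have bz: "b = constant_cochain G (E (Suc n)) z"
      unfolding z_def by (rule aE.cocycle_1_constant(3)[OF b(1,2)])
    have "z \<in> cocycles fixed_E \<delta> (Suc n)"
      using aE.cocycle_1_constant(1,2)[OF b(1,2)] fun_cong[OF b(3), of "[\<one>\<^bsub>G\<^esub>]"]
      by (simp add: cocycles_def carrier_fixed_E z_def)
    then obtain y where y: "y \<in> carrier (fixed_E n)"
      "gr.single s \<one>\<^bsub>G\<^esub> \<odot>\<^bsub>E (Suc n)\<^esub> z = \<delta> n y"
      using * by auto
    have yE: "y \<in> carrier (E n)" "\<And>g. g \<in> carrier G \<Longrightarrow> act_E n g y = y"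
      using y(1) by (auto simp: carrier_fixed_E)
    have "(\<lambda>gs. gr.single s \<one>\<^bsub>G\<^esub> \<odot>\<^bsub>E (Suc n)\<^esub> b gs) = (\<lambda>gs. \<delta> n (constant_cochain G (E n) y gs))"
      using y(2) abelian_group_hom.hom_zero[OF smult_fixed_E[OF s, of "Suc n"]]
      by (auto simp: bz constant_cochain_def)
    then show "\<exists>a\<in>carrier (cochains G (E n) (act_E n) (Suc 0)).
        cochain_d G (E n) (Suc 0) a = (\<lambda>_. \<zero>\<^bsub>E n\<^esub>) \<and>
        (\<lambda>gs. gr.single s \<one>\<^bsub>G\<^esub> \<odot>\<^bsub>E (Suc n)\<^esub> b gs) = (\<lambda>gs. \<delta> n (a gs))"
      using aE.constant_cochain_closed[OF yE] aE.cochain_d_constant_cochain[OF yE(1)] by blast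
  qed
qed

lemma \<epsilon>_mult:
  assumes "r \<in> carrier R"
  shows "\<epsilon> (s \<otimes> r) = gr.single s \<one>\<^bsub>G\<^esub> \<odot>\<^bsub>E 0\<^esub> \<epsilon> r"
  using \<epsilon>_smult[OF s _ assms, of "\<one>\<^bsub>G\<^esub>"] act_one[OF assms] by simp

lemma \<epsilon>_eq_iff: "x \<in> carrier R \<Longrightarrow> y \<in> carrier R \<Longrightarrow> \<epsilon> x = \<epsilon> y \<longleftrightarrow> x = y"
  using inj_\<epsilon> by (auto dest: inj_onD)

lemma \<epsilon>_cochain_eqD:
  assumes "\<And>gs. x gs \<in> carrier R" "\<And>gs. y gs \<in> carrier R" "(\<lambda>gs. \<epsilon> (x gs)) = (\<lambda>gs. \<epsilon> (y gs))"
  shows "x = y"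
  using assms by (auto simp: fun_eq_iff \<epsilon>_eq_iff)

lemma lift_kernel_cochain:
  assumes "b \<in> carrier (cochains G (E 0) (act_E 0) (Suc n))"
    and "(\<lambda>gs. \<delta> 0 (b gs)) = (\<lambda>_. \<zero>\<^bsub>E (Suc 0)\<^esub>)"
  obtains f where "f \<in> carrier (cochains G R act (Suc n))" "b = (\<lambda>gs. \<epsilon> (f gs))"
proof -
  have "b gs \<in> \<epsilon> ` carrier R" for gs
    unfolding \<epsilon>_exact using assms by (auto simp: cochains_def fun_eq_iff)
  then show thesis using \<epsilon>.cochain_lift[OF assms(1)] that by blast
qed

lemma \<delta>_\<epsilon>_cochain:
  assumes "\<And>gs. f gs \<in> carrier R"
  shows "(\<lambda>gs. \<delta> 0 (\<epsilon> (f gs))) = (\<lambda>_. \<zero>\<^bsub>E (Suc 0)\<^esub>)"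
  using assms \<epsilon>_exact by (auto simp: fun_eq_iff)

text \<open>
  An element at \<open>q = 0\<close> that the horizontal map kills has its values in the image of \<open>\<epsilon>\<close>, so this edge is the
  complex of cochains with values in \<open>R\<close>.
\<close>
lemma v_killed_iff: "D.v_killed n 0 \<longleftrightarrow> kills_cochain_cohomology s n"
proof
  assume killed: "D.v_killed n 0"
  show "kills_cochain_cohomology s n"
    unfolding kills_cochain_cohomology_def
  proof (intro ballI impI)
    fix f assume f: "f \<in> carrier (cochains G R act (Suc (Suc n)))"
      and df: "cochain_d G R (Suc (Suc n)) f = (\<lambda>_. \<zero>)"
    have fR: "f gs \<in> carrier R" for gs using f by (simp add: cochains_def)
    have "cochain_d G (E 0) (Suc (Suc n)) (\<lambda>gs. \<epsilon> (f gs)) = (\<lambda>_. \<zero>\<^bsub>E 0\<^esub>)"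
      using \<epsilon>.cochain_map_cochain_d[OF f] df by simp
    then obtain a where a: "a \<in> carrier (cochains G (E 0) (act_E 0) (Suc n))"
      "(\<lambda>gs. \<delta> 0 (a gs)) = (\<lambda>_. \<zero>\<^bsub>E (Suc 0)\<^esub>)"
      "(\<lambda>gs. gr.single s \<one>\<^bsub>G\<^esub> \<odot>\<^bsub>E 0\<^esub> \<epsilon> (f gs)) = cochain_d G (E 0) (Suc n) a"
      using killed abelian_group_hom.hom_closed[OF \<epsilon>.cochain_map_hom f] \<delta>_\<epsilon>_cochain[of f, OF fR]
      unfolding D.v_killed_def zero_cochains by blast
    obtain f' where f': "f' \<in> carrier (cochains G R act (Suc n))" "a = (\<lambda>gs. \<epsilon> (f' gs))"
      using lift_kernel_cochain[OF a(1,2)] .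
    have "(\<lambda>gs. \<epsilon> (s \<otimes> f gs)) = (\<lambda>gs. \<epsilon> (cochain_d G R (Suc n) f' gs))"
      using a(3) f'(2) \<epsilon>.cochain_map_cochain_d[OF f'(1)] fR by (simp add: \<epsilon>_mult)
    then have "(\<lambda>gs. s \<otimes> f gs) = cochain_d G R (Suc n) f'"
      using fR S_subset[OF s] aR.cochain_d_closed[OF f'(1)]
      by (intro \<epsilon>_cochain_eqD) (simp_all add: cochains_def)
    then show "(\<lambda>gs. s \<otimes> f gs) \<in> cobounding (Suc n)"
      using f'(1) by blast
  qed
next
  assume killed: "kills_cochain_cohomology s n"
  show "D.v_killed n 0"
    unfolding D.v_killed_def zero_cochains
  proof (intro ballI impI)
    fix b assume b: "b \<in> carrier (cochains G (E 0) (act_E 0) (Suc (Suc n)))"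
      "cochain_d G (E 0) (Suc (Suc n)) b = (\<lambda>_. \<zero>\<^bsub>E 0\<^esub>)"
      "(\<lambda>gs. \<delta> 0 (b gs)) = (\<lambda>_. \<zero>\<^bsub>E (Suc 0)\<^esub>)"
    obtain f where f: "f \<in> carrier (cochains G R act (Suc (Suc n)))" "b = (\<lambda>gs. \<epsilon> (f gs))"
      using lift_kernel_cochain[OF b(1,3)] .
    have fR: "f gs \<in> carrier R" for gs using f by (simp add: cochains_def)
    have "(\<lambda>gs. \<epsilon> (cochain_d G R (Suc (Suc n)) f gs)) = (\<lambda>gs. \<epsilon> \<zero>)"
      using b(2) f(2) \<epsilon>.cochain_map_cochain_d[OF f(1)] by simp
    then have "cochain_d G R (Suc (Suc n)) f = (\<lambda>_. \<zero>)"
      using aR.cochain_d_closed[OF f(1)] by (intro \<epsilon>_cochain_eqD) (simp_all add: cochains_def)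
    then obtain f' where f': "f' \<in> carrier (cochains G R act (Suc n))"
      "(\<lambda>gs. s \<otimes> f gs) = cochain_d G R (Suc n) f'"
      using killed f(1) unfolding kills_cochain_cohomology_def by blast
    have f'R: "f' gs \<in> carrier R" for gs using f' by (simp add: cochains_def)
    have "(\<lambda>gs. gr.single s \<one>\<^bsub>G\<^esub> \<odot>\<^bsub>E 0\<^esub> b gs) = (\<lambda>gs. \<epsilon> (s \<otimes> f gs))"
      using f(2) fR by (simp add: \<epsilon>_mult)
    also have "\<dots> = (\<lambda>gs. \<epsilon> (cochain_d G R (Suc n) f' gs))"
      using fun_cong[OF f'(2)] by simp
    also have "\<dots> = cochain_d G (E 0) (Suc n) (\<lambda>gs. \<epsilon> (f' gs))"
      by (rule \<epsilon>.cochain_map_cochain_d[OF f'(1)])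
    finally show "\<exists>a\<in>carrier (cochains G (E 0) (act_E 0) (Suc n)).
        (\<lambda>gs. \<delta> 0 (a gs)) = (\<lambda>_. \<zero>\<^bsub>E (Suc 0)\<^esub>) \<and>
        (\<lambda>gs. gr.single s \<one>\<^bsub>G\<^esub> \<odot>\<^bsub>E 0\<^esub> b gs) = cochain_d G (E 0) (Suc n) a"
      using abelian_group_hom.hom_closed[OF \<epsilon>.cochain_map_hom f'(1)] \<delta>_\<epsilon>_cochain[of f', OF f'R]
      by (intro bexI[of _ "\<lambda>gs. \<epsilon> (f' gs)"] conjI) simp_all
  qed
qed

lemma annihilates_iff_kills_cochain_cohomology:
  "s \<in> annihilator S (group_cohomology S G E \<delta> (Suc n)) \<longleftrightarrow> kills_cochain_cohomology s n"
  using s by (simp add: mem_annihilator_group_cohomology h_killed_iff [symmetric]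
      D.h_killed_iff_v_killed_edge v_killed_iff del: coboundaries.simps)

end

theorem annihilator_group_cohomology_Suc:
  "annihilator S (group_cohomology S G E \<delta> (Suc n)) = {s \<in> carrier S. kills_cochain_cohomology s n}"
  using annihilates_iff_kills_cochain_cohomology mem_annihilator_group_cohomology by blast

text \<open>
  The fixed points in the kernel of \<open>\<delta> 0\<close> include \<open>\<epsilon> 1\<close>, and an element that kills \<open>\<epsilon> 1\<close> is zero because \<open>\<epsilon>\<close> is
  injective.
\<close>
lemma annihilator_group_cohomology_0:
  "annihilator S (group_cohomology S G E \<delta> 0) = {\<zero>}"
proof -
  have zero: "\<zero> \<in> carrier S" using gr.S.zero_closed by simp
  have "gr.single \<zero> \<one>\<^bsub>G\<^esub> \<odot>\<^bsub>E 0\<^esub> z = \<zero>\<^bsub>E 0\<^esub>" if "z \<in> cocycles fixed_E \<delta> 0" for z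
  proof -
    have "z \<in> \<epsilon> ` carrier R"
      unfolding \<epsilon>_exact using that by (simp add: cocycles_def carrier_fixed_E)
    then show ?thesis using \<epsilon>_mult[OF zero] by auto
  qed
  moreover have "s = \<zero>"
    if s: "s \<in> carrier S"
      and kills: "\<And>z. z \<in> cocycles fixed_E \<delta> 0 \<Longrightarrow> gr.single s \<one>\<^bsub>G\<^esub> \<odot>\<^bsub>E 0\<^esub> z = \<zero>\<^bsub>E 0\<^esub>" for s
  proof -
    have "\<epsilon> \<one> \<in> {x \<in> carrier (E 0). \<delta> 0 x = \<zero>\<^bsub>E (Suc 0)\<^esub>}"
      unfolding \<epsilon>_exact [symmetric] by simp
    moreover have "act_E 0 g (\<epsilon> \<one>) = \<epsilon> \<one>" if "g \<in> carrier G" for g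
      using \<epsilon>.equivariant[OF that, of "\<one>"] ring_hom_one[OF act_ring_hom[OF that]] by simp
    ultimately have "gr.single s \<one>\<^bsub>G\<^esub> \<odot>\<^bsub>E 0\<^esub> \<epsilon> \<one> = \<zero>\<^bsub>E 0\<^esub>"
      by (intro kills) (simp add: cocycles_def carrier_fixed_E)
    then have "\<epsilon> s = \<epsilon> \<zero>"
      using \<epsilon>_mult[OF s, of "\<one>"] S_subset[OF s] by simp
    then show ?thesis using \<epsilon>_eq_iff[OF s S_subset[OF s] R.zero_closed] by blast
  qed
  ultimately have "s \<in> annihilator S (group_cohomology S G E \<delta> 0) \<longleftrightarrow> s = \<zero>" for s
    unfolding mem_annihilator_group_cohomology coboundaries.simps fixed_E_ops
    using zero by blast
  then show ?thesis by blast
qed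

end

section \<open>Polynomial rings and symmetric algebras\<close>

lemma poly_mapping_sum_single:
  "f = (\<Sum>x\<in>Poly_Mapping.keys f. Poly_Mapping.single x (Poly_Mapping.lookup f x))"
proof (rule poly_mapping_eqI)
  fix y
  have "(\<Sum>x\<in>Poly_Mapping.keys f. Poly_Mapping.lookup f x when x = y) = Poly_Mapping.lookup f y"
    by (cases "y \<in> Poly_Mapping.keys f") (auto simp: when_def in_keys_iff if_distrib cong: if_cong)
  then show "Poly_Mapping.lookup f y =
      Poly_Mapping.lookup (\<Sum>x\<in>Poly_Mapping.keys f. Poly_Mapping.single x (Poly_Mapping.lookup f x)) y"
    by (simp add: lookup_sum lookup_single)
qed

lemma mpoly_ring_simps [simp]:
  "monoid.mult (mpoly_ring X) = (*)" "\<one>\<^bsub>mpoly_ring X\<^esub> = 1" "\<zero>\<^bsub>mpoly_ring X\<^esub> = 0" "add (mpoly_ring X) = (+)"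
  by (simp_all add: mpoly_ring_def)

lemma carrier_mpoly_ring:
  "f \<in> carrier (mpoly_ring X) \<longleftrightarrow> (\<forall>m\<in>Poly_Mapping.keys f. Poly_Mapping.keys m \<subseteq> X)"
  by (simp add: mpoly_ring_def)

lemma mpoly_add_closed:
  "f \<in> carrier (mpoly_ring X) \<Longrightarrow> g \<in> carrier (mpoly_ring X) \<Longrightarrow> f + g \<in> carrier (mpoly_ring X)"
  using keys_add[of f g] by (auto simp: carrier_mpoly_ring)

lemma mpoly_mult_closed:
  assumes "f \<in> carrier (mpoly_ring X)" "g \<in> carrier (mpoly_ring X)"
  shows "f * g \<in> carrier (mpoly_ring X)"
  unfolding carrier_mpoly_ring
proof
  fix m assume "m \<in> Poly_Mapping.keys (f * g)"
  then obtain a b where ab: "m = a + b" "a \<in> Poly_Mapping.keys f" "b \<in> Poly_Mapping.keys g"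
    using keys_mult[of f g] by blast
  moreover have "Poly_Mapping.keys a \<subseteq> X" "Poly_Mapping.keys b \<subseteq> X"
    using ab assms by (simp_all add: carrier_mpoly_ring)
  ultimately show "Poly_Mapping.keys m \<subseteq> X"
    using keys_add[of a b] by blast
qed

lemma mpoly_const_closed [simp]: "mpoly_const c \<in> carrier (mpoly_ring X)"
  by (simp add: carrier_mpoly_ring mpoly_const_def)

lemma mpoly_zero_closed [simp]: "0 \<in> carrier (mpoly_ring X)"
  and mpoly_one_closed [simp]: "1 \<in> carrier (mpoly_ring X)"
  by (simp_all add: carrier_mpoly_ring)

lemma mpoly_var_closed: "x \<in> X \<Longrightarrow> mpoly_var x \<in> carrier (mpoly_ring X)"
  by (simp add: carrier_mpoly_ring mpoly_var_def)

lemma mpoly_uminus_closed: "f \<in> carrier (mpoly_ring X) \<Longrightarrow> - f \<in> carrier (mpoly_ring X)"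
  by (simp add: carrier_mpoly_ring in_keys_iff)

lemma cring_mpoly_ring: "cring (mpoly_ring X :: ('x, 'k::field) mpoly ring)"
proof (rule cringI)
  show "abelian_group (mpoly_ring X :: ('x, 'k) mpoly ring)"
  proof (rule abelian_groupI)
    fix f :: "('x, 'k) mpoly" assume "f \<in> carrier (mpoly_ring X)"
    then show "\<exists>g\<in>carrier (mpoly_ring X). g \<oplus>\<^bsub>mpoly_ring X\<^esub> f = \<zero>\<^bsub>mpoly_ring X\<^esub>"
      by (intro bexI[of _ "- f"]) (simp_all add: mpoly_uminus_closed)
  qed (auto simp: mpoly_add_closed add_ac)
  show "Group.comm_monoid (mpoly_ring X :: ('x, 'k) mpoly ring)"
    by (intro comm_monoidI) (auto simp: mpoly_mult_closed mult_ac)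
qed (simp add: distrib_right)

lemma mpoly_single_induct [consumes 1, case_names single add]:
  assumes f: "f \<in> carrier (mpoly_ring X)"
    and single: "\<And>m c. Poly_Mapping.keys m \<subseteq> X \<Longrightarrow> P (Poly_Mapping.single m c)"
    and add: "\<And>f g. f \<in> carrier (mpoly_ring X) \<Longrightarrow> g \<in> carrier (mpoly_ring X) \<Longrightarrow> P f \<Longrightarrow> P g \<Longrightarrow> P (f + g)"
  shows "P f"
proof -
  have "P (\<Sum>m\<in>A. Poly_Mapping.single m (c m)) \<and>
      (\<Sum>m\<in>A. Poly_Mapping.single m (c m)) \<in> carrier (mpoly_ring X)"
    if "finite A" "\<And>m. m \<in> A \<Longrightarrow> Poly_Mapping.keys m \<subseteq> X" for A and c :: "('a \<Rightarrow>\<^sub>0 nat) \<Rightarrow> 'b"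
    using that
  proof (induction A rule: finite_induct)
    case empty
    then show ?case using single[of 0 0] by (simp add: carrier_mpoly_ring)
  next
    case (insert m A)
    have "Poly_Mapping.single m (c m) \<in> carrier (mpoly_ring X)"
      using insert.prems by (simp add: carrier_mpoly_ring)
    then show ?case using insert by (auto intro: add single mpoly_add_closed)
  qed
  from this[of "Poly_Mapping.keys f" "Poly_Mapping.lookup f"] show ?thesis
    using f poly_mapping_sum_single[of f] by (simp add: carrier_mpoly_ring)
qed

lemma mpoly_induct [consumes 1, case_names const var add mult]:
  assumes f: "f \<in> carrier (mpoly_ring X)"
    and const: "\<And>c. P (mpoly_const c)"
    and var: "\<And>x. x \<in> X \<Longrightarrow> P (mpoly_var x)"
    and add: "\<And>f g. f \<in> carrier (mpoly_ring X) \<Longrightarrow> g \<in> carrier (mpoly_ring X) \<Longrightarrow> P f \<Longrightarrow> P g \<Longrightarrow> P (f + g)"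
    and mult: "\<And>f g. f \<in> carrier (mpoly_ring X) \<Longrightarrow> g \<in> carrier (mpoly_ring X) \<Longrightarrow> P f \<Longrightarrow> P g \<Longrightarrow> P (f * g)"
  shows "P f"
  using f
proof (induction rule: mpoly_single_induct)
  case (single m c)
  define Q where "Q f \<longleftrightarrow> P f \<and> f \<in> carrier (mpoly_ring X)" for f
  have Q_mult: "Q (f * g)" if "Q f" "Q g" for f g
    using that by (auto simp: Q_def mult mpoly_mult_closed)
  have Q_const: "Q (mpoly_const c)" for c by (simp add: Q_def const)
  have Q_power: "Q (Poly_Mapping.single (Poly_Mapping.single x n) 1)" if "x \<in> X" for x n
  proof (induction n)
    case 0
    show ?case using Q_const[of 1] by (simp add: mpoly_const_def)
  next
    case (Suc n)
    have "Poly_Mapping.single (Poly_Mapping.single x (Suc n)) 1 =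
        (mpoly_var x :: ('a, 'b) mpoly) * Poly_Mapping.single (Poly_Mapping.single x n) 1"
      by (simp add: mpoly_var_def mult_single single_add [symmetric])
    moreover have "Q (mpoly_var x)" using that by (simp add: Q_def var mpoly_var_closed)
    ultimately show ?case using Suc by (simp add: Q_mult)
  qed
  have "Q (Poly_Mapping.single (\<Sum>x\<in>A. Poly_Mapping.single x (n x)) 1)"
    if "finite A" "A \<subseteq> X" for A and n :: "'a \<Rightarrow> nat"
    using that
  proof (induction A rule: finite_induct)
    case empty
    show ?case using Q_const[of 1] by (simp add: mpoly_const_def)
  next
    case (insert x A)
    then have "Q (Poly_Mapping.single (Poly_Mapping.single x (n x)) 1 *
        Poly_Mapping.single (\<Sum>x\<in>A. Poly_Mapping.single x (n x)) 1)"
      by (intro Q_mult Q_power) auto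
    then show ?case using insert by (simp add: mult_single)
  qed
  from this[of "Poly_Mapping.keys m" "Poly_Mapping.lookup m"]
  have "Q (Poly_Mapping.single m 1)"
    using single poly_mapping_sum_single[of m] by simp
  with Q_const[of c] have "Q (mpoly_const c * Poly_Mapping.single m 1)" by (rule Q_mult)
  then show ?case by (simp add: Q_def mpoly_const_def mult_single)
qed (rule add)

definition mpoly_monomial_eval ::
  "('b, 'm) ring_scheme \<Rightarrow> ('x \<Rightarrow> 'b) \<Rightarrow> ('x \<Rightarrow>\<^sub>0 nat) \<Rightarrow> 'b"
  where "mpoly_monomial_eval B \<phi> m =
    (\<Otimes>\<^bsub>B\<^esub>x\<in>Poly_Mapping.keys m. \<phi> x [^]\<^bsub>B\<^esub> Poly_Mapping.lookup m x)"

definition mpoly_eval ::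
  "('b, 'm) ring_scheme \<Rightarrow> ('k \<Rightarrow> 'b) \<Rightarrow> ('x \<Rightarrow> 'b) \<Rightarrow> ('x, 'k::field) mpoly \<Rightarrow> 'b"
  where "mpoly_eval B \<kappa> \<phi> f =
    (\<Oplus>\<^bsub>B\<^esub>m\<in>Poly_Mapping.keys f. \<kappa> (Poly_Mapping.lookup f m) \<otimes>\<^bsub>B\<^esub> mpoly_monomial_eval B \<phi> m)"

locale field_algebra = B?: cring B
  for B :: "('b, 'm) ring_scheme" (structure) and \<kappa> :: "'k::field \<Rightarrow> 'b" +
  assumes \<kappa>_closed [simp]: "\<kappa> c \<in> carrier B"
    and \<kappa>_add: "\<kappa> (c + d) = \<kappa> c \<oplus> \<kappa> d"
    and \<kappa>_mult: "\<kappa> (c * d) = \<kappa> c \<otimes> \<kappa> d"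
    and \<kappa>_one: "\<kappa> 1 = \<one>"
begin

lemma \<kappa>_zero: "\<kappa> 0 = \<zero>"
  using \<kappa>_add[of 0 0] by (simp add: B.add.l_cancel_one)

context
  fixes X :: "'x set" and \<phi> :: "'x \<Rightarrow> 'b"
  assumes \<phi>: "\<And>x. x \<in> X \<Longrightarrow> \<phi> x \<in> carrier B"
begin

lemma monomial_eval_superset:
  assumes "finite A" "Poly_Mapping.keys m \<subseteq> A" "A \<subseteq> X"
  shows "mpoly_monomial_eval B \<phi> m = (\<Otimes>x\<in>A. \<phi> x [^] Poly_Mapping.lookup m x)"
  unfolding mpoly_monomial_eval_def
  by (rule B.finprod_mono_neutral_cong_left) (use assms \<phi> in \<open>auto simp: in_keys_iff\<close>)

lemma monomial_eval_closed:
  assumes "Poly_Mapping.keys m \<subseteq> X"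
  shows "mpoly_monomial_eval B \<phi> m \<in> carrier B"
  unfolding mpoly_monomial_eval_def using assms \<phi> by (auto intro!: B.finprod_closed)

lemma monomial_eval_add:
  assumes "Poly_Mapping.keys m \<subseteq> X" "Poly_Mapping.keys m' \<subseteq> X"
  shows "mpoly_monomial_eval B \<phi> (m + m') = mpoly_monomial_eval B \<phi> m \<otimes> mpoly_monomial_eval B \<phi> m'"
proof -
  let ?A = "Poly_Mapping.keys m \<union> Poly_Mapping.keys m'"
  have "mpoly_monomial_eval B \<phi> (m + m') = (\<Otimes>x\<in>?A. \<phi> x [^] Poly_Mapping.lookup (m + m') x)"
    using assms keys_add[of m m'] by (intro monomial_eval_superset) auto
  also have "\<dots> = (\<Otimes>x\<in>?A. (\<phi> x [^] Poly_Mapping.lookup m x) \<otimes> (\<phi> x [^] Poly_Mapping.lookup m' x))"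
    using assms \<phi> by (intro B.finprod_cong') (auto simp: lookup_add B.nat_pow_mult)
  also have "\<dots> = (\<Otimes>x\<in>?A. \<phi> x [^] Poly_Mapping.lookup m x) \<otimes> (\<Otimes>x\<in>?A. \<phi> x [^] Poly_Mapping.lookup m' x)"
    using assms \<phi> by (intro B.finprod_multf) auto
  finally show ?thesis
    using assms by (simp add: monomial_eval_superset[of ?A])
qed

lemma eval_superset:
  assumes "f \<in> carrier (mpoly_ring X)" "finite A" "Poly_Mapping.keys f \<subseteq> A"
    "\<And>m. m \<in> A \<Longrightarrow> Poly_Mapping.keys m \<subseteq> X"
  shows "mpoly_eval B \<kappa> \<phi> f = (\<Oplus>m\<in>A. \<kappa> (Poly_Mapping.lookup f m) \<otimes> mpoly_monomial_eval B \<phi> m)"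
  unfolding mpoly_eval_def
  by (rule B.add.finprod_mono_neutral_cong_left)
    (use assms in \<open>auto simp: in_keys_iff \<kappa>_zero monomial_eval_closed\<close>)

lemma eval_closed:
  assumes "f \<in> carrier (mpoly_ring X)"
  shows "mpoly_eval B \<kappa> \<phi> f \<in> carrier B"
  unfolding mpoly_eval_def using assms
  by (auto simp: carrier_mpoly_ring monomial_eval_closed intro!: B.finsum_closed)

lemma eval_add:
  assumes f: "f \<in> carrier (mpoly_ring X)" and g: "g \<in> carrier (mpoly_ring X)"
  shows "mpoly_eval B \<kappa> \<phi> (f + g) = mpoly_eval B \<kappa> \<phi> f \<oplus> mpoly_eval B \<kappa> \<phi> g"
proof -
  let ?A = "Poly_Mapping.keys f \<union> Poly_Mapping.keys g"
  have A: "Poly_Mapping.keys m \<subseteq> X" if "m \<in> ?A" for m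
    using that f g by (auto simp: carrier_mpoly_ring)
  have "mpoly_eval B \<kappa> \<phi> (f + g) =
      (\<Oplus>m\<in>?A. \<kappa> (Poly_Mapping.lookup (f + g) m) \<otimes> mpoly_monomial_eval B \<phi> m)"
    using A keys_add[of f g] mpoly_add_closed[OF f g] by (intro eval_superset) auto
  also have "\<dots> = (\<Oplus>m\<in>?A. \<kappa> (Poly_Mapping.lookup f m) \<otimes> mpoly_monomial_eval B \<phi> m
      \<oplus> \<kappa> (Poly_Mapping.lookup g m) \<otimes> mpoly_monomial_eval B \<phi> m)"
    using A by (intro B.finsum_cong')
      (auto simp: lookup_add \<kappa>_add B.l_distr monomial_eval_closed)
  also have "\<dots> = (\<Oplus>m\<in>?A. \<kappa> (Poly_Mapping.lookup f m) \<otimes> mpoly_monomial_eval B \<phi> m) \<oplus>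
      (\<Oplus>m\<in>?A. \<kappa> (Poly_Mapping.lookup g m) \<otimes> mpoly_monomial_eval B \<phi> m)"
    using A by (intro B.finsum_addf) (auto simp: monomial_eval_closed)
  also have "(\<Oplus>m\<in>?A. \<kappa> (Poly_Mapping.lookup f m) \<otimes> mpoly_monomial_eval B \<phi> m) = mpoly_eval B \<kappa> \<phi> f"
    by (rule eval_superset [OF f _ _ A, symmetric]) auto
  also have "(\<Oplus>m\<in>?A. \<kappa> (Poly_Mapping.lookup g m) \<otimes> mpoly_monomial_eval B \<phi> m) = mpoly_eval B \<kappa> \<phi> g"
    by (rule eval_superset [OF g _ _ A, symmetric]) auto
  finally show ?thesis .
qed

lemma eval_single:
  assumes "Poly_Mapping.keys m \<subseteq> X"
  shows "mpoly_eval B \<kappa> \<phi> (Poly_Mapping.single m c) = \<kappa> c \<otimes> mpoly_monomial_eval B \<phi> m"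
  using eval_superset[of "Poly_Mapping.single m c" "{m}"] assms
  by (simp add: carrier_mpoly_ring monomial_eval_closed)

lemma eval_mult:
  assumes f: "f \<in> carrier (mpoly_ring X)" and g: "g \<in> carrier (mpoly_ring X)"
  shows "mpoly_eval B \<kappa> \<phi> (f * g) = mpoly_eval B \<kappa> \<phi> f \<otimes> mpoly_eval B \<kappa> \<phi> g"
  using f
proof (induction rule: mpoly_single_induct)
  case (single m c)
  have c: "Poly_Mapping.single m c \<in> carrier (mpoly_ring X)"
    using single by (simp add: carrier_mpoly_ring)
  show ?case
    using g
  proof (induction rule: mpoly_single_induct)
    case (single m' d)
    have "Poly_Mapping.keys (m + m') \<subseteq> X"
      using keys_add[of m m'] single \<open>Poly_Mapping.keys m \<subseteq> X\<close> by blast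
    then show ?case
      using single \<open>Poly_Mapping.keys m \<subseteq> X\<close>
      by (simp add: mult_single eval_single monomial_eval_add monomial_eval_closed \<kappa>_mult B.m_ac)
  next
    case (add g h)
    then show ?case
      using c by (simp add: distrib_left eval_add mpoly_mult_closed B.r_distr eval_closed)
  qed
next
  case (add f h)
  then show ?case
    using g by (simp add: distrib_right eval_add mpoly_mult_closed B.l_distr eval_closed)
qed

lemma eval_const: "mpoly_eval B \<kappa> \<phi> (mpoly_const c) = \<kappa> c"
  by (simp add: mpoly_const_def eval_single) (simp add: mpoly_monomial_eval_def)

lemma eval_var: "x \<in> X \<Longrightarrow> mpoly_eval B \<kappa> \<phi> (mpoly_var x) = \<phi> x"
  using \<phi>[of x] by (simp add: mpoly_var_def eval_single \<kappa>_one) (simp add: mpoly_monomial_eval_def)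

lemma eval_ring_hom: "mpoly_eval B \<kappa> \<phi> \<in> ring_hom (mpoly_ring X) B"
  using eval_const[of 1]
  by (intro ring_hom_memI) (simp_all add: eval_closed eval_mult eval_add \<kappa>_one mpoly_const_def)

end

end

text \<open>
  Closure under the vector space operations ensures that the relations that define the symmetric algebra
  lie in the polynomial ring on \<open>W\<close>.
\<close>
locale function_space =
  fixes W :: "('v \<Rightarrow> 'k::field) set"
  assumes add_closed: "l \<in> W \<Longrightarrow> m \<in> W \<Longrightarrow> (\<lambda>v. l v + m v) \<in> W"
    and scale_closed: "l \<in> W \<Longrightarrow> (\<lambda>v. c * l v) \<in> W"
begin

sublocale MP: cring "mpoly_ring W" by (rule cring_mpoly_ring)

lemma mpoly_minus: "f \<in> carrier (mpoly_ring W) \<Longrightarrow> g \<in> carrier (mpoly_ring W) \<Longrightarrow> f \<ominus>\<^bsub>mpoly_ring W\<^esub> g = f - g"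
proof -
  assume f: "f \<in> carrier (mpoly_ring W)" and g: "g \<in> carrier (mpoly_ring W)"
  have "\<ominus>\<^bsub>mpoly_ring W\<^esub> g = - g"
    by (rule MP.minus_equality) (simp_all add: g mpoly_uminus_closed)
  then show ?thesis by (simp add: a_minus_def)
qed

lemma sym_relations_subset: "sym_relations W \<subseteq> carrier (mpoly_ring W)"
proof -
  have "f - g \<in> carrier (mpoly_ring W)" if "f \<in> carrier (mpoly_ring W)" "g \<in> carrier (mpoly_ring W)"
    for f g :: "('v \<Rightarrow> 'k, 'k) mpoly"
    using mpoly_add_closed[OF that(1) mpoly_uminus_closed[OF that(2)]] by simp
  then show ?thesis
    by (auto simp: sym_relations_def mpoly_var_closed mpoly_mult_closed add_closed scale_closed)
qed

sublocale I: ideal "sym_ideal W" "mpoly_ring W"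
  unfolding sym_ideal_def by (rule MP.genideal_ideal[OF sym_relations_subset])

lemma cring_sym_alg: "cring (sym_alg W)"
  unfolding sym_alg_def by (rule I.quotient_is_cring[OF cring_mpoly_ring])

sublocale Sym: cring "sym_alg W" by (rule cring_sym_alg)

abbreviation cls where "cls f \<equiv> sym_ideal W +>\<^bsub>mpoly_ring W\<^esub> f"

lemma carrier_sym_alg: "carrier (sym_alg W) = cls ` carrier (mpoly_ring W)"
  by (auto simp: sym_alg_def FactRing_def A_RCOSETS_def')

lemma cls_closed: "f \<in> carrier (mpoly_ring W) \<Longrightarrow> cls f \<in> carrier (sym_alg W)"
  by (simp add: carrier_sym_alg)

lemma cls_add: "f \<in> carrier (mpoly_ring W) \<Longrightarrow> g \<in> carrier (mpoly_ring W) \<Longrightarrow>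
    cls (f + g) = cls f \<oplus>\<^bsub>sym_alg W\<^esub> cls g"
  by (simp add: sym_alg_def FactRing_def I.a_rcos_sum)

lemma cls_mult: "f \<in> carrier (mpoly_ring W) \<Longrightarrow> g \<in> carrier (mpoly_ring W) \<Longrightarrow>
    cls (f * g) = cls f \<otimes>\<^bsub>sym_alg W\<^esub> cls g"
  by (simp add: sym_alg_def FactRing_def I.rcoset_mult_add)

lemma cls_one: "cls 1 = \<one>\<^bsub>sym_alg W\<^esub>"
  by (simp add: sym_alg_def FactRing_def)

lemma cls_eq:
  assumes "f \<in> carrier (mpoly_ring W)" "g \<in> carrier (mpoly_ring W)" "f - g \<in> sym_ideal W"
  shows "cls f = cls g"
  using MP.quotient_eq_iff_same_a_r_cos[OF I.ideal_axioms assms(1,2)] assms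
  by (simp add: mpoly_minus)

lemma sym_const_closed [simp]: "sym_const W c \<in> carrier (sym_alg W)"
  by (simp add: sym_const_def cls_closed)

lemma sym_gen_closed [simp]: "l \<in> W \<Longrightarrow> sym_gen W l \<in> carrier (sym_alg W)"
  by (simp add: sym_gen_def cls_closed mpoly_var_closed)

lemma sym_const_algebra: "field_algebra (sym_alg W) (sym_const W)"
proof (intro field_algebra.intro field_algebra_axioms.intro cring_sym_alg)
  show "sym_const W (c + d) = sym_const W c \<oplus>\<^bsub>sym_alg W\<^esub> sym_const W d" for c d
    using cls_add[of "mpoly_const c" "mpoly_const d"]
    by (simp add: sym_const_def) (simp add: mpoly_const_def single_add)
  show "sym_const W (c * d) = sym_const W c \<otimes>\<^bsub>sym_alg W\<^esub> sym_const W d" for c d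
    using cls_mult[of "mpoly_const c" "mpoly_const d"]
    by (simp add: sym_const_def) (simp add: mpoly_const_def mult_single)
  show "sym_const W 1 = \<one>\<^bsub>sym_alg W\<^esub>"
    unfolding sym_const_def mpoly_const_def by (simp add: cls_one)
qed simp

lemma relation_in_ideal: "f \<in> sym_relations W \<Longrightarrow> f \<in> sym_ideal W"
  unfolding sym_ideal_def using MP.genideal_self[OF sym_relations_subset] by blast

lemma sym_gen_add:
  assumes "l \<in> W" "m \<in> W"
  shows "sym_gen W (\<lambda>v. l v + m v) = sym_gen W l \<oplus>\<^bsub>sym_alg W\<^esub> sym_gen W m"
proof -
  have "mpoly_var (\<lambda>v. l v + m v) - (mpoly_var l + mpoly_var m) \<in> sym_ideal W"
    using assms by (intro relation_in_ideal) (auto simp: sym_relations_def diff_diff_add)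
  then have "cls (mpoly_var (\<lambda>v. l v + m v)) = cls (mpoly_var l + mpoly_var m)"
    using assms by (intro cls_eq) (simp_all add: mpoly_var_closed add_closed mpoly_add_closed)
  then show ?thesis
    using assms by (simp add: sym_gen_def cls_add mpoly_var_closed)
qed

lemma sym_gen_scale:
  assumes "l \<in> W"
  shows "sym_gen W (\<lambda>v. c * l v) = sym_const W c \<otimes>\<^bsub>sym_alg W\<^esub> sym_gen W l"
proof -
  have "mpoly_var (\<lambda>v. c * l v) - mpoly_const c * mpoly_var l \<in> sym_ideal W"
    using assms by (intro relation_in_ideal) (auto simp: sym_relations_def)
  then have "cls (mpoly_var (\<lambda>v. c * l v)) = cls (mpoly_const c * mpoly_var l)"
    using assms by (intro cls_eq) (simp_all add: mpoly_var_closed scale_closed mpoly_mult_closed)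
  then show ?thesis
    using assms by (simp add: sym_gen_def sym_const_def cls_mult mpoly_var_closed)
qed

text \<open>
  The symmetric algebra is generated by constants and linear forms. This serves as the uniqueness part of
  the universal property and as the means to check identities between homomorphisms.
\<close>
lemma sym_induct [consumes 1, case_names const gen add mult]:
  assumes f: "f \<in> carrier (sym_alg W)"
    and const: "\<And>c. P (sym_const W c)"
    and gen: "\<And>l. l \<in> W \<Longrightarrow> P (sym_gen W l)"
    and add: "\<And>f g. f \<in> carrier (sym_alg W) \<Longrightarrow> g \<in> carrier (sym_alg W) \<Longrightarrow> P f \<Longrightarrow> P g \<Longrightarrow>
      P (f \<oplus>\<^bsub>sym_alg W\<^esub> g)"
    and mult: "\<And>f g. f \<in> carrier (sym_alg W) \<Longrightarrow> g \<in> carrier (sym_alg W) \<Longrightarrow> P f \<Longrightarrow> P g \<Longrightarrow>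
      P (f \<otimes>\<^bsub>sym_alg W\<^esub> g)"
  shows "P f"
proof -
  obtain f' where f': "f = cls f'" "f' \<in> carrier (mpoly_ring W)"
    using f by (auto simp: carrier_sym_alg)
  from f'(2) have "P (cls f')"
  proof (induction rule: mpoly_induct)
    case (const c) show ?case using assms(2) by (simp add: sym_const_def)
  next
    case (var l) then show ?case using gen by (simp add: sym_gen_def)
  next
    case (add f g) then show ?case using assms(4) by (simp add: cls_add cls_closed)
  next
    case (mult f g) then show ?case using assms(5) by (simp add: cls_mult cls_closed)
  qed
  then show ?thesis using f'(1) by simp
qed

text \<open>
  The universal property of the symmetric algebra. Evaluation of polynomials kills the relations, because
  \<open>\<phi>\<close> is linear, and so it factors through the quotient.
\<close>
lemma sym_lift:
  assumes B: "field_algebra B \<kappa>"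
    and \<phi>: "\<And>l. l \<in> W \<Longrightarrow> \<phi> l \<in> carrier B"
    and \<phi>_add: "\<And>l m. l \<in> W \<Longrightarrow> m \<in> W \<Longrightarrow> \<phi> (\<lambda>v. l v + m v) = \<phi> l \<oplus>\<^bsub>B\<^esub> \<phi> m"
    and \<phi>_scale: "\<And>c l. l \<in> W \<Longrightarrow> \<phi> (\<lambda>v. c * l v) = \<kappa> c \<otimes>\<^bsub>B\<^esub> \<phi> l"
  shows "sym_lift W B \<kappa> \<phi> \<in> ring_hom (sym_alg W) B"
    and "sym_lift W B \<kappa> \<phi> (sym_const W c) = \<kappa> c"
    and "l \<in> W \<Longrightarrow> sym_lift W B \<kappa> \<phi> (sym_gen W l) = \<phi> l"
proof -
  interpret B: field_algebra B \<kappa> by (rule B)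
  define ev where "ev = mpoly_eval B \<kappa> \<phi>"
  have ev_hom: "ev \<in> ring_hom (mpoly_ring W) B"
    unfolding ev_def by (rule B.eval_ring_hom[OF \<phi>])
  interpret ev: ring_hom_ring "mpoly_ring W" B ev
    by (intro ring_hom_ringI2 MP.ring_axioms B.ring_axioms ev_hom)
  have ev_var: "ev (mpoly_var l) = \<phi> l" if "l \<in> W" for l
    unfolding ev_def by (rule B.eval_var[OF \<phi> that])
  have ev_const: "ev (mpoly_const c) = \<kappa> c" for c
    unfolding ev_def by (rule B.eval_const[OF \<phi>])
  have ev_minus: "ev (f - g) = ev f \<ominus>\<^bsub>B\<^esub> ev g"
    if "f \<in> carrier (mpoly_ring W)" "g \<in> carrier (mpoly_ring W)" for f g
    using that ev.hom_add[OF that(1) MP.a_inv_closed[OF that(2)]] ev.hom_a_inv[OF that(2)]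
    by (simp add: mpoly_minus [symmetric] a_minus_def)
  have "sym_relations W \<subseteq> a_kernel (mpoly_ring W) B ev"
  proof
    fix f assume "f \<in> sym_relations W"
    then consider (add) l m where "f = mpoly_var (\<lambda>v. l v + m v) - (mpoly_var l + mpoly_var m)" "l \<in> W" "m \<in> W"
      | (scale) c l where "f = mpoly_var (\<lambda>v. c * l v) - mpoly_const c * mpoly_var l" "l \<in> W"
      by (auto simp: sym_relations_def diff_diff_add)
    then have "ev f = \<zero>\<^bsub>B\<^esub>"
    proof cases
      case add
      have "ev (mpoly_var l + mpoly_var m) = ev (mpoly_var l) \<oplus>\<^bsub>B\<^esub> ev (mpoly_var m)"
        using ev.hom_add[OF mpoly_var_closed[OF add(2)] mpoly_var_closed[OF add(3)]] by simp
      also have "\<dots> = ev (mpoly_var (\<lambda>v. l v + m v))"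
        by (simp only: ev_var add(2,3) add_closed \<phi>_add)
      finally have eq: "ev (mpoly_var (\<lambda>v. l v + m v)) = ev (mpoly_var l + mpoly_var m)" ..
      have "ev f = ev (mpoly_var (\<lambda>v. l v + m v)) \<ominus>\<^bsub>B\<^esub> ev (mpoly_var l + mpoly_var m)"
        unfolding add(1) by (intro ev_minus mpoly_add_closed mpoly_var_closed add_closed add(2,3))
      then show ?thesis
        unfolding eq
        using B.minus_self[OF ev.hom_closed[OF mpoly_add_closed[OF mpoly_var_closed[OF add(2)] mpoly_var_closed[OF add(3)]]]]
        by simp
    next
      case scale
      have "ev (mpoly_const c * mpoly_var l) = ev (mpoly_const c) \<otimes>\<^bsub>B\<^esub> ev (mpoly_var l)"
        using ev.hom_mult[OF mpoly_const_closed mpoly_var_closed[OF scale(2)]] by simp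
      also have "\<dots> = ev (mpoly_var (\<lambda>v. c * l v))"
        by (simp only: ev_var ev_const scale(2) scale_closed \<phi>_scale)
      finally have eq: "ev (mpoly_var (\<lambda>v. c * l v)) = ev (mpoly_const c * mpoly_var l)" ..
      have "ev f = ev (mpoly_var (\<lambda>v. c * l v)) \<ominus>\<^bsub>B\<^esub> ev (mpoly_const c * mpoly_var l)"
        unfolding scale(1)
        by (intro ev_minus mpoly_mult_closed mpoly_const_closed mpoly_var_closed scale_closed scale(2))
      then show ?thesis
        unfolding eq
        using B.minus_self[OF ev.hom_closed[OF mpoly_mult_closed[OF mpoly_const_closed mpoly_var_closed[OF scale(2)]]]]
        by simp
    qed
    then show "f \<in> a_kernel (mpoly_ring W) B ev"
      using sym_relations_subset \<open>f \<in> sym_relations W\<close> unfolding a_kernel_def' by blast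
  qed
  then have ker: "sym_ideal W \<subseteq> a_kernel (mpoly_ring W) B ev"
    unfolding sym_ideal_def by (rule MP.genideal_minimal[OF ev.kernel_is_ideal])
  have ev_cls: "the_elem (ev ` cls f) = ev f" if f: "f \<in> carrier (mpoly_ring W)" for f
  proof -
    have "ev ` cls f = {ev f}"
    proof -
      have "ev g = ev f" if g: "g \<in> cls f" for g
      proof -
        obtain i where i: "i \<in> sym_ideal W" "g = i \<oplus>\<^bsub>mpoly_ring W\<^esub> f"
          using g unfolding a_r_coset_def' by blast
        then have iC: "i \<in> carrier (mpoly_ring W)" and i0: "ev i = \<zero>\<^bsub>B\<^esub>"
          using ker unfolding a_kernel_def' by blast+
        have "ev g = \<zero>\<^bsub>B\<^esub> \<oplus>\<^bsub>B\<^esub> ev f"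
          unfolding i(2) ev.hom_add[OF iC f] i0 ..
        then show ?thesis using B.l_zero[OF ev.hom_closed[OF f]] by simp
      qed
      moreover have "f \<in> cls f" using f by (rule I.a_rcos_self)
      ultimately show ?thesis by blast
    qed
    then show ?thesis by simp
  qed
  define h where "h = (\<lambda>X\<in>carrier (sym_alg W). the_elem (ev ` X))"
  have h_cls: "h (cls f) = ev f" if "f \<in> carrier (mpoly_ring W)" for f
    using that by (simp add: h_def ev_cls cls_closed)
  let ?spec = "\<lambda>h. h \<in> ring_hom (sym_alg W) B \<and> h \<in> extensional (carrier (sym_alg W)) \<and>
    (\<forall>c. h (sym_const W c) = \<kappa> c) \<and> (\<forall>l\<in>W. h (sym_gen W l) = \<phi> l)"
  have h_spec: "?spec h"
  proof (intro conjI allI ballI)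
    show "h \<in> ring_hom (sym_alg W) B"
    proof (rule ring_hom_memI)
      fix x y assume "x \<in> carrier (sym_alg W)" "y \<in> carrier (sym_alg W)"
      then obtain f g where x: "x = cls f" "f \<in> carrier (mpoly_ring W)"
        and y: "y = cls g" "g \<in> carrier (mpoly_ring W)" by (auto simp: carrier_sym_alg)
      show "h x \<in> carrier B" using x by (simp add: h_cls)
      show "h (x \<oplus>\<^bsub>sym_alg W\<^esub> y) = h x \<oplus>\<^bsub>B\<^esub> h y"
        using x y ev.hom_add[of f g] by (simp add: h_cls cls_add [symmetric] mpoly_add_closed)
      show "h (x \<otimes>\<^bsub>sym_alg W\<^esub> y) = h x \<otimes>\<^bsub>B\<^esub> h y"
        using x y ev.hom_mult[of f g] by (simp add: h_cls cls_mult [symmetric] mpoly_mult_closed)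
    next
      show "h \<one>\<^bsub>sym_alg W\<^esub> = \<one>\<^bsub>B\<^esub>"
        using ev.hom_one by (simp add: cls_one [symmetric] h_cls)
    qed
    show "h (sym_const W c) = \<kappa> c" for c by (simp add: sym_const_def h_cls ev_const)
    show "h (sym_gen W l) = \<phi> l" if "l \<in> W" for l
      using that by (simp add: sym_gen_def h_cls ev_var mpoly_var_closed)
  qed (simp add: h_def)
  have "h' = h" if h': "?spec h'" for h'
  proof
    fix x show "h' x = h x"
    proof (cases "x \<in> carrier (sym_alg W)")
      case True
      then show ?thesis
      proof (induction rule: sym_induct)
        case (add f g)
        then show ?case
          using h' h_spec ring_hom_add[of h' "sym_alg W" B] ring_hom_add[of h "sym_alg W" B] by simp
      next
        case (mult f g)
        then show ?case
          using h' h_spec ring_hom_mult[of h' "sym_alg W" B] ring_hom_mult[of h "sym_alg W" B] by simp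
      qed (use h' h_spec in simp_all)
    next
      case False
      then show ?thesis using h' h_spec by (simp add: extensional_def)
    qed
  qed
  with h_spec have "?spec (sym_lift W B \<kappa> \<phi>)"
    unfolding sym_lift_def by (rule theI2) blast+
  then show "sym_lift W B \<kappa> \<phi> \<in> ring_hom (sym_alg W) B"
    and "sym_lift W B \<kappa> \<phi> (sym_const W c) = \<kappa> c"
    and "l \<in> W \<Longrightarrow> sym_lift W B \<kappa> \<phi> (sym_gen W l) = \<phi> l"
    by simp_all
qed

end

section \<open>Frobenius and Steenrod operations\<close>

lemma finite_field_power_CARD: "(x::'k::{field,finite}) ^ CARD('k) = x"
proof (cases "x = 0")
  case False
  have "(\<Prod>y\<in>UNIV - {0}. x * y) = (\<Prod>y\<in>UNIV - {0}. y)"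
    by (rule prod.reindex_bij_witness[of _ "\<lambda>y. y / x" "\<lambda>y. x * y"]) (use False in auto)
  then have "x ^ (CARD('k) - 1) * \<Prod>(UNIV - {0}) = \<Prod>(UNIV - {0} :: 'k set)"
    by (simp add: prod.distrib)
  then have "x ^ (CARD('k) - 1) = 1" by simp
  moreover have "CARD('k) = Suc (CARD('k) - 1)" by simp
  ultimately show ?thesis by (metis mult.right_neutral power_Suc)
qed simp

text \<open>
  The characteristic of the field divides its cardinality \<open>p ^ e\<close>, so it is \<open>p\<close>, and the power map is an
  iterate of the Frobenius map.
\<close>
lemma mpoly_power_CARD_add:
  fixes f g :: "('x, 'k::{field,finite}) mpoly"
  assumes "prime p" "CARD('k) = p ^ e"
  shows "(f + g) ^ CARD('k) = f ^ CARD('k) + g ^ CARD('k)"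
proof -
  have prime_char: "prime CHAR('k)"
    by (rule prime_CHAR_semidom[OF finite_imp_CHAR_pos]) simp
  have "CHAR('k) dvd p ^ e" using CHAR_dvd_CARD[where ?'a = 'k] assms(2) by simp
  then have "CHAR('k) = p"
    using prime_char assms(1) prime_dvd_power primes_dvd_imp_eq by blast
  then have "of_nat p = (0 :: 'k)" by (metis of_nat_CHAR)
  then have "of_nat p = (0 :: ('x, 'k) mpoly)"
    by (metis single_of_nat single_zero)
  then have "CHAR(('x, 'k) mpoly) dvd p" by (simp add: of_nat_eq_0_iff_char_dvd)
  moreover have "CHAR(('x, 'k) mpoly) \<noteq> 1"
    using of_nat_CHAR[where ?'a = "('x, 'k) mpoly"] by auto
  ultimately have "CHAR(('x, 'k) mpoly) = p"
    using assms(1) by (metis prime_nat_iff)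
  then show ?thesis
    using freshmans_dream'[where ?'a = "('x, 'k) mpoly" and m = "CARD('k)" and n = e] assms by simp
qed

context function_space
begin

lemma mpoly_power_closed: "f \<in> carrier (mpoly_ring W) \<Longrightarrow> f ^ n \<in> carrier (mpoly_ring W)"
  by (induction n) (simp_all add: mpoly_mult_closed)

lemma cls_power:
  "f \<in> carrier (mpoly_ring W) \<Longrightarrow> cls (f ^ n) = cls f [^]\<^bsub>sym_alg W\<^esub> n"
  by (induction n) (simp_all add: cls_one cls_mult mpoly_power_closed mult.commute[of f])

end

locale linear_forms = vector_space scale
  for scale :: "'k::field \<Rightarrow> 'v::ab_group_add \<Rightarrow> 'v"
begin

lemma linear_inv_bij:
  assumes f: "Vector_Spaces.linear scale scale f" and bij: "bij f"
  shows "Vector_Spaces.linear scale scale (Hilbert_Choice.inv f)"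
proof -
  have "Hilbert_Choice.inv f (x + y) = Hilbert_Choice.inv f x + Hilbert_Choice.inv f y" for x y
    using f bij by (intro inv_f_eq) (auto simp: Vector_Spaces.linear_iff bij_def surj_f_inv_f)
  moreover have "Hilbert_Choice.inv f (scale c x) = scale c (Hilbert_Choice.inv f x)" for c x
    using f bij by (intro inv_f_eq) (auto simp: Vector_Spaces.linear_iff bij_def surj_f_inv_f)
  ultimately show ?thesis using f by (simp add: Vector_Spaces.linear_iff)
qed

lemma group_general_linear_group: "group (general_linear_group scale)"
proof (rule groupI)
  fix f assume f: "f \<in> carrier (general_linear_group scale)"
  then have "Hilbert_Choice.inv f \<in> carrier (general_linear_group scale)"
    by (simp add: general_linear_group_def linear_inv_bij bij_imp_bij_inv)
  moreover have "Hilbert_Choice.inv f \<circ> f = id"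
    using f by (simp add: general_linear_group_def bij_is_inj)
  ultimately show "\<exists>g\<in>carrier (general_linear_group scale).
      g \<otimes>\<^bsub>general_linear_group scale\<^esub> f = \<one>\<^bsub>general_linear_group scale\<^esub>"
    by (intro bexI) (simp_all add: general_linear_group_def)
next
  show "\<one>\<^bsub>general_linear_group scale\<^esub> \<in> carrier (general_linear_group scale)"
    using vector_space_axioms by (simp add: general_linear_group_def Vector_Spaces.linear_iff)
qed (auto simp: general_linear_group_def Vector_Spaces.linear_iff intro: bij_comp)

lemma linear_form_iff:
  "l \<in> dual_space scale \<longleftrightarrow> (\<forall>x y. l (x + y) = l x + l y) \<and> (\<forall>c x. l (scale c x) = c * l x)"
proof -
  have "vector_space ((*) :: 'k \<Rightarrow> 'k \<Rightarrow> 'k)"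
    by unfold_locales (simp_all add: algebra_simps)
  then show ?thesis
    using vector_space_axioms by (simp add: dual_space_def Vector_Spaces.linear_iff)
qed

sublocale dual: function_space "dual_space scale"
  by unfold_locales (auto simp: linear_form_iff algebra_simps)

lemma dual_space_comp:
  assumes "l \<in> dual_space scale" "Vector_Spaces.linear scale scale g"
  shows "l \<circ> g \<in> dual_space scale"
  using assms by (simp add: linear_form_iff Vector_Spaces.linear_iff)

lemma polys_act_spec:
  assumes g: "g \<in> carrier (general_linear_group scale)"
  shows "polys_act scale g \<in> ring_hom (polys scale) (polys scale)"
    and "polys_act scale g (sym_const (dual_space scale) c) = sym_const (dual_space scale) c"
    and "l \<in> dual_space scale \<Longrightarrow> polys_act scale g (sym_gen (dual_space scale) l) =
      sym_gen (dual_space scale) (l \<circ> Hilbert_Choice.inv g)"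
proof -
  have lin: "Vector_Spaces.linear scale scale (Hilbert_Choice.inv g)"
    using g by (simp add: general_linear_group_def linear_inv_bij)
  let ?\<phi> = "\<lambda>l. sym_gen (dual_space scale) (l \<circ> Hilbert_Choice.inv g)"
  have 1: "?\<phi> l \<in> carrier (sym_alg (dual_space scale))" if "l \<in> dual_space scale" for l
    using that lin by (simp add: dual_space_comp)
  have 2: "?\<phi> (\<lambda>v. l v + m v) = ?\<phi> l \<oplus>\<^bsub>sym_alg (dual_space scale)\<^esub> ?\<phi> m"
    if "l \<in> dual_space scale" "m \<in> dual_space scale" for l m
    using dual.sym_gen_add[OF dual_space_comp[OF that(1) lin] dual_space_comp[OF that(2) lin]]
    by (simp add: o_def)
  have 3: "?\<phi> (\<lambda>v. c * l v) = sym_const (dual_space scale) c \<otimes>\<^bsub>sym_alg (dual_space scale)\<^esub> ?\<phi> l"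
    if "l \<in> dual_space scale" for c l
    using dual.sym_gen_scale[OF dual_space_comp[OF that lin]] by (simp add: o_def)
  note lift = dual.sym_lift[OF dual.sym_const_algebra, of ?\<phi>, OF 1 2 3]
  show "polys_act scale g \<in> ring_hom (polys scale) (polys scale)"
    and "polys_act scale g (sym_const (dual_space scale) c) = sym_const (dual_space scale) c"
    and "l \<in> dual_space scale \<Longrightarrow> polys_act scale g (sym_gen (dual_space scale) l) = ?\<phi> l"
    unfolding polys_act_def polys_def by (rule lift; assumption?)+
qed

lemma polys_act_id:
  assumes "f \<in> carrier (polys scale)"
  shows "polys_act scale id f = f"
proof -
  define g :: "'v \<Rightarrow> 'v" where "g = id"
  have g: "g \<in> carrier (general_linear_group scale)"
    using monoid.one_closed[OF group.is_monoid[OF group_general_linear_group]]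
    by (simp add: general_linear_group_def g_def)
  have "Hilbert_Choice.inv g = id" by (simp add: g_def)
  then have comp: "l \<circ> Hilbert_Choice.inv g = l" for l :: "'v \<Rightarrow> 'k" by simp
  note spec = polys_act_spec[OF g, unfolded polys_def comp]
  show ?thesis
    using assms unfolding polys_def g_def [symmetric]
    by (induction rule: dual.sym_induct)
      (simp_all add: spec(2,3) ring_hom_add[OF spec(1)] ring_hom_mult[OF spec(1)])
qed

lemma polys_act_comp:
  assumes g: "g \<in> carrier (general_linear_group scale)" and h: "h \<in> carrier (general_linear_group scale)"
    and f: "f \<in> carrier (polys scale)"
  shows "polys_act scale (g \<circ> h) f = polys_act scale g (polys_act scale h f)"
proof -
  define k where "k = g \<circ> h"
  have k: "k \<in> carrier (general_linear_group scale)"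
    using monoid.m_closed[OF group.is_monoid[OF group_general_linear_group] g h]
    by (simp add: general_linear_group_def k_def)
  have "Hilbert_Choice.inv k = Hilbert_Choice.inv h \<circ> Hilbert_Choice.inv g"
    unfolding k_def using g h by (intro o_inv_distrib) (simp_all add: general_linear_group_def)
  then have inv: "l \<circ> Hilbert_Choice.inv k = (l \<circ> Hilbert_Choice.inv h) \<circ> Hilbert_Choice.inv g"
    for l :: "'v \<Rightarrow> 'k" by (simp only: o_assoc)
  have lin: "l \<circ> Hilbert_Choice.inv h \<in> dual_space scale" if "l \<in> dual_space scale" for l
    using that h by (intro dual_space_comp) (simp_all add: general_linear_group_def linear_inv_bij)
  note spec = polys_act_spec[OF g, unfolded polys_def] polys_act_spec[OF h, unfolded polys_def]
    polys_act_spec[OF k, unfolded polys_def inv]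
  show ?thesis
    using f unfolding polys_def k_def [symmetric]
  proof (induction rule: dual.sym_induct)
    case (const c)
    show ?case by (simp add: spec)
  next
    case (gen l)
    then show ?case by (simp add: spec lin)
  next
    case (add x y)
    then show ?case
      using ring_hom_closed[OF spec(4)]
      by (simp add: ring_hom_add[OF spec(1)] ring_hom_add[OF spec(4)] ring_hom_add[OF spec(7)])
  next
    case (mult x y)
    then show ?case
      using ring_hom_closed[OF spec(4)]
      by (simp add: ring_hom_mult[OF spec(1)] ring_hom_mult[OF spec(4)] ring_hom_mult[OF spec(7)])
  qed
qed

end

lemma (in finite_dimensional_vector_space) finite_UNIV_vectors:
  assumes "finite (UNIV :: 'a set)"
  shows "finite (UNIV :: 'b set)"
proof -
  have "UNIV = range (\<lambda>u. \<Sum>b\<in>Basis. scale (u b) b)"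
    using span_Basis span_finite[OF finite_Basis] by simp
  also have "\<dots> = (\<lambda>u. \<Sum>b\<in>Basis. scale (u b) b) ` (Basis \<rightarrow>\<^sub>E UNIV)"
  proof -
    have "(\<Sum>b\<in>Basis. scale (u b) b) \<in> (\<lambda>u. \<Sum>b\<in>Basis. scale (u b) b) ` (Basis \<rightarrow>\<^sub>E UNIV)" for u
      by (rule image_eqI[of _ _ "restrict u Basis"]) auto
    then show ?thesis by auto
  qed
  also have "finite \<dots>"
    using assms finite_Basis by (intro finite_imageI finite_PiE) auto
  finally show ?thesis .
qed

locale steenrod_algebra = linear_forms scale
  for scale :: "'k::{field,finite} \<Rightarrow> 'v::ab_group_add \<Rightarrow> 'v" +
  fixes p e :: nat
  assumes prime: "prime p" and card: "CARD('k) = p ^ e"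
begin

abbreviation W where "W \<equiv> dual_space scale"
abbreviation R where "R \<equiv> polys scale"

lemma R_def': "R = sym_alg W" by (simp add: polys_def)

sublocale R: cring R unfolding R_def' by (rule dual.cring_sym_alg)

sublocale UP: UP_cring R "UP R" by unfold_locales simp

lemma sym_gen_power_add:
  assumes "l \<in> W" "m \<in> W"
  shows "sym_gen W (\<lambda>v. l v + m v) [^]\<^bsub>R\<^esub> CARD('k) =
    sym_gen W l [^]\<^bsub>R\<^esub> CARD('k) \<oplus>\<^bsub>R\<^esub> sym_gen W m [^]\<^bsub>R\<^esub> CARD('k)"
proof -
  let ?q = "CARD('k)"
  have "sym_gen W (\<lambda>v. l v + m v) [^]\<^bsub>R\<^esub> ?q = dual.cls (mpoly_var l + mpoly_var m) [^]\<^bsub>R\<^esub> ?q"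
    using assms by (simp add: dual.sym_gen_add dual.cls_add mpoly_var_closed) (simp add: sym_gen_def)
  also have "\<dots> = dual.cls ((mpoly_var l + mpoly_var m) ^ ?q)"
    using assms by (simp add: R_def' dual.cls_power mpoly_add_closed mpoly_var_closed)
  also have "(mpoly_var l + mpoly_var m) ^ ?q = mpoly_var l ^ ?q + (mpoly_var m ^ ?q :: ('v \<Rightarrow> 'k, 'k) mpoly)"
    by (rule mpoly_power_CARD_add[OF prime card])
  also have "dual.cls (mpoly_var l ^ ?q + mpoly_var m ^ ?q) =
      sym_gen W l [^]\<^bsub>R\<^esub> ?q \<oplus>\<^bsub>R\<^esub> sym_gen W m [^]\<^bsub>R\<^esub> ?q"
    using assms
    by (simp add: R_def' dual.cls_add dual.cls_power mpoly_var_closed dual.mpoly_power_closed sym_gen_def)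
  finally show ?thesis .
qed

lemma sym_const_closed_R [simp]: "sym_const W c \<in> carrier R"
  and sym_gen_closed_R [simp]: "l \<in> W \<Longrightarrow> sym_gen W l \<in> carrier R"
  by (simp_all add: R_def')

lemma sym_gen_power_scale:
  assumes "l \<in> W"
  shows "sym_gen W (\<lambda>v. c * l v) [^]\<^bsub>R\<^esub> CARD('k) = sym_const W c \<otimes>\<^bsub>R\<^esub> (sym_gen W l [^]\<^bsub>R\<^esub> CARD('k))"
proof -
  interpret C: field_algebra R "sym_const W" unfolding R_def' by (rule dual.sym_const_algebra)
  have "sym_const W c [^]\<^bsub>R\<^esub> n = sym_const W (c ^ n)" for n :: nat
    by (induction n) (simp_all add: C.\<kappa>_one C.\<kappa>_mult [symmetric] mult.commute)
  then have "sym_const W c [^]\<^bsub>R\<^esub> CARD('k) = sym_const W c"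
    by (simp add: finite_field_power_CARD)
  then show ?thesis
    using assms dual.sym_gen_scale[OF assms, of c]
    by (simp add: R_def' [symmetric] R.nat_pow_distrib)
qed

text \<open>
  The map \<open>l \<mapsto> l + l\<^sup>q \<xi>\<close> is additive because \<open>q\<close> is a power of the characteristic, and it is homogeneous because
  \<open>c\<^sup>q = c\<close> in the field with \<open>q\<close> elements.
\<close>
lemma total_steenrod_spec:
  shows "total_steenrod scale \<in> ring_hom R (UP R)"
    and "total_steenrod scale (sym_const W c) = monom (UP R) (sym_const W c) 0"
    and "l \<in> W \<Longrightarrow> total_steenrod scale (sym_gen W l) = monom (UP R) (sym_gen W l) 0
      \<oplus>\<^bsub>UP R\<^esub> monom (UP R) (sym_gen W l [^]\<^bsub>R\<^esub> CARD('k)) 1"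
proof -
  let ?\<kappa> = "\<lambda>c. monom (UP R) (sym_const W c) 0"
  let ?\<phi> = "\<lambda>l. monom (UP R) (sym_gen W l) 0 \<oplus>\<^bsub>UP R\<^esub> monom (UP R) (sym_gen W l [^]\<^bsub>R\<^esub> CARD('k)) 1"
  interpret C: field_algebra R "sym_const W" unfolding R_def' by (rule dual.sym_const_algebra)
  have 0: "field_algebra (UP R) ?\<kappa>"
  proof (intro field_algebra.intro field_algebra_axioms.intro UP.UP_cring)
    show "?\<kappa> (c * d) = ?\<kappa> c \<otimes>\<^bsub>UP R\<^esub> ?\<kappa> d" for c d
      using UP.monom_mult[of "sym_const W c" "sym_const W d" 0 0] by (simp add: C.\<kappa>_mult)
  qed (simp_all add: C.\<kappa>_add C.\<kappa>_one)
  have 1: "?\<phi> l \<in> carrier (UP R)" if "l \<in> W" for l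
    using that by simp
  have 2: "?\<phi> (\<lambda>v. l v + m v) = ?\<phi> l \<oplus>\<^bsub>UP R\<^esub> ?\<phi> m" if "l \<in> W" "m \<in> W" for l m
    using that unfolding sym_gen_power_add[OF that] unfolding dual.sym_gen_add[OF that] R_def' [symmetric]
    by (simp add: UP.P.a_ac)
  have 3: "?\<phi> (\<lambda>v. c * l v) = ?\<kappa> c \<otimes>\<^bsub>UP R\<^esub> ?\<phi> l" if "l \<in> W" for c l
    unfolding sym_gen_power_scale[OF that] unfolding dual.sym_gen_scale[OF that] R_def' [symmetric]
    using that UP.monom_mult[of "sym_const W c" "sym_gen W l" 0 0]
      UP.monom_mult[of "sym_const W c" "sym_gen W l [^]\<^bsub>R\<^esub> CARD('k)" 0 1]
    by (simp add: UP.P.r_distr)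
  note lift = dual.sym_lift[OF 0, of ?\<phi>, OF 1 2 3]
  show "total_steenrod scale \<in> ring_hom R (UP R)"
    and "total_steenrod scale (sym_const W c) = ?\<kappa> c"
    and "l \<in> W \<Longrightarrow> total_steenrod scale (sym_gen W l) = ?\<phi> l"
    unfolding total_steenrod_def by (rule lift[folded R_def']; assumption?)+
qed

lemma total_steenrod_closed: "f \<in> carrier R \<Longrightarrow> total_steenrod scale f \<in> carrier (UP R)"
  by (rule ring_hom_closed[OF total_steenrod_spec(1)])

lemma steenrod_closed: "f \<in> carrier R \<Longrightarrow> steenrod scale m f \<in> carrier R"
  unfolding steenrod_def by (intro UP.coeff_closed total_steenrod_closed)

lemma steenrod_add:
  assumes "f \<in> carrier R" "g \<in> carrier R"
  shows "steenrod scale m (f \<oplus>\<^bsub>R\<^esub> g) = steenrod scale m f \<oplus>\<^bsub>R\<^esub> steenrod scale m g"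
  using assms by (simp add: steenrod_def ring_hom_add[OF total_steenrod_spec(1)] total_steenrod_closed)

text \<open>
  The Cartan formula is the multiplicativity of \<open>P(\<xi>)\<close>, read off from the coefficients.
\<close>
lemma steenrod_mult:
  assumes "f \<in> carrier R" "g \<in> carrier R"
  shows "steenrod scale m (f \<otimes>\<^bsub>R\<^esub> g) =
    (\<Oplus>\<^bsub>R\<^esub>a\<in>{..m}. steenrod scale a f \<otimes>\<^bsub>R\<^esub> steenrod scale (m - a) g)"
  using assms by (simp add: steenrod_def ring_hom_mult[OF total_steenrod_spec(1)] total_steenrod_closed)

lemma steenrod_const: "steenrod scale m (sym_const W c) = (if m = 0 then sym_const W c else \<zero>\<^bsub>R\<^esub>)"
  by (simp add: steenrod_def total_steenrod_spec(2))

lemma steenrod_gen: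
  assumes "l \<in> W"
  shows "steenrod scale m (sym_gen W l) = (if m = 0 then sym_gen W l
    else if m = 1 then sym_gen W l [^]\<^bsub>R\<^esub> CARD('k) else \<zero>\<^bsub>R\<^esub>)"
  using assms by (simp add: steenrod_def total_steenrod_spec(3))

lemma steenrod_0: "f \<in> carrier R \<Longrightarrow> steenrod scale 0 f = f"
  unfolding R_def'
  by (induction rule: dual.sym_induct)
    (simp_all add: steenrod_const steenrod_gen steenrod_add[unfolded R_def'] steenrod_mult[unfolded R_def'])

lemma steenrod_polys_act:
  assumes g: "g \<in> carrier (general_linear_group scale)" and f: "f \<in> carrier R"
  shows "steenrod scale m (polys_act scale g f) = polys_act scale g (steenrod scale m f)"
proof -
  note spec = polys_act_spec[OF g]
  interpret g: ring_hom_cring R R "polys_act scale g"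
    by (intro ring_hom_cring.intro ring_hom_cring_axioms.intro R.cring_axioms spec(1))
  have lin: "l \<circ> Hilbert_Choice.inv g \<in> W" if "l \<in> W" for l
    using that g by (intro dual_space_comp) (simp_all add: general_linear_group_def linear_inv_bij)
  have "\<forall>m. steenrod scale m (polys_act scale g f) = polys_act scale g (steenrod scale m f)"
    using f unfolding R_def'
  proof (induction rule: dual.sym_induct)
    case (const c)
    show ?case by (simp add: spec(2) steenrod_const)
  next
    case (gen l)
    then show ?case by (simp add: spec(3) steenrod_gen lin)
  next
    case (add x y)
    then show ?case
      unfolding R_def' [symmetric] by (simp add: steenrod_add steenrod_closed)
  next
    case (mult x y)
    then show ?case
      unfolding R_def' [symmetric]
      by (simp add: steenrod_mult steenrod_closed g.hom_finsum Pi_def o_def)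
  qed
  then show ?thesis by blast
qed

end

section \<open>Invariance of the annihilators\<close>

theorem proposition4p2:
  fixes scale :: "'k::{field,finite} \<Rightarrow> 'v::ab_group_add \<Rightarrow> 'v"
    and Basis :: "'v set" and p e q d i :: nat
    and H :: "('v \<Rightarrow> 'v) set"
    and E :: "nat \<Rightarrow> (('v \<Rightarrow> 'v) \<Rightarrow> ('v, 'k) sym, 'b) module"
    and \<epsilon> :: "('v, 'k) sym \<Rightarrow> 'b"
    and \<delta> :: "nat \<Rightarrow> 'b \<Rightarrow> 'b"
  defines "G \<equiv> (general_linear_group scale)\<lparr>carrier := H\<rparr>"
    and "R \<equiv> polys scale"
  defines "S \<equiv> invariant_ring R G (polys_act scale)"
  defines "J \<equiv> annihilator S (group_cohomology S G E \<delta> i)"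
  assumes "prime p" and "e > 0" and "q = p ^ e" and "CARD('k) = q"
    and "finite_dimensional_vector_space scale Basis"
    and "vector_space.dim scale (UNIV :: 'v set) = d"
    and "subgroup H (general_linear_group scale)"
    and "injective_resolution (group_ring S G) (group_ring_module R G (polys_act scale)) \<epsilon> E \<delta>"
  shows "ideal J S \<and> steenrod_invariant scale J"
proof -
  interpret V: finite_dimensional_vector_space scale Basis by (rule assms(9))
  interpret V: steenrod_algebra scale p e
    using assms(5,7,8) V.vector_space_axioms
    by (intro steenrod_algebra.intro steenrod_algebra_axioms.intro linear_forms.intro) simp_all
  have finite_V: "finite (UNIV :: 'v set)" by (rule V.finite_UNIV_vectors) simp
  have H: "H \<subseteq> carrier (general_linear_group scale)" by (rule subgroup.subset[OF assms(11)])
  have group_G: "group G"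
    unfolding G_def by (rule subgroup.subgroup_is_group[OF assms(11) V.group_general_linear_group])
  have G_simps: "carrier G = H" "\<one>\<^bsub>G\<^esub> = id" "\<And>g h. g \<otimes>\<^bsub>G\<^esub> h = g \<circ> h"
    by (simp_all add: G_def general_linear_group_def)
  have "ring_action R G (polys_act scale)"
    unfolding R_def
  proof (intro ring_action.intro ring_action_axioms.intro V.R.cring_axioms group_G)
    have "finite (PiE (UNIV :: 'v set) (\<lambda>_. UNIV :: 'v set))"
      by (intro finite_PiE finite_V)
    then have "finite (UNIV :: ('v \<Rightarrow> 'v) set)" by (simp add: PiE_UNIV_domain)
    then show "finite (carrier G)" by (rule finite_subset[rotated]) simp
    fix g h x assume g: "g \<in> carrier G" and h: "h \<in> carrier G" and x: "x \<in> carrier (polys scale)"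
    show "polys_act scale (g \<otimes>\<^bsub>G\<^esub> h) x = polys_act scale g (polys_act scale h x)"
      unfolding G_simps(3) using g h x H unfolding G_simps(1) by (intro V.polys_act_comp) auto
  next
    show "polys_act scale g \<in> ring_hom (polys scale) (polys scale)" if "g \<in> carrier G" for g
      using that H unfolding G_simps(1) by (intro V.polys_act_spec(1)) auto
    show "polys_act scale \<one>\<^bsub>G\<^esub> x = x" if "x \<in> carrier (polys scale)" for x
      unfolding G_simps(2) using that by (rule V.polys_act_id)
  qed
  then interpret res: resolved_ring_action R G "polys_act scale" \<epsilon> E \<delta>
    using assms(12)
    by (intro resolved_ring_action.intro resolved_ring_action_axioms.intro) (simp_all add: S_def)
  have P: "equivariant_hom G R R (polys_act scale) (polys_act scale) (steenrod scale m)" for m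
  proof (intro equivariant_hom.intro equivariant_hom_axioms.intro res.equivariant_group
      abelian_group_hom_additiveI res.R.is_abelian_group)
    fix g x assume "g \<in> carrier G" "x \<in> carrier R"
    then show "steenrod scale m (polys_act scale g x) = polys_act scale g (steenrod scale m x)"
      using H unfolding G_simps(1) R_def by (intro V.steenrod_polys_act) auto
  qed (simp_all add: R_def V.steenrod_closed V.steenrod_add)
  show ?thesis
  proof (cases i)
    case 0
    have J: "J = {\<zero>\<^bsub>R\<^esub>}"
      unfolding J_def S_def 0 by (rule res.annihilator_group_cohomology_0)
    have "ideal {\<zero>\<^bsub>S\<^esub>} S" unfolding S_def by (rule res.gr.S.zeroideal)
    moreover have "steenrod scale m \<zero>\<^bsub>R\<^esub> = \<zero>\<^bsub>R\<^esub>" for m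
      by (rule abelian_group_hom.hom_zero[OF equivariant_hom.axioms(3)[OF P]])
    ultimately show ?thesis
      by (simp add: J steenrod_invariant_def S_def)
  next
    case (Suc n)
    have J: "J = {s \<in> carrier S. res.kills_cochain_cohomology s n}"
      unfolding J_def S_def Suc by (rule res.annihilator_group_cohomology_Suc)
    have "ideal J S"
      unfolding J unfolding S_def by (rule res.ideal_kills_cochain_cohomology)
    moreover have "steenrod scale m s \<in> J" if "s \<in> J" for m s
    proof -
      have s: "s \<in> carrier (invariant_ring R G (polys_act scale))" "res.kills_cochain_cohomology s n"
        using that by (simp_all add: J S_def)
      have Cartan: "steenrod scale m (x \<otimes>\<^bsub>R\<^esub> y) =
          (\<Oplus>\<^bsub>R\<^esub>a\<in>{..m}. steenrod scale a x \<otimes>\<^bsub>R\<^esub> steenrod scale (m - a) y)"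
        if "x \<in> carrier R" "y \<in> carrier R" for m x y
        using that unfolding R_def by (rule V.steenrod_mult)
      have zero: "steenrod scale 0 x = x" if "x \<in> carrier R" for x
        using that unfolding R_def by (rule V.steenrod_0)
      show ?thesis
        using res.kills_cochain_cohomology_Cartan[OF P zero Cartan s, of m] by (simp add: J S_def)
    qed
    ultimately show ?thesis by (auto simp: steenrod_invariant_def)
  qed
qed

end
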